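(* Let $1\le r\le n$. For any finite dimensional $kE$-module $M$ and any integer $\ell$, $1\le\ell\le(p-1)r$, we have equalities of coherent $\mathcal O_{Gr}$-modules (as subsheaves of $M\otimes\mathcal O_{Gr}$) $$\mathcal{K}er^\ell(M)=\mathcal R(\operatorname{Ker}\{\widetilde\Theta^\ell,M\}),\qquad \mathcal{I}m^\ell(M)=\mathcal R(\operatorname{Im}\{\widetilde\Theta^\ell,M\}).$$
   Context: $k$ is an algebraically closed field of characteristic $p>0$, $E$ an elementary abelian $p$-group of rank $n\ge1$, $\mathbb V\subset\operatorname{Rad}(kE)$ a linear subspace with basis $x_1,\dots,x_n$ such that $\mathbb V\hookrightarrow\operatorname{Rad}(kE)\to\operatorname{Rad}(kE)/\operatorname{Rad}^2(kE)$ is an isomorphism; so $kE=k[x_1,\dots,x_n]/(x_i^p)$. Let $\mathbb M=M_{n,r}$ be the affine variety of $n\times r$ matrices, with coordinate ring $k[\mathbb M]=k[Y_{i,j}]_{1\le i\le n,1\le j\le r}$, and $\mathbb M^o\subset\mathbb M$ the open subvariety of matrices of rank $r$. Then $\operatorname{Grass}(r,\mathbb V)=\operatorname{Grass}_{n,r}\cong\mathbb M^o/\mathrm{GL}_r$ is the Grassmannian of $r$-dimensional subspaces of $\mathbb V$ (a matrix represents the span of its columns), with structure sheaf $\mathcal O_{Gr}$. Local construction. For $\Sigma=\{i_1<\dots<i_r\}\subset\{1,\dots,n\}$, $\mathcal U_\Sigma\subset\operatorname{Grass}_{n,r}$ is the affine open subset of those $U$ represented by matrices whose $\Sigma$-submatrix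 (rows indexed by $\Sigma$) is invertible; each such $U$ has a unique representative with $\Sigma$-submatrix the identity, and $k[\mathcal U_\Sigma]=k[Y^\Sigma_{i,j}]_{i\notin\Sigma,1\le j\le r}$ where $Y^\Sigma_{i,j}$ is the $(i,j)$ entry of this representative; also $Y^\Sigma_{i_j,j}=1$ and $Y^\Sigma_{i_{j'},j}=0$ for $j'\ne j$. Let $\theta^\Sigma_j(m\otimes f)=\sum_{i=1}^n x_im\otimes Y^\Sigma_{i,j}f$ on $M\otimes k[\mathcal U_\Sigma]$. $\mathcal{K}er^\ell(M)$ and $\mathcal{I}m^\ell(M)$ are the unique subsheaves of $M\otimes\mathcal O_{Gr}$ whose restrictions to each $\mathcal U_\Sigma$ are $\bigcap_{1\le j_1,\dots,j_\ell\le r}\ker(\theta^\Sigma_{j_1}\cdots\theta^\Sigma_{j_\ell})$ and $\sum_{1\le j_1,\dots,j_\ell\le r}\operatorname{im}(\theta^\Sigma_{j_1}\cdots\theta^\Sigma_{j_\ell})$ respectively. Descent construction. On $\widetilde M=M\otimes k[Y_{i,j}]$ define $k[Y_{i,j}]$-linear commuting operators $\widetilde\theta_j(m\otimes f)=\sum_{i=1}^n x_im\otimes Y_{i,j}f$, $1\le j\le r$. $\operatorname{Ker}\{\widetilde\Theta^\ell,M\}\subset\widetilde M$ is the intersection of the kernels, and $\operatorname{Im}\{\widetilde\Theta^\ell,M\}\subset\widetilde M$ the sum of the images, of all monomials of degree $\ell$ in $\widetilde\theta_1,\dots,\widetilde\theta_r$. These are $\mathrm{GL}_r$-equivariant $k[\mathbb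 M]$-submodules of $M\otimes k[\mathbb M]$, where $\mathrm{GL}_r$ acts trivially on $M$ and acts on $\mathbb M$ by multiplication by the inverse on the right. The functor $\mathcal R:\operatorname{Coh}^{\mathrm{GL}_r}(\mathbb M)\to\operatorname{Coh}(\operatorname{Grass}_{n,r})$ (from $\mathrm{GL}_r$-equivariant coherent sheaves on $\mathbb M$, equivalently equivariant finitely generated $k[\mathbb M]$-modules) is restriction to $\mathbb M^o$ followed by the inverse of the equivalence $\operatorname{Coh}(\operatorname{Grass}_{n,r})\to\operatorname{Coh}^{\mathrm{GL}_r}(\mathbb M^o)$ given by pull-back along the principal $\mathrm{GL}_r$-bundle $\mathbb M^o\to\operatorname{Grass}_{n,r}$. One has $\mathcal R(\widetilde M)=M\otimes\mathcal O_{Gr}$, so that $\mathcal R$ of a submodule of $\widetilde M$ is a subsheaf of $M\otimes\mathcal O_{Gr}$. *)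

theory Defs
  imports "HOL-Analysis.Analysis" "HOL-Computational_Algebra.Computational_Algebra"
    "HOL-Library.Poly_Mapping"
begin

section \<open>The group algebra and its radical\<close>

text \<open>
  For a finite abelian group \<open>'e\<close> (written additively) the type \<open>'e \<Rightarrow>\<^sub>0 'k\<close>, with the convolution
  product of \<^theory>\<open>HOL-Library.Poly_Mapping\<close>, is the group algebra \<open>kE\<close>. Ideals are the
  subspaces of the ring regarded as a module over itself.
\<close>

definition maximal_ideal :: "'a::comm_ring_1 set \<Rightarrow> bool" where
  "maximal_ideal I \<longleftrightarrow> module.subspace (*) I \<and> I \<noteq> UNIV \<and>
     (\<forall>J. module.subspace (*) J \<and> I \<subseteq> J \<longrightarrow> J = I \<or> J = UNIV)"

definition Rad :: "'a::comm_ring_1 set" where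
  "Rad = \<Inter>{I. maximal_ideal I}"

definition Rad2 :: "'a::comm_ring_1 set" where
  "Rad2 = module.span (*) {a * b | a b. a \<in> Rad \<and> b \<in> Rad}"

definition kscale :: "(('e::comm_monoid_add \<Rightarrow>\<^sub>0 'k::comm_ring_1) \<Rightarrow> 'm \<Rightarrow> 'm) \<Rightarrow> 'k \<Rightarrow> 'm \<Rightarrow> 'm" where
  "kscale act c m = act (Poly_Mapping.single 0 c) m"

text \<open>
  \<open>V\<close> is a \<open>k\<close>-subspace of \<open>Rad(kE)\<close> with basis \<open>x\<close>, and the composite
  \<open>V \<rightarrow> Rad(kE) \<rightarrow> Rad(kE)/Rad\<^sup>2(kE)\<close> (sending \<open>v\<close> to its coset) is an isomorphism.
\<close>

definition radical_complement ::
    "('e::ab_group_add \<Rightarrow>\<^sub>0 'k::field) set \<Rightarrow> ('n \<Rightarrow> ('e \<Rightarrow>\<^sub>0 'k)) \<Rightarrow> bool" where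
  "radical_complement V x \<longleftrightarrow>
     module.subspace (kscale (*)) V \<and> V \<subseteq> Rad \<and>
     inj x \<and> \<not> module.dependent (kscale (*)) (range x) \<and> module.span (kscale (*)) (range x) = V \<and>
     bij_betw (\<lambda>v. (+) v ` Rad2) V ((\<lambda>a. (+) a ` Rad2) ` Rad)"


section \<open>Spaces with functions and sheaves of modules\<close>

text \<open>
  Varieties over the algebraically closed field \<open>k\<close> are treated classically, as topological spaces
  together with a sheaf of \<open>k\<close>-valued functions. A section over an open set \<open>W\<close> is encoded as a
  function that is extended by \<open>0\<close> outside \<open>W\<close>.
\<close>

record ('p, 'k) function_space =
  opens :: "'p topology"
  reg_funs :: "'p set \<Rightarrow> ('p \<Rightarrow> 'k) set"

text \<open>
  For a finite dimensional \<open>M\<close> with scalar multiplication \<open>sc\<close> and a \<open>k\<close>-space \<open>A\<close> of functions, the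
  tensor product \<open>M \<otimes> A\<close> is the space of \<open>M\<close>-valued functions \<open>\<Sum>\<^sub>i m\<^sub>i \<otimes> f\<^sub>i\<close>.
\<close>

definition tensor_functions ::
    "('k \<Rightarrow> 'm::ab_group_add \<Rightarrow> 'm) \<Rightarrow> ('p \<Rightarrow> 'k) set \<Rightarrow> ('p \<Rightarrow> 'm) set" where
  "tensor_functions sc A =
     {(\<lambda>p. \<Sum>i<N. sc (f i p) (m i)) | (N::nat) f m. \<forall>i<N. f i \<in> A}"

text \<open>The sheaf \<open>M \<otimes> \<O>\<^sub>X\<close>. Sheaves take the value \<open>{}\<close> on sets that are not open, so that
  equality of sheaves is equality of functions.\<close>

definition free_sheaf ::
    "('k \<Rightarrow> 'm::ab_group_add \<Rightarrow> 'm) \<Rightarrow> ('p, 'k) function_space \<Rightarrow> 'p set \<Rightarrow> ('p \<Rightarrow> 'm) set" where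
  "free_sheaf sc X W =
     (if openin (opens X) W then tensor_functions sc (reg_funs X W) else {})"

definition restrict_section :: "('p \<Rightarrow> 'm::zero) \<Rightarrow> 'p set \<Rightarrow> ('p \<Rightarrow> 'm)" where
  "restrict_section s W = (\<lambda>p. if p \<in> W then s p else 0)"

text \<open>Subsheaves of \<open>\<O>\<^sub>X\<close>-modules of \<open>M \<otimes> \<O>\<^sub>X\<close>.\<close>

definition module_subsheaf ::
    "('k \<Rightarrow> 'm::ab_group_add \<Rightarrow> 'm) \<Rightarrow> ('p, 'k) function_space \<Rightarrow>
     ('p set \<Rightarrow> ('p \<Rightarrow> 'm) set) \<Rightarrow> bool" where
  "module_subsheaf sc X F \<longleftrightarrow>
     (\<forall>W. F W \<subseteq> free_sheaf sc X W) \<and>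
     (\<forall>W. openin (opens X) W \<longrightarrow>
        (\<lambda>p. 0) \<in> F W \<and>
        (\<forall>s\<in>F W. \<forall>t\<in>F W. (\<lambda>p. s p + t p) \<in> F W) \<and>
        (\<forall>a\<in>reg_funs X W. \<forall>s\<in>F W. (\<lambda>p. sc (a p) (s p)) \<in> F W) \<and>
        (\<forall>W'. openin (opens X) W' \<and> W' \<subseteq> W \<longrightarrow> (\<forall>s\<in>F W. restrict_section s W' \<in> F W')) \<and>
        (\<forall>s\<in>free_sheaf sc X W.
           (\<forall>p\<in>W. \<exists>W'. openin (opens X) W' \<and> p \<in> W' \<and> W' \<subseteq> W \<and> restrict_section s W' \<in> F W')
           \<longrightarrow> s \<in> F W))"

text \<open>
  The \<open>\<O>\<^sub>X\<close>-submodule of \<open>M \<otimes> \<O>\<^sub>X\<close> generated by sections, where \<open>G W\<close> is the set of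
  generators available over \<open>W\<close>. If \<open>U\<close> is affine and \<open>N \<subseteq> M \<otimes> k[U]\<close> is a \<open>k[U]\<close>-submodule, then
  \<open>generated_subsheaf sc X (\<lambda>_. N)\<close> restricted to \<open>U\<close> is the quasi-coherent sheaf on \<open>U\<close> associated
  with \<open>N\<close>; likewise for the restriction to an open subset of \<open>U\<close>.
\<close>

definition generated_subsheaf ::
    "('k \<Rightarrow> 'm::ab_group_add \<Rightarrow> 'm) \<Rightarrow> ('p, 'k) function_space \<Rightarrow>
     ('p set \<Rightarrow> ('p \<Rightarrow> 'm) set) \<Rightarrow> 'p set \<Rightarrow> ('p \<Rightarrow> 'm) set" where
  "generated_subsheaf sc X G W =
     {s \<in> free_sheaf sc X W.
        \<forall>p\<in>W. \<exists>W'. openin (opens X) W' \<and> p \<in> W' \<and> W' \<subseteq> W \<and>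
          (\<exists>(N::nat) a t. (\<forall>i<N. a i \<in> reg_funs X W' \<and> t i \<in> G W') \<and>
             (\<forall>q\<in>W'. s q = (\<Sum>i<N. sc (a i q) (t i q))))}"

text \<open>
  On a noetherian variety, a subsheaf of \<open>M \<otimes> \<O>\<^sub>X\<close> is coherent iff locally it is the sheaf associated
  with a finitely generated submodule.
\<close>

definition coherent_subsheaf ::
    "('k \<Rightarrow> 'm::ab_group_add \<Rightarrow> 'm) \<Rightarrow> ('p, 'k) function_space \<Rightarrow>
     ('p set \<Rightarrow> ('p \<Rightarrow> 'm) set) \<Rightarrow> bool" where
  "coherent_subsheaf sc X F \<longleftrightarrow> module_subsheaf sc X F \<and>
     (\<forall>p\<in>topspace (opens X). \<exists>U S. openin (opens X) U \<and> p \<in> U \<and> finite S \<and> S \<subseteq> F U \<and>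
        (\<forall>W. openin (opens X) W \<and> W \<subseteq> U \<longrightarrow> F W = generated_subsheaf sc X (\<lambda>_. S) W))"


section \<open>The variety of matrices of maximal rank\<close>

text \<open>
  An element of \<open>'k^'r^'n\<close> is a matrix with rows indexed by \<open>'n\<close> and columns by \<open>'r\<close>. Over an
  infinite field the coordinate ring \<open>k[Y\<^sub>i\<^sub>,\<^sub>j]\<close> is the ring of polynomial functions.
\<close>

inductive_set matrix_polys :: "('k::comm_ring_1^'r^'n \<Rightarrow> 'k) set" where
  const: "(\<lambda>A. c) \<in> matrix_polys"
| coord: "(\<lambda>A. A $ i $ j) \<in> matrix_polys"
| add: "f \<in> matrix_polys \<Longrightarrow> g \<in> matrix_polys \<Longrightarrow> (\<lambda>A. f A + g A) \<in> matrix_polys"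
| mult: "f \<in> matrix_polys \<Longrightarrow> g \<in> matrix_polys \<Longrightarrow> (\<lambda>A. f A * g A) \<in> matrix_polys"

definition nonvanishing_locus :: "('k::field^'r^'n \<Rightarrow> 'k) set \<Rightarrow> ('k^'r^'n) set" where
  "nonvanishing_locus S = {A. \<exists>f\<in>S. f A \<noteq> 0}"

definition zariski :: "('k::field^'r^'n) topology" where
  "zariski = topology (\<lambda>W. \<exists>S\<subseteq>matrix_polys. W = nonvanishing_locus S)"

lemma istopology_zariski:
  "istopology (\<lambda>W. \<exists>S\<subseteq>matrix_polys. W = nonvanishing_locus (S :: ('k::field^'r^'n \<Rightarrow> 'k) set))"
  unfolding istopology_def
proof (intro conjI allI impI)
  fix W1 W2 :: "('k^'r^'n) set"
  assume "\<exists>S\<subseteq>matrix_polys. W1 = nonvanishing_locus S" "\<exists>S\<subseteq>matrix_polys. W2 = nonvanishing_locus S"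
  then obtain S1 S2 where S: "S1 \<subseteq> matrix_polys" "W1 = nonvanishing_locus S1"
    "S2 \<subseteq> matrix_polys" "W2 = nonvanishing_locus S2" by blast
  let ?S = "{(\<lambda>A. f A * g A) | f g. f \<in> S1 \<and> g \<in> S2}"
  have "?S \<subseteq> matrix_polys" using S by (auto intro: matrix_polys.mult)
  moreover have "W1 \<inter> W2 = nonvanishing_locus ?S"
    unfolding S nonvanishing_locus_def by (auto 4 4)
  ultimately show "\<exists>S\<subseteq>matrix_polys. W1 \<inter> W2 = nonvanishing_locus S" by blast
next
  fix \<W> :: "('k^'r^'n) set set"
  assume "\<forall>W\<in>\<W>. \<exists>S\<subseteq>matrix_polys. W = nonvanishing_locus S"
  then obtain S where S: "\<forall>W\<in>\<W>. S W \<subseteq> matrix_polys \<and> W = nonvanishing_locus (S W)" by metis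
  have "\<Union>\<W> = nonvanishing_locus (\<Union>W\<in>\<W>. S W)"
    using S unfolding nonvanishing_locus_def by blast
  with S show "\<exists>S\<subseteq>matrix_polys. \<Union>\<W> = nonvanishing_locus S" by (intro exI[of _ "\<Union>W\<in>\<W>. S W"]) auto
qed

lemma openin_zariski: "openin zariski W \<longleftrightarrow> (\<exists>S\<subseteq>matrix_polys. W = nonvanishing_locus S)"
  unfolding zariski_def by (simp add: topology_inverse'[OF istopology_zariski])

definition full_rank :: "('k::field^'r^'n) set" where
  "full_rank = {A. rank A = CARD('r)}"

definition regular_functions :: "('k::field^'r^'n) set \<Rightarrow> ('k^'r^'n \<Rightarrow> 'k) set" where
  "regular_functions W =
     {f. (\<forall>A. A \<notin> W \<longrightarrow> f A = 0) \<and>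
         (\<forall>A\<in>W. \<exists>W' g h. openin zariski W' \<and> A \<in> W' \<and> W' \<subseteq> W \<and>
            g \<in> matrix_polys \<and> h \<in> matrix_polys \<and> (\<forall>B\<in>W'. h B \<noteq> 0 \<and> f B = g B / h B))}"

definition Mo :: "('k::field^'r^'n, 'k) function_space" where
  "Mo = \<lparr>opens = subtopology zariski full_rank, reg_funs = regular_functions\<rparr>"


section \<open>The Grassmannian\<close>

text \<open>A matrix represents the span of its columns, read in the basis \<open>x\<close> of \<open>V\<close>.\<close>

definition column_span ::
    "('n::finite \<Rightarrow> ('e::ab_group_add \<Rightarrow>\<^sub>0 'k::field)) \<Rightarrow> 'k^'r^'n \<Rightarrow> ('e \<Rightarrow>\<^sub>0 'k) set" where
  "column_span x A =
     module.span (kscale (*)) (range (\<lambda>j. \<Sum>i\<in>UNIV. kscale (*) (A $ i $ j) (x i)))"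

definition subspaces_of_dim ::
    "('e::ab_group_add \<Rightarrow>\<^sub>0 'k::field) set \<Rightarrow> nat \<Rightarrow> ('e \<Rightarrow>\<^sub>0 'k) set set" where
  "subspaces_of_dim V d =
     {U. module.subspace (kscale (*)) U \<and> U \<subseteq> V \<and> vector_space.dim (kscale (*)) U = d}"

definition representatives ::
    "('n::finite \<Rightarrow> ('e::ab_group_add \<Rightarrow>\<^sub>0 'k::field)) \<Rightarrow> ('e \<Rightarrow>\<^sub>0 'k) set set \<Rightarrow> ('k^'r^'n) set" where
  "representatives x W = {A \<in> full_rank. column_span x A \<in> W}"

text \<open>
  The Grassmannian \<open>Grass(r, V)\<close>, as the geometric quotient of \<open>\<M>\<^sup>o\<close> by \<open>GL\<^sub>r\<close>: open sets and
  regular functions are those whose pull-back to \<open>\<M>\<^sup>o\<close> is open, respectively regular. The size \<open>r\<close>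
  is the cardinality of the index type \<open>'r\<close>.
\<close>

definition grass_topology ::
    "'r::finite itself \<Rightarrow> ('n::finite \<Rightarrow> ('e::ab_group_add \<Rightarrow>\<^sub>0 'k::field)) \<Rightarrow> ('e \<Rightarrow>\<^sub>0 'k) set topology" where
  "grass_topology r x = topology (\<lambda>W.
     W \<subseteq> subspaces_of_dim (module.span (kscale (*)) (range x)) CARD('r) \<and>
     openin (opens Mo) (representatives x W :: ('k^'r^'n) set))"

lemma istopology_grass:
  fixes x :: "'n::finite \<Rightarrow> ('e::ab_group_add \<Rightarrow>\<^sub>0 'k::field)"
  shows "istopology (\<lambda>W. W \<subseteq> P \<and> openin (opens Mo) (representatives x W :: ('k^'r::finite^'n) set))"
  unfolding istopology_def
proof (intro conjI allI impI; (elim conjE)?)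
  fix S T
  assume "openin (opens Mo) (representatives x S :: ('k^'r^'n) set)"
    "openin (opens Mo) (representatives x T :: ('k^'r^'n) set)"
  moreover have "representatives x (S \<inter> T) =
      representatives x S \<inter> (representatives x T :: ('k^'r^'n) set)"
    by (auto simp: representatives_def)
  ultimately show "openin (opens Mo) (representatives x (S \<inter> T) :: ('k^'r^'n) set)" by auto
next
  fix \<W>
  assume *: "\<forall>W\<in>\<W>. W \<subseteq> P \<and> openin (opens Mo) (representatives x W :: ('k^'r^'n) set)"
  have "representatives x (\<Union>\<W>) = (\<Union>W\<in>\<W>. representatives x W :: ('k^'r^'n) set)"
    by (auto simp: representatives_def)
  with * show "openin (opens Mo) (representatives x (\<Union>\<W>) :: ('k^'r^'n) set)" by auto
qed auto

lemma openin_grass: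
  fixes x :: "'n::finite \<Rightarrow> ('e::ab_group_add \<Rightarrow>\<^sub>0 'k::field)"
  shows "openin (grass_topology TYPE('r::finite) x) W \<longleftrightarrow>
     W \<subseteq> subspaces_of_dim (module.span (kscale (*)) (range x)) CARD('r) \<and>
     openin (opens Mo) (representatives x W :: ('k^'r^'n) set)"
  unfolding grass_topology_def by (simp only: topology_inverse'[OF istopology_grass])

definition grass_functions ::
    "'r::finite itself \<Rightarrow> ('n::finite \<Rightarrow> ('e::ab_group_add \<Rightarrow>\<^sub>0 'k::field)) \<Rightarrow>
     ('e \<Rightarrow>\<^sub>0 'k) set set \<Rightarrow> (('e \<Rightarrow>\<^sub>0 'k) set \<Rightarrow> 'k) set" where
  "grass_functions r x W =
     {f. (\<forall>U. U \<notin> W \<longrightarrow> f U = 0) \<and>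
         restrict_section (\<lambda>A::'k^'r^'n. f (column_span x A)) (representatives x W)
           \<in> reg_funs Mo (representatives x W)}"

definition Grass ::
    "'r::finite itself \<Rightarrow> ('n::finite \<Rightarrow> ('e::ab_group_add \<Rightarrow>\<^sub>0 'k::field)) \<Rightarrow>
     (('e \<Rightarrow>\<^sub>0 'k) set, 'k) function_space" where
  "Grass r x = \<lparr>opens = grass_topology r x, reg_funs = grass_functions r x\<rparr>"

text \<open>
  A subset \<open>\<Sigma> = {i\<^sub>1 < \<dots> < i\<^sub>r}\<close> is given by its increasing enumeration \<open>\<sigma> :: 'r \<Rightarrow> 'n\<close>.
\<close>

definition submat :: "('r \<Rightarrow> 'n) \<Rightarrow> 'k^'r^'n \<Rightarrow> 'k^'r^'r" where
  "submat \<sigma> A = (\<chi> j. A $ \<sigma> j)"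

definition chart ::
    "('n::finite \<Rightarrow> ('e::ab_group_add \<Rightarrow>\<^sub>0 'k::field)) \<Rightarrow> ('r::finite \<Rightarrow> 'n) \<Rightarrow> ('e \<Rightarrow>\<^sub>0 'k) set set" where
  "chart x \<sigma> = column_span x ` {A::'k^'r^'n. A \<in> full_rank \<and> invertible (submat \<sigma> A)}"

definition chart_matrix ::
    "('n::finite \<Rightarrow> ('e::ab_group_add \<Rightarrow>\<^sub>0 'k::field)) \<Rightarrow> ('r::finite \<Rightarrow> 'n) \<Rightarrow> ('e \<Rightarrow>\<^sub>0 'k) set \<Rightarrow> 'k^'r^'n" where
  "chart_matrix x \<sigma> U =
     (THE A. A \<in> full_rank \<and> column_span x A = U \<and> submat \<sigma> A = mat 1)"


section \<open>The operators, their kernels and images\<close>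

text \<open>
  The operator \<open>m \<otimes> f \<mapsto> \<Sum>\<^sub>i x\<^sub>i m \<otimes> y\<^sub>i f\<close> on \<open>M\<close>-valued functions. It is applied with \<open>y\<^sub>i = Y\<^sub>i\<^sub>,\<^sub>j\<close> on
  \<open>\<M>\<close> and with \<open>y\<^sub>i = Y\<^sup>\<Sigma>\<^sub>i\<^sub>,\<^sub>j\<close> on \<open>\<U>\<^sub>\<Sigma>\<close>.
\<close>

definition theta ::
    "('n::finite \<Rightarrow> ('e::ab_group_add \<Rightarrow>\<^sub>0 'k::field)) \<Rightarrow> (('e \<Rightarrow>\<^sub>0 'k) \<Rightarrow> 'm::ab_group_add \<Rightarrow> 'm) \<Rightarrow>
     ('n \<Rightarrow> 'p \<Rightarrow> 'k) \<Rightarrow> ('p \<Rightarrow> 'm) \<Rightarrow> ('p \<Rightarrow> 'm)" where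
  "theta x act y s = (\<lambda>p. \<Sum>i\<in>UNIV. kscale act (y i p) (act (x i) (s p)))"

definition theta_global ::
    "('n::finite \<Rightarrow> ('e::ab_group_add \<Rightarrow>\<^sub>0 'k::field)) \<Rightarrow> (('e \<Rightarrow>\<^sub>0 'k) \<Rightarrow> 'm::ab_group_add \<Rightarrow> 'm) \<Rightarrow>
     'r \<Rightarrow> ('k^'r^'n \<Rightarrow> 'm) \<Rightarrow> ('k^'r^'n \<Rightarrow> 'm)" where
  "theta_global x act j = theta x act (\<lambda>i A. A $ i $ j)"

definition theta_chart ::
    "('n::finite \<Rightarrow> ('e::ab_group_add \<Rightarrow>\<^sub>0 'k::field)) \<Rightarrow> (('e \<Rightarrow>\<^sub>0 'k) \<Rightarrow> 'm::ab_group_add \<Rightarrow> 'm) \<Rightarrow>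
     ('r::finite \<Rightarrow> 'n) \<Rightarrow> 'r \<Rightarrow> (('e \<Rightarrow>\<^sub>0 'k) set \<Rightarrow> 'm) \<Rightarrow> (('e \<Rightarrow>\<^sub>0 'k) set \<Rightarrow> 'm)" where
  "theta_chart x act \<sigma> j = theta x act (\<lambda>i U. chart_matrix x \<sigma> U $ i $ j)"

definition word_op :: "('r \<Rightarrow> 's \<Rightarrow> 's) \<Rightarrow> 'r list \<Rightarrow> 's \<Rightarrow> 's" where
  "word_op \<theta> js = foldr \<theta> js"

definition common_kernel ::
    "('r \<Rightarrow> ('p \<Rightarrow> 'm::zero) \<Rightarrow> ('p \<Rightarrow> 'm)) \<Rightarrow> nat \<Rightarrow> ('p \<Rightarrow> 'm) set \<Rightarrow> ('p \<Rightarrow> 'm) set" where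
  "common_kernel \<theta> l D = {s \<in> D. \<forall>js. length js = l \<longrightarrow> word_op \<theta> js s = (\<lambda>p. 0)}"

definition sum_of_images ::
    "('r::finite \<Rightarrow> ('p \<Rightarrow> 'm::ab_group_add) \<Rightarrow> ('p \<Rightarrow> 'm)) \<Rightarrow> nat \<Rightarrow> ('p \<Rightarrow> 'm) set \<Rightarrow> ('p \<Rightarrow> 'm) set" where
  "sum_of_images \<theta> l D =
     {(\<lambda>p. \<Sum>js | length js = l. word_op \<theta> js (t js) p) | t. \<forall>js. length js = l \<longrightarrow> t js \<in> D}"

text \<open>The submodules \<open>Ker{\<Theta>\<^sup>l, M}\<close> and \<open>Im{\<Theta>\<^sup>l, M}\<close> of \<open>M \<otimes> k[Y\<^sub>i\<^sub>,\<^sub>j]\<close>.\<close>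

definition Ker_module ::
    "('n::finite \<Rightarrow> ('e::ab_group_add \<Rightarrow>\<^sub>0 'k::field)) \<Rightarrow> (('e \<Rightarrow>\<^sub>0 'k) \<Rightarrow> 'm::ab_group_add \<Rightarrow> 'm) \<Rightarrow>
     nat \<Rightarrow> ('k^'r::finite^'n \<Rightarrow> 'm) set" where
  "Ker_module x act l =
     common_kernel (theta_global x act) l (tensor_functions (kscale act) matrix_polys)"

definition Im_module ::
    "('n::finite \<Rightarrow> ('e::ab_group_add \<Rightarrow>\<^sub>0 'k::field)) \<Rightarrow> (('e \<Rightarrow>\<^sub>0 'k) \<Rightarrow> 'm::ab_group_add \<Rightarrow> 'm) \<Rightarrow>
     nat \<Rightarrow> ('k^'r::finite^'n \<Rightarrow> 'm) set" where
  "Im_module x act l =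
     sum_of_images (theta_global x act) l (tensor_functions (kscale act) matrix_polys)"

text \<open>The corresponding submodules of \<open>M \<otimes> k[\<U>\<^sub>\<Sigma>]\<close>.\<close>

definition Ker_chart ::
    "('n::finite \<Rightarrow> ('e::ab_group_add \<Rightarrow>\<^sub>0 'k::field)) \<Rightarrow> (('e \<Rightarrow>\<^sub>0 'k) \<Rightarrow> 'm::ab_group_add \<Rightarrow> 'm) \<Rightarrow>
     nat \<Rightarrow> ('r::finite \<Rightarrow> 'n) \<Rightarrow> (('e \<Rightarrow>\<^sub>0 'k) set \<Rightarrow> 'm) set" where
  "Ker_chart x act l \<sigma> =
     common_kernel (theta_chart x act \<sigma>) l (free_sheaf (kscale act) (Grass TYPE('r) x) (chart x \<sigma>))"

definition Im_chart ::
    "('n::finite \<Rightarrow> ('e::ab_group_add \<Rightarrow>\<^sub>0 'k::field)) \<Rightarrow> (('e \<Rightarrow>\<^sub>0 'k) \<Rightarrow> 'm::ab_group_add \<Rightarrow> 'm) \<Rightarrow>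
     nat \<Rightarrow> ('r::finite \<Rightarrow> 'n) \<Rightarrow> (('e \<Rightarrow>\<^sub>0 'k) set \<Rightarrow> 'm) set" where
  "Im_chart x act l \<sigma> =
     sum_of_images (theta_chart x act \<sigma>) l (free_sheaf (kscale act) (Grass TYPE('r) x) (chart x \<sigma>))"


section \<open>The local construction\<close>

text \<open>\<open>F\<close> is a subsheaf of \<open>M \<otimes> \<O>\<^sub>G\<^sub>r\<close> whose restriction to each \<open>\<U>\<^sub>\<Sigma>\<close> is (the sheaf associated
  with) the module \<open>N \<Sigma>\<close>.\<close>

definition has_chart_modules ::
    "('n::{finite,linorder} \<Rightarrow> ('e::ab_group_add \<Rightarrow>\<^sub>0 'k::field)) \<Rightarrow>
     (('e \<Rightarrow>\<^sub>0 'k) \<Rightarrow> 'm::ab_group_add \<Rightarrow> 'm) \<Rightarrow>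
     (('r::{finite,linorder} \<Rightarrow> 'n) \<Rightarrow> (('e \<Rightarrow>\<^sub>0 'k) set \<Rightarrow> 'm) set) \<Rightarrow>
     (('e \<Rightarrow>\<^sub>0 'k) set set \<Rightarrow> (('e \<Rightarrow>\<^sub>0 'k) set \<Rightarrow> 'm) set) \<Rightarrow> bool" where
  "has_chart_modules x act N F \<longleftrightarrow>
     module_subsheaf (kscale act) (Grass TYPE('r) x) F \<and>
     (\<forall>\<sigma>. strict_mono \<sigma> \<longrightarrow>
        (\<forall>W. openin (opens (Grass TYPE('r) x)) W \<and> W \<subseteq> chart x \<sigma> \<longrightarrow>
           F W = generated_subsheaf (kscale act) (Grass TYPE('r) x) (\<lambda>_. N \<sigma>) W))"

definition Ker_sheaf ::
    "'r::{finite,linorder} itself \<Rightarrow> ('n::{finite,linorder} \<Rightarrow> ('e::ab_group_add \<Rightarrow>\<^sub>0 'k::field)) \<Rightarrow>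
     (('e \<Rightarrow>\<^sub>0 'k) \<Rightarrow> 'm::ab_group_add \<Rightarrow> 'm) \<Rightarrow> nat \<Rightarrow>
     ('e \<Rightarrow>\<^sub>0 'k) set set \<Rightarrow> (('e \<Rightarrow>\<^sub>0 'k) set \<Rightarrow> 'm) set" where
  "Ker_sheaf r x act l =
     (THE F. has_chart_modules x act (Ker_chart x act l :: ('r \<Rightarrow> 'n) \<Rightarrow> _) F)"

definition Im_sheaf ::
    "'r::{finite,linorder} itself \<Rightarrow> ('n::{finite,linorder} \<Rightarrow> ('e::ab_group_add \<Rightarrow>\<^sub>0 'k::field)) \<Rightarrow>
     (('e \<Rightarrow>\<^sub>0 'k) \<Rightarrow> 'm::ab_group_add \<Rightarrow> 'm) \<Rightarrow> nat \<Rightarrow>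
     ('e \<Rightarrow>\<^sub>0 'k) set set \<Rightarrow> (('e \<Rightarrow>\<^sub>0 'k) set \<Rightarrow> 'm) set" where
  "Im_sheaf r x act l =
     (THE F. has_chart_modules x act (Im_chart x act l :: ('r \<Rightarrow> 'n) \<Rightarrow> _) F)"


section \<open>The descent construction\<close>

text \<open>
  The pull-back of a subsheaf \<open>F\<close> of \<open>M \<otimes> \<O>\<^sub>G\<^sub>r\<close> along the principal bundle \<open>\<pi> : \<M>\<^sup>o \<rightarrow> Grass\<close>. As
  \<open>\<pi>\<close> is flat, \<open>\<pi>\<^sup>*F\<close> is a subsheaf of \<open>\<pi>\<^sup>*(M \<otimes> \<O>\<^sub>G\<^sub>r) = M \<otimes> \<O>\<close>, namely the
  \<open>\<O>\<close>-submodule generated by the functions \<open>t \<circ> \<pi>\<close> for local sections \<open>t\<close> of \<open>F\<close>.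
\<close>

definition pullback_subsheaf ::
    "('n::finite \<Rightarrow> ('e::ab_group_add \<Rightarrow>\<^sub>0 'k::field)) \<Rightarrow> (('e \<Rightarrow>\<^sub>0 'k) \<Rightarrow> 'm::ab_group_add \<Rightarrow> 'm) \<Rightarrow>
     (('e \<Rightarrow>\<^sub>0 'k) set set \<Rightarrow> (('e \<Rightarrow>\<^sub>0 'k) set \<Rightarrow> 'm) set) \<Rightarrow>
     ('k^'r::finite^'n) set \<Rightarrow> ('k^'r^'n \<Rightarrow> 'm) set" where
  "pullback_subsheaf x act F =
     generated_subsheaf (kscale act) Mo
       (\<lambda>W. {t \<circ> column_span x | t V. openin (opens (Grass TYPE('r) x)) V \<and>
               column_span x ` W \<subseteq> V \<and> t \<in> F V})"

text \<open>The sheaf on \<open>\<M>\<close> associated with a submodule of \<open>M \<otimes> k[\<M>]\<close>, restricted to \<open>\<M>\<^sup>o\<close>.\<close>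

definition restriction_to_Mo ::
    "(('e::ab_group_add \<Rightarrow>\<^sub>0 'k::field) \<Rightarrow> 'm::ab_group_add \<Rightarrow> 'm) \<Rightarrow> ('k^'r::finite^'n::finite \<Rightarrow> 'm) set \<Rightarrow>
     ('k^'r^'n) set \<Rightarrow> ('k^'r^'n \<Rightarrow> 'm) set" where
  "restriction_to_Mo act N = generated_subsheaf (kscale act) Mo (\<lambda>_. N)"

text \<open>
  \<open>descends_to x act N F\<close>: the coherent subsheaf \<open>F\<close> of \<open>M \<otimes> \<O>\<^sub>G\<^sub>r\<close> pulls back to the restriction of
  \<open>N \<subseteq> M \<otimes> k[\<M>]\<close> to \<open>\<M>\<^sup>o\<close>. The equivariant structures need no separate mention: that of \<open>N\<close> and that
  of \<open>\<pi>\<^sup>*F\<close> are both induced from the action \<open>(g \<cdot> s)(A) = s(A g)\<close> on \<open>M \<otimes> \<O>\<close>, and so coincide once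
  the two subsheaves of \<open>M \<otimes> \<O>\<close> are equal. \<open>\<R>\<close> is the inverse of the pull-back, applied to the
  restriction; on equivariant submodules of \<open>M \<otimes> k[\<M>]\<close> it takes values in subsheaves of
  \<open>M \<otimes> \<O>\<^sub>G\<^sub>r\<close>.
\<close>

definition descends_to ::
    "('n::finite \<Rightarrow> ('e::ab_group_add \<Rightarrow>\<^sub>0 'k::field)) \<Rightarrow> (('e \<Rightarrow>\<^sub>0 'k) \<Rightarrow> 'm::ab_group_add \<Rightarrow> 'm) \<Rightarrow>
     ('k^'r::finite^'n \<Rightarrow> 'm) set \<Rightarrow> (('e \<Rightarrow>\<^sub>0 'k) set set \<Rightarrow> (('e \<Rightarrow>\<^sub>0 'k) set \<Rightarrow> 'm) set) \<Rightarrow> bool" where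
  "descends_to x act N F \<longleftrightarrow>
     coherent_subsheaf (kscale act) (Grass TYPE('r) x) F \<and>
     pullback_subsheaf x act F = restriction_to_Mo act N"

definition \<R> ::
    "('n::finite \<Rightarrow> ('e::ab_group_add \<Rightarrow>\<^sub>0 'k::field)) \<Rightarrow> (('e \<Rightarrow>\<^sub>0 'k) \<Rightarrow> 'm::ab_group_add \<Rightarrow> 'm) \<Rightarrow>
     ('k^'r::finite^'n \<Rightarrow> 'm) set \<Rightarrow> ('e \<Rightarrow>\<^sub>0 'k) set set \<Rightarrow> (('e \<Rightarrow>\<^sub>0 'k) set \<Rightarrow> 'm) set" where
  "\<R> x act N = (THE F. descends_to x act N F)"

end

theory Submission
  imports Defs "HOL-Library.Function_Algebras"
begin

text \<open>
  Let \<open>N\<close> be one of the two submodules of \<open>M \<otimes> k[Y\<^sub>i\<^sub>,\<^sub>j]\<close> and \<open>N\<^sub>\<sigma>\<close> the corresponding submodule on the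
  chart \<open>\<sigma>\<close>. The sheaf that answers both constructions consists of the sections of \<open>M \<otimes> \<O>\<^sub>G\<^sub>r\<close> whose
  pull-back to \<open>\<M>\<^sup>o\<close> lies in the subsheaf generated by \<open>N\<close>. Over the chart \<open>\<sigma>\<close> the projection
  \<open>A \<mapsto> column_span A\<close> has the section \<open>chart_matrix \<sigma>\<close>, and \<open>A\<close> is the chart matrix of its column span
  times the invertible matrix \<open>submat \<sigma> A\<close>. Restricting along the section turns elements of \<open>N\<close> into
  elements of \<open>N\<^sub>\<sigma>\<close>; as right multiplication of \<open>A\<close> by \<open>g\<close> only replaces the degree \<open>l\<close> monomials in the
  \<open>\<theta>\<^sub>j\<close> by linear combinations of each other, elements of \<open>N\<^sub>\<sigma>\<close> pull back into the sheaf of \<open>N\<close>.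
  Conversely, expanding \<open>t (B ** g) = (\<Sum>q. a\<^sub>q g \<cdot> u\<^sub>q B)\<close> with \<open>u\<^sub>q \<in> N\<close> and substituting
  \<open>g = submat \<sigma> A\<close> shows that \<open>N\<close> is generated by pulled back sections. Uniqueness on the descent side
  follows by restricting a pulled back section along \<open>chart_matrix \<sigma>\<close>, and coherence from Hilbert's
  basis theorem.
\<close>

text \<open>The main obstacle is the passage from points to families. Stability of \<open>N\<close>
  under the general linear group is available for one matrix \<open>g\<close> over \<open>k\<close>
  at a time, whereas generating \<open>N\<close> by pulled back sections requires substituting for
  \<open>g\<close> a matrix that varies with the point. Expanding \<open>t (B ** g)\<close> in terms
  of \<open>g\<close> gives right factors that need not lie in \<open>N\<close>; shortening the
  expansion until they do turns information on single group elements into an algebraic formula. A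
  second obstacle is the kernel, which comes without generators. Finite generation on the charts
  therefore rests on the basis theorem. Moreover a section over a chart, known to be killed only
  where its denominator \<open>h\<close> is nonzero, has to be related to polynomial elements of the
  kernel; multiplying by \<open>h\<close> once more makes the numerator vanish on the zero set of
  \<open>h\<close>. Since all sheaves consist of \<open>M\<close>-valued functions, equalities of
  sections are checked pointwise, and at each matrix the operators are the action of elements of the
  group algebra.\<close>

no_notation vector_scalar_mult (infixl "*s" 70)
no_notation fps_nth (infixl "$" 75)

section \<open>Hilbert's basis theorem\<close>

locale operator_module = module scale for scale :: "'a::comm_ring_1 \<Rightarrow> 'b::ab_group_add \<Rightarrow> 'b" (infixr "*s" 75)
begin

text \<open>Only an additive monoid is required; negatives become available once \<open>-1\<close>
  is among the operators. Taking a set of operators allows constants and coordinates to be adjoined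
  one at a time.\<close>

definition stable :: "'a set \<Rightarrow> 'b set \<Rightarrow> bool" where
  "stable A L \<longleftrightarrow> 0 \<in> L \<and> (\<forall>s\<in>L. \<forall>t\<in>L. s + t \<in> L) \<and> (\<forall>a\<in>A. \<forall>s\<in>L. a *s s \<in> L)"

lemma stableI:
  assumes "0 \<in> L" "\<And>s t. s \<in> L \<Longrightarrow> t \<in> L \<Longrightarrow> s + t \<in> L" "\<And>a s. a \<in> A \<Longrightarrow> s \<in> L \<Longrightarrow> a *s s \<in> L"
  shows "stable A L"
  using assms by (auto simp: stable_def)

lemma stableD:
  assumes "stable A L"
  shows "0 \<in> L" "\<And>s t. s \<in> L \<Longrightarrow> t \<in> L \<Longrightarrow> s + t \<in> L" "\<And>a s. a \<in> A \<Longrightarrow> s \<in> L \<Longrightarrow> a *s s \<in> L"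
  using assms by (auto simp: stable_def)

definition stable_hull :: "'a set \<Rightarrow> 'b set \<Rightarrow> 'b set" where
  "stable_hull A S = \<Inter>{L. stable A L \<and> S \<subseteq> L}"

lemma stable_stable_hull: "stable A (stable_hull A S)"
  by (rule stableI) (auto simp: stable_hull_def dest: stableD)

lemma stable_hull_superset: "S \<subseteq> stable_hull A S"
  by (auto simp: stable_hull_def)

lemma stable_hull_least: "stable A L \<Longrightarrow> S \<subseteq> L \<Longrightarrow> stable_hull A S \<subseteq> L"
  by (auto simp: stable_hull_def)

lemmas stable_hullD = stableD[OF stable_stable_hull]

definition noetherian :: "'a set \<Rightarrow> 'b set \<Rightarrow> bool" where
  "noetherian A N \<longleftrightarrow> stable A N \<and>
     (\<forall>L\<subseteq>N. stable A L \<longrightarrow> (\<exists>S\<subseteq>L. finite S \<and> L \<subseteq> stable_hull A S))"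

text \<open>The coefficient sequence is not determined by the value, since powers of
  \<open>y\<close> may satisfy relations over the coefficients. Degrees and leading coefficients
  below therefore belong to a chosen pair \<open>d\<close>, \<open>c\<close> and not to the
  element.\<close>

definition poly_eval :: "'a \<Rightarrow> nat \<Rightarrow> (nat \<Rightarrow> 'b) \<Rightarrow> 'b" where
  "poly_eval y d c = (\<Sum>i<d. y ^ i *s c i)"

definition poly_module :: "'a \<Rightarrow> 'b set \<Rightarrow> 'b set" where
  "poly_module y N = {poly_eval y d c | d c. \<forall>i. c i \<in> N}"

lemma poly_eval_0 [simp]: "poly_eval y 0 c = 0"
  by (simp add: poly_eval_def)

lemma poly_eval_Suc: "poly_eval y (Suc d) c = poly_eval y d c + y ^ d *s c d"
  by (simp add: poly_eval_def)

lemma poly_eval_add: "poly_eval y d (\<lambda>i. c i + c' i) = poly_eval y d c + poly_eval y d c'"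
  by (simp add: poly_eval_def scale_right_distrib sum.distrib)

lemma poly_eval_scale: "poly_eval y d (\<lambda>i. a *s c i) = a *s poly_eval y d c"
  by (simp add: poly_eval_def scale_sum_right mult.commute)

lemma poly_eval_shift:
  "poly_eval y (Suc d) (\<lambda>i. case i of 0 \<Rightarrow> 0 | Suc j \<Rightarrow> c j) = y *s poly_eval y d c"
  by (simp add: poly_eval_def sum.lessThan_Suc_shift scale_sum_right del: sum.lessThan_Suc)

lemma poly_eval_pad:
  assumes "d \<le> d'"
  shows "poly_eval y d' (\<lambda>i. if i < d then c i else 0) = poly_eval y d c"
proof -
  have "poly_eval y d' (\<lambda>i. if i < d then c i else 0) = (\<Sum>i<d'. if i < d then y ^ i *s c i else 0)"
    unfolding poly_eval_def by (rule sum.cong) auto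
  also have "\<dots> = (\<Sum>i\<in>{..<d'} \<inter> {i. i < d}. y ^ i *s c i)"
    by (simp add: sum.inter_restrict)
  also have "{..<d'} \<inter> {i. i < d} = {..<d}" using assms by auto
  finally show ?thesis by (simp add: poly_eval_def)
qed

lemma stable_poly_module:
  assumes N: "stable A N"
  shows "stable (insert y A) (poly_module y N)"
proof (rule stableI)
  show "0 \<in> poly_module y N"
    unfolding poly_module_def using stableD(1)[OF N] by (auto intro!: exI[of _ 0])
next
  fix s t assume "s \<in> poly_module y N" "t \<in> poly_module y N"
  then obtain d c d' c' where c: "s = poly_eval y d c" "\<forall>i. c i \<in> N"
    and c': "t = poly_eval y d' c'" "\<forall>i. c' i \<in> N" by (auto simp: poly_module_def)
  define e where "e = max d d'"
  let ?c = "\<lambda>i. (if i < d then c i else 0) + (if i < d' then c' i else 0)"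
  have "s + t = poly_eval y e ?c"
    by (simp add: poly_eval_add poly_eval_pad e_def c(1) c'(1))
  moreover have "?c i \<in> N" for i using c(2) c'(2) stableD(1,2)[OF N] by auto
  ultimately show "s + t \<in> poly_module y N" unfolding poly_module_def by blast
next
  fix a s assume a: "a \<in> insert y A" and "s \<in> poly_module y N"
  then obtain d c where c: "s = poly_eval y d c" "\<forall>i. c i \<in> N" by (auto simp: poly_module_def)
  show "a *s s \<in> poly_module y N"
  proof (cases "a = y")
    case True
    have "a *s s = poly_eval y (Suc d) (\<lambda>i. case i of 0 \<Rightarrow> 0 | Suc j \<Rightarrow> c j)"
      by (simp add: c True poly_eval_shift)
    moreover have "\<forall>i. (case i of 0 \<Rightarrow> 0 | Suc j \<Rightarrow> c j) \<in> N"
      using c(2) stableD(1)[OF N] by (auto split: nat.splits)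
    ultimately show ?thesis unfolding poly_module_def by blast
  next
    case False
    then have "a \<in> A" using a by simp
    have "a *s s = poly_eval y d (\<lambda>i. a *s c i)" by (simp add: poly_eval_scale c)
    moreover have "\<forall>i. a *s c i \<in> N" using c(2) stableD(3)[OF N] \<open>a \<in> A\<close> by auto
    ultimately show ?thesis unfolding poly_module_def by blast
  qed
qed

text \<open>The set \<open>A\<close> need not be a ring: the argument with modules of leading coefficients only uses
  closure under the operations in \<open>A\<close> and \<open>y\<close>.\<close>

theorem noetherian_poly_module:
  assumes noeth: "noetherian A N" and minus_one: "-1 \<in> A"
  shows "noetherian (insert y A) (poly_module y N)"
  unfolding noetherian_def
proof (intro conjI allI impI)
  have N: "stable A N" using noeth by (simp add: noetherian_def)
  show "stable (insert y A) (poly_module y N)" by (rule stable_poly_module[OF N])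
  fix L assume sub: "L \<subseteq> poly_module y N" and L: "stable (insert y A) L"
  \<comment> \<open>Candidates for leading coefficients in degree \<open>d\<close>. The value
    \<open>c d\<close> may be zero, which makes each \<open>T d\<close> stable; multiplying by
    \<open>y\<close> gives the inclusion in \<open>T (Suc d)\<close>.\<close>
  define T where "T d = {c d | c. (\<forall>i. c i \<in> N) \<and> poly_eval y (Suc d) c \<in> L}" for d
  have TN: "T d \<subseteq> N" for d by (auto simp: T_def)
  have T_stable: "stable A (T d)" for d
  proof (rule stableI)
    show "0 \<in> T d"
      unfolding T_def using stableD(1)[OF N] stableD(1)[OF L]
      by (auto intro!: exI[of _ "\<lambda>_. 0"] simp: poly_eval_def)
  next
    fix s t assume "s \<in> T d" "t \<in> T d"
    then obtain c c' where c: "s = c d" "\<forall>i. c i \<in> N" "poly_eval y (Suc d) c \<in> L"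
      "t = c' d" "\<forall>i. c' i \<in> N" "poly_eval y (Suc d) c' \<in> L" by (auto simp: T_def)
    then show "s + t \<in> T d"
      unfolding T_def using stableD(2)[OF N] stableD(2)[OF L]
      by (auto intro!: exI[of _ "\<lambda>i. c i + c' i"] simp: poly_eval_add)
  next
    fix a s assume "a \<in> A" "s \<in> T d"
    then obtain c where c: "s = c d" "\<forall>i. c i \<in> N" "poly_eval y (Suc d) c \<in> L"
      by (auto simp: T_def)
    then show "a *s s \<in> T d"
      unfolding T_def using stableD(3)[OF N] stableD(3)[OF L] \<open>a \<in> A\<close>
      by (auto intro!: exI[of _ "\<lambda>i. a *s c i"] simp: poly_eval_scale)
  qed
  have shift: "\<exists>c'. (\<forall>i. c' i \<in> N) \<and> c' (Suc d) = c d \<and> poly_eval y (Suc (Suc d)) c' \<in> K"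
    if "\<forall>i. c i \<in> N" "poly_eval y (Suc d) c \<in> K" "stable (insert y A) K" for c d K
    using that stableD(1)[OF N] stableD(3)[OF that(3)]
    by (intro exI[of _ "\<lambda>i. case i of 0 \<Rightarrow> 0 | Suc j \<Rightarrow> c j"])
      (auto simp: poly_eval_shift split: nat.splits)
  have T_Suc: "T d \<subseteq> T (Suc d)" for d
  proof
    fix s assume "s \<in> T d"
    then obtain c where c: "s = c d" "\<forall>i. c i \<in> N" "poly_eval y (Suc d) c \<in> L"
      by (auto simp: T_def)
    then obtain c' where "\<forall>i. c' i \<in> N" "c' (Suc d) = s" "poly_eval y (Suc (Suc d)) c' \<in> L"
      using shift[OF c(2,3) L] by auto
    then show "s \<in> T (Suc d)" unfolding T_def by blast
  qed
  have T_mono: "T d \<subseteq> T e" if "d \<le> e" for d e using T_Suc that by (rule lift_Suc_mono_le)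
  have "stable A (\<Union>d. T d)"
  proof (rule stableI)
    show "0 \<in> (\<Union>d. T d)" using stableD(1)[OF T_stable] by blast
  next
    fix s t assume "s \<in> (\<Union>d. T d)" "t \<in> (\<Union>d. T d)"
    then obtain d e where "s \<in> T d" "t \<in> T e" by blast
    then have "s \<in> T (max d e)" "t \<in> T (max d e)" using T_mono by (meson max.cobounded1 max.cobounded2 subsetD)+
    then show "s + t \<in> (\<Union>d. T d)" using stableD(2)[OF T_stable] by blast
  next
    fix a s assume "a \<in> A" "s \<in> (\<Union>d. T d)"
    then show "a *s s \<in> (\<Union>d. T d)" using stableD(3)[OF T_stable] by blast
  qed
  then obtain S where S: "S \<subseteq> (\<Union>d. T d)" "finite S" "(\<Union>d. T d) \<subseteq> stable_hull A S"
    using noeth TN unfolding noetherian_def by (meson UN_least)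
  \<comment> \<open>A finite generating set of the union already sits in one member of the chain, so
    the chain is constant from \<open>D\<close> on.\<close>
  have "\<exists>D. S \<subseteq> T D"
    using S(2,1)
  proof (induction S)
    case (insert s S)
    then obtain D e where "S \<subseteq> T D" "s \<in> T e" by blast
    then have "insert s S \<subseteq> T (max D e)"
      using T_mono[of D "max D e"] T_mono[of e "max D e"] by auto
    then show ?case by blast
  qed auto
  then obtain D where "S \<subseteq> T D" by blast
  then have TD: "T d \<subseteq> T D" for d
    using S(3) stable_hull_least[OF T_stable] by blast
  have "\<forall>d. \<exists>S. S \<subseteq> T d \<and> finite S \<and> T d \<subseteq> stable_hull A S"
    using noeth TN T_stable unfolding noetherian_def by blast
  from choice[OF this] obtain G where G0: "\<forall>d. G d \<subseteq> T d \<and> finite (G d) \<and> T d \<subseteq> stable_hull A (G d)"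
    by blast
  then have G: "G d \<subseteq> T d" "finite (G d)" "T d \<subseteq> stable_hull A (G d)" for d
    by simp_all
  define C where "C d g = (SOME c. (\<forall>i. c i \<in> N) \<and> c d = g \<and> poly_eval y (Suc d) c \<in> L)" for d g
  have C: "(\<forall>i. C d g i \<in> N) \<and> C d g d = g \<and> poly_eval y (Suc d) (C d g) \<in> L" if "g \<in> T d" for d g
  proof -
    obtain c where "g = c d" "\<forall>i. c i \<in> N" "poly_eval y (Suc d) c \<in> L"
      using \<open>g \<in> T d\<close> unfolding T_def by blast
    then have "\<exists>c. (\<forall>i. c i \<in> N) \<and> c d = g \<and> poly_eval y (Suc d) c \<in> L" by metis
    then show ?thesis unfolding C_def by (rule someI_ex)
  qed
  \<comment> \<open>Lifts of generators of \<open>T d\<close> for \<open>d \<le> D\<close> suffice: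
    a leading coefficient of higher degree lies in \<open>T D\<close>, and an expression for it is
    shifted up by a power of \<open>y\<close>.\<close>
  define F where "F = (\<Union>d\<le>D. (\<lambda>g. poly_eval y (Suc d) (C d g)) ` G d)"
  define H where "H = stable_hull (insert y A) F"
  have H: "stable (insert y A) H" by (simp add: H_def stable_stable_hull)
  have "poly_eval y (Suc d) (C d g) \<in> L" if "g \<in> G d" for d g
    using C[of g d] G(1)[of d] that by blast
  then have "F \<subseteq> L" by (auto simp: F_def)
  then have HL: "H \<subseteq> L" unfolding H_def by (rule stable_hull_least[OF L])
  \<comment> \<open>The analogue of \<open>T\<close> for the submodule \<open>H\<close> generated by
    the lifts. Once \<open>T d \<subseteq> Q d\<close> holds, every leading coefficient of
    \<open>L\<close> can be cancelled by an element of \<open>H\<close>.\<close>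
  define Q where "Q d = {g. \<exists>c. (\<forall>i. c i \<in> N) \<and> c d = g \<and> poly_eval y (Suc d) c \<in> H}" for d
  have Q_stable: "stable A (Q d)" for d
  proof (rule stableI)
    show "0 \<in> Q d" unfolding Q_def using stableD(1)[OF N] stableD(1)[OF H]
      by (auto intro!: exI[of _ "\<lambda>_. 0"] simp: poly_eval_def)
  next
    fix s t assume "s \<in> Q d" "t \<in> Q d"
    then obtain c c' where c: "\<forall>i. c i \<in> N" "c d = s" "poly_eval y (Suc d) c \<in> H"
      "\<forall>i. c' i \<in> N" "c' d = t" "poly_eval y (Suc d) c' \<in> H" by (auto simp: Q_def)
    then show "s + t \<in> Q d" unfolding Q_def
      using stableD(2)[OF N] stableD(2)[OF H]
      by (auto intro!: exI[of _ "\<lambda>i. c i + c' i"] simp: poly_eval_add)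
  next
    fix a s assume "a \<in> A" "s \<in> Q d"
    then obtain c where c: "\<forall>i. c i \<in> N" "c d = s" "poly_eval y (Suc d) c \<in> H"
      by (auto simp: Q_def)
    then show "a *s s \<in> Q d" unfolding Q_def
      using stableD(3)[OF N] stableD(3)[OF H] \<open>a \<in> A\<close>
      by (auto intro!: exI[of _ "\<lambda>i. a *s c i"] simp: poly_eval_scale)
  qed
  have TQ_low: "T d \<subseteq> Q d" if "d \<le> D" for d
  proof -
    have "G d \<subseteq> Q d"
    proof
      fix g assume g: "g \<in> G d"
      then have "poly_eval y (Suc d) (C d g) \<in> F" using that by (auto simp: F_def)
      then have "poly_eval y (Suc d) (C d g) \<in> H" unfolding H_def using stable_hull_superset by blast
      then show "g \<in> Q d" using C[of g d] G(1) g by (auto simp: Q_def)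
    qed
    then show ?thesis using G(3) stable_hull_least[OF Q_stable] by blast
  qed
  have Q_Suc: "Q d \<subseteq> Q (Suc d)" for d
    unfolding Q_def using shift[OF _ _ H] by blast
  have Q_mono: "Q d \<subseteq> Q e" if "d \<le> e" for d e using Q_Suc that by (rule lift_Suc_mono_le)
  have TQ: "T d \<subseteq> Q d" for d
    using TQ_low[of d] TQ_low[of D] TD[of d] Q_mono[of D d] by (cases "d \<le> D") auto
  have "poly_eval y d c \<in> H" if "\<forall>i. c i \<in> N" "poly_eval y d c \<in> L" for d c
    using that
  proof (induction d arbitrary: c)
    case 0
    then show ?case by (simp add: stableD(1)[OF H])
  next
    case (Suc d)
    then have "c d \<in> T d" unfolding T_def by blast
    then have "c d \<in> Q d" using TQ by blast
    then obtain c' where c': "\<forall>i. c' i \<in> N" "c' d = c d" "poly_eval y (Suc d) c' \<in> H"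
      by (auto simp: Q_def)
    \<comment> \<open>The difference has coefficient zero at \<open>d\<close>, so it is an
      expression of length \<open>d\<close> to which the induction hypothesis applies; its value
      stays in \<open>L\<close> because \<open>H \<subseteq> L\<close>.\<close>
    let ?c = "\<lambda>i. c i + (-1) *s c' i"
    have eq: "poly_eval y (Suc d) c = poly_eval y d ?c + poly_eval y (Suc d) c'"
      by (simp only: poly_eval_add poly_eval_scale) (simp add: poly_eval_Suc c'(2))
    have "poly_eval y d ?c = poly_eval y (Suc d) c + (-1) *s poly_eval y (Suc d) c'"
      by (simp add: eq)
    also have "\<dots> \<in> L"
      using Suc.prems(2) c'(3) HL minus_one stableD(2,3)[OF L] by blast
    finally have "poly_eval y d ?c \<in> H"
      using Suc.IH[of ?c] Suc.prems(1) c'(1) stableD(2,3)[OF N] minus_one by blast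
    then show ?case unfolding eq using c'(3) stableD(2)[OF H] by blast
  qed
  then have "L \<subseteq> H" using sub by (auto simp: poly_module_def)
  moreover have "finite F" using G(2) by (simp add: F_def)
  ultimately show "\<exists>S\<subseteq>L. finite S \<and> L \<subseteq> stable_hull (insert y A) S"
    using \<open>F \<subseteq> L\<close> unfolding H_def by blast
qed

end

section \<open>Subsheaves generated by sections\<close>

lemma restrict_section_in [simp]: "p \<in> W \<Longrightarrow> restrict_section s W p = s p"
  by (simp add: restrict_section_def)

lemma restrict_section_out [simp]: "p \<notin> W \<Longrightarrow> restrict_section s W p = 0"
  by (simp add: restrict_section_def)

lemma restrict_section_restrict:
  "restrict_section (restrict_section s W) W' = restrict_section s (W \<inter> W')"
  by (auto simp: restrict_section_def fun_eq_iff)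

lemma restrict_section_cong:
  "W = W' \<Longrightarrow> (\<And>p. p \<in> W' \<Longrightarrow> s p = t p) \<Longrightarrow> restrict_section s W = restrict_section t W'"
  by (auto simp: restrict_section_def fun_eq_iff)

lemma sum_lessThan_append:
  fixes f g :: "nat \<Rightarrow> 'a::comm_monoid_add"
  shows "(\<Sum>i<N + N'. if i < N then f i else g (i - N)) = (\<Sum>i<N. f i) + (\<Sum>i<N'. g i)"
  by (induction N') (simp_all add: add.assoc)

section \<open>Tensor products as spaces of vector-valued functions\<close>

context vector_space
begin

lemma tensor_functionsI:
  "(\<And>i. i < (N::nat) \<Longrightarrow> f i \<in> A) \<Longrightarrow> (\<lambda>p. \<Sum>i<N. scale (f i p) (m i)) \<in> tensor_functions scale A"
  unfolding tensor_functions_def by blast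

lemma tensor_functions_iff:
  "s \<in> tensor_functions scale A \<longleftrightarrow>
     (\<exists>(N::nat) f m. (\<forall>i<N. f i \<in> A) \<and> s = (\<lambda>p. \<Sum>i<N. scale (f i p) (m i)))"
  unfolding tensor_functions_def by blast

lemma tensor_functions_zero: "(\<lambda>p. 0) \<in> tensor_functions scale A"
  using tensor_functionsI[of 0 undefined A undefined] by simp

lemma tensor_functions_pure: "f \<in> A \<Longrightarrow> (\<lambda>p. scale (f p) m) \<in> tensor_functions scale A"
  using tensor_functionsI[of 1 "\<lambda>_. f" A "\<lambda>_. m"] by simp

lemma tensor_functions_add:
  assumes "s \<in> tensor_functions scale A" "t \<in> tensor_functions scale A"
  shows "(\<lambda>p. s p + t p) \<in> tensor_functions scale A"
proof -
  obtain N f m where s: "\<And>i. i < (N::nat) \<Longrightarrow> f i \<in> A" "s = (\<lambda>p. \<Sum>i<N. scale (f i p) (m i))"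
    using assms(1) unfolding tensor_functions_iff by blast
  obtain N' f' m' where t: "\<And>i. i < (N'::nat) \<Longrightarrow> f' i \<in> A" "t = (\<lambda>p. \<Sum>i<N'. scale (f' i p) (m' i))"
    using assms(2) unfolding tensor_functions_iff by blast
  let ?f = "\<lambda>i. if i < N then f i else f' (i - N)" and ?m = "\<lambda>i. if i < N then m i else m' (i - N)"
  have "(\<lambda>p. \<Sum>i<N + N'. scale (?f i p) (?m i)) \<in> tensor_functions scale A"
    by (rule tensor_functionsI) (auto simp: s t)
  also have "(\<lambda>p. \<Sum>i<N + N'. scale (?f i p) (?m i)) = (\<lambda>p. s p + t p)"
    unfolding s(2) t(2) sum_lessThan_append[symmetric] by (intro ext sum.cong) auto
  finally show ?thesis .
qed

lemma tensor_functions_sum: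
  "finite I \<Longrightarrow> (\<And>i. i \<in> I \<Longrightarrow> s i \<in> tensor_functions scale A) \<Longrightarrow>
    (\<lambda>p. \<Sum>i\<in>I. s i p) \<in> tensor_functions scale A"
  by (induction I rule: finite_induct) (auto intro: tensor_functions_zero tensor_functions_add)

text \<open>A weight \<open>c\<close> and a substitution \<open>h\<close> cover at once
  multiplication by a function, restriction to a smaller set (an indicator as weight) and pull-back
  along a map.\<close>

lemma tensor_functions_map:
  assumes "s \<in> tensor_functions scale A" "\<And>f. f \<in> A \<Longrightarrow> \<phi> f \<in> B"
    and "\<And>f p. f \<in> A \<Longrightarrow> \<phi> f p = c p * f (h p)"
  shows "(\<lambda>p. scale (c p) (s (h p))) \<in> tensor_functions scale B"
proof -
  obtain N f m where s: "\<And>i. i < (N::nat) \<Longrightarrow> f i \<in> A" "s = (\<lambda>p. \<Sum>i<N. scale (f i p) (m i))"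
    using assms(1) unfolding tensor_functions_iff by blast
  have "(\<lambda>p. \<Sum>i<N. scale (\<phi> (f i) p) (m i)) \<in> tensor_functions scale B"
    by (intro tensor_functionsI assms(2) s(1))
  also have "(\<lambda>p. \<Sum>i<N. scale (\<phi> (f i) p) (m i)) = (\<lambda>p. scale (c p) (s (h p)))"
    unfolding s(2) scale_sum_right using s(1) assms(3) by (intro ext sum.cong) auto
  finally show ?thesis .
qed

end

text \<open>Closure properties common to the matrices of full rank and the Grassmannian, so that
  generated subsheaves are treated once for both.\<close>

locale function_sheaf = vector_space sc
  for sc :: "'k::field \<Rightarrow> 'm::ab_group_add \<Rightarrow> 'm" +
  fixes X :: "('p, 'k) function_space"
  assumes reg_outside: "a \<in> reg_funs X W \<Longrightarrow> p \<notin> W \<Longrightarrow> a p = 0"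
    and reg_const: "openin (opens X) W \<Longrightarrow> (\<lambda>p. if p \<in> W then c else 0) \<in> reg_funs X W"
    and reg_add: "openin (opens X) W \<Longrightarrow> a \<in> reg_funs X W \<Longrightarrow> b \<in> reg_funs X W \<Longrightarrow>
      (\<lambda>p. a p + b p) \<in> reg_funs X W"
    and reg_mult: "openin (opens X) W \<Longrightarrow> a \<in> reg_funs X W \<Longrightarrow> b \<in> reg_funs X W \<Longrightarrow>
      (\<lambda>p. a p * b p) \<in> reg_funs X W"
    and reg_restrict: "openin (opens X) W \<Longrightarrow> openin (opens X) W' \<Longrightarrow> W' \<subseteq> W \<Longrightarrow>
      a \<in> reg_funs X W \<Longrightarrow> restrict_section a W' \<in> reg_funs X W'"
begin

lemma free_sheafI: "openin (opens X) W \<Longrightarrow> s \<in> tensor_functions sc (reg_funs X W) \<Longrightarrow> s \<in> free_sheaf sc X W"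
  by (simp add: free_sheaf_def)

lemma free_sheafD:
  assumes "s \<in> free_sheaf sc X W"
  shows "openin (opens X) W" "s \<in> tensor_functions sc (reg_funs X W)"
  using assms by (auto simp: free_sheaf_def split: if_splits)

lemma free_add: "s \<in> free_sheaf sc X W \<Longrightarrow> t \<in> free_sheaf sc X W \<Longrightarrow> (\<lambda>p. s p + t p) \<in> free_sheaf sc X W"
  by (auto intro!: free_sheafI tensor_functions_add dest: free_sheafD)

lemma free_scale:
  "a \<in> reg_funs X W \<Longrightarrow> s \<in> free_sheaf sc X W \<Longrightarrow> (\<lambda>p. sc (a p) (s p)) \<in> free_sheaf sc X W"
  by (auto intro!: free_sheafI tensor_functions_map[where \<phi> = "\<lambda>f p. a p * f p" and h = "\<lambda>p. p"]
      reg_mult dest: free_sheafD)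

lemma free_restrict:
  assumes "s \<in> free_sheaf sc X W" "openin (opens X) W'" "W' \<subseteq> W"
  shows "restrict_section s W' \<in> free_sheaf sc X W'"
proof -
  have "(\<lambda>p. sc (if p \<in> W' then 1 else 0) (s p)) \<in> tensor_functions sc (reg_funs X W')"
    by (rule tensor_functions_map[where \<phi> = "\<lambda>f. restrict_section f W'",
          OF free_sheafD(2)[OF assms(1)] reg_restrict[OF free_sheafD(1)[OF assms(1)] assms(2,3)]])
      (simp_all add: restrict_section_def)
  also have "(\<lambda>p. sc (if p \<in> W' then 1 else 0) (s p)) = restrict_section s W'"
    by (auto simp: restrict_section_def fun_eq_iff)
  finally show ?thesis using assms(2) by (rule free_sheafI[rotated])
qed

text \<open>Only the values on \<open>W\<close> matter, so members of \<open>comb W S\<close> and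
  the generators need not vanish outside \<open>W\<close>. This is the local condition inside
  \<open>generated_subsheaf\<close>, separated from openness and gluing.\<close>

definition comb :: "'p set \<Rightarrow> ('p \<Rightarrow> 'm) set \<Rightarrow> ('p \<Rightarrow> 'm) set" where
  "comb W S = {s. \<exists>(N::nat) a t. (\<forall>i<N. a i \<in> reg_funs X W \<and> t i \<in> S) \<and>
     (\<forall>q\<in>W. s q = (\<Sum>i<N. sc (a i q) (t i q)))}"

lemma generated_iff:
  "s \<in> generated_subsheaf sc X G W \<longleftrightarrow> s \<in> free_sheaf sc X W \<and>
     (\<forall>p\<in>W. \<exists>W'. openin (opens X) W' \<and> p \<in> W' \<and> W' \<subseteq> W \<and> s \<in> comb W' (G W'))"
  unfolding generated_subsheaf_def comb_def by simp

lemma combI: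
  "(\<And>i. i < (N::nat) \<Longrightarrow> a i \<in> reg_funs X W) \<Longrightarrow> (\<And>i. i < N \<Longrightarrow> t i \<in> S) \<Longrightarrow>
   (\<And>q. q \<in> W \<Longrightarrow> s q = (\<Sum>i<N. sc (a i q) (t i q))) \<Longrightarrow> s \<in> comb W S"
  unfolding comb_def by blast

lemma comb_cong: "s \<in> comb W S \<Longrightarrow> (\<And>q. q \<in> W \<Longrightarrow> s' q = s q) \<Longrightarrow> s' \<in> comb W S"
  by (simp add: comb_def)

lemma comb_zero: "(\<lambda>q. 0) \<in> comb W S"
  by (rule combI[of 0]) auto

lemma comb_add:
  assumes "s \<in> comb W S" "t \<in> comb W S"
  shows "(\<lambda>p. s p + t p) \<in> comb W S"
proof -
  obtain N a u where s: "\<And>i. i < (N::nat) \<Longrightarrow> a i \<in> reg_funs X W" "\<And>i. i < N \<Longrightarrow> u i \<in> S"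
   "\<And>q. q \<in> W \<Longrightarrow> s q = (\<Sum>i<N. sc (a i q) (u i q))" using assms(1) unfolding comb_def by blast
  obtain N' a' u' where t: "\<And>i. i < (N'::nat) \<Longrightarrow> a' i \<in> reg_funs X W" "\<And>i. i < N' \<Longrightarrow> u' i \<in> S"
   "\<And>q. q \<in> W \<Longrightarrow> t q = (\<Sum>i<N'. sc (a' i q) (u' i q))" using assms(2) unfolding comb_def by blast
  show ?thesis
  proof (rule combI[of "N + N'" "\<lambda>i. if i < N then a i else a' (i - N)" _
        "\<lambda>i. if i < N then u i else u' (i - N)"])
    fix q assume "q \<in> W"
    then show "s q + t q = (\<Sum>i<N + N'. sc ((if i < N then a i else a' (i - N)) q)
        ((if i < N then u i else u' (i - N)) q))"
      unfolding s(3)[OF \<open>q \<in> W\<close>] t(3)[OF \<open>q \<in> W\<close>] sum_lessThan_append[symmetric]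
      by (intro sum.cong) auto
  qed (auto simp: s t)
qed

lemma comb_sum:
  "finite I \<Longrightarrow> (\<And>i. i \<in> I \<Longrightarrow> s i \<in> comb W S) \<Longrightarrow> (\<lambda>p. \<Sum>i\<in>I. s i p) \<in> comb W S"
  by (induction I rule: finite_induct) (auto intro: comb_zero comb_add)

lemma comb_scale:
  assumes "openin (opens X) W" "b \<in> reg_funs X W" "s \<in> comb W S"
  shows "(\<lambda>p. sc (b p) (s p)) \<in> comb W S"
proof -
  obtain N a u where s: "\<And>i. i < (N::nat) \<Longrightarrow> a i \<in> reg_funs X W" "\<And>i. i < N \<Longrightarrow> u i \<in> S"
   "\<And>q. q \<in> W \<Longrightarrow> s q = (\<Sum>i<N. sc (a i q) (u i q))" using assms(3) unfolding comb_def by blast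
  show ?thesis
    by (rule combI[of N "\<lambda>i p. b p * a i p" _ u])
      (use s assms in \<open>auto intro: reg_mult simp: scale_sum_right\<close>)
qed

lemma comb_base: "openin (opens X) W \<Longrightarrow> t \<in> S \<Longrightarrow> t \<in> comb W S"
  by (rule combI[of 1 "\<lambda>_ p. if p \<in> W then 1 else 0" _ "\<lambda>_. t"]) (auto intro: reg_const)

lemma comb_restrict:
  assumes "openin (opens X) W" "openin (opens X) W'" "W' \<subseteq> W" "s \<in> comb W S"
  shows "s \<in> comb W' S"
proof -
  obtain N a u where s: "\<And>i. i < (N::nat) \<Longrightarrow> a i \<in> reg_funs X W" "\<And>i. i < N \<Longrightarrow> u i \<in> S"
   "\<And>q. q \<in> W \<Longrightarrow> s q = (\<Sum>i<N. sc (a i q) (u i q))" using assms(4) unfolding comb_def by blast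
  show ?thesis
    by (rule combI[of N "\<lambda>i. restrict_section (a i) W'" _ u])
      (use s assms in \<open>auto intro: reg_restrict\<close>)
qed

lemma comb_mono: "S \<subseteq> S' \<Longrightarrow> comb W S \<subseteq> comb W S'"
  unfolding comb_def by blast

lemma comb_trans:
  assumes "openin (opens X) W" "S \<subseteq> comb W S'" "s \<in> comb W S"
  shows "s \<in> comb W S'"
proof -
  obtain N a u where s: "\<And>i. i < (N::nat) \<Longrightarrow> a i \<in> reg_funs X W" "\<And>i. i < N \<Longrightarrow> u i \<in> S"
   "\<And>q. q \<in> W \<Longrightarrow> s q = (\<Sum>i<N. sc (a i q) (u i q))" using assms(3) unfolding comb_def by blast
  have "(\<lambda>q. \<Sum>i<N. sc (a i q) (u i q)) \<in> comb W S'"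
    by (rule comb_sum) (use s assms in \<open>auto intro!: comb_scale\<close>)
  then show ?thesis using s(3) by (rule comb_cong)
qed

context
  fixes F
  assumes F: "module_subsheaf sc X F"
begin

lemma subsheaf_free: "s \<in> F W \<Longrightarrow> s \<in> free_sheaf sc X W"
  using F unfolding module_subsheaf_def by blast

lemmas subsheaf_local = F[unfolded module_subsheaf_def, THEN conjunct2, THEN spec, THEN mp]

lemma subsheaf_zero: "openin (opens X) W \<Longrightarrow> (\<lambda>p. 0) \<in> F W"
  by (rule subsheaf_local[THEN conjunct1])

lemma subsheaf_add: "openin (opens X) W \<Longrightarrow> s \<in> F W \<Longrightarrow> t \<in> F W \<Longrightarrow> (\<lambda>p. s p + t p) \<in> F W"
  by (rule subsheaf_local[THEN conjunct2, THEN conjunct1, THEN bspec, THEN bspec])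

lemma subsheaf_scale:
  "openin (opens X) W \<Longrightarrow> a \<in> reg_funs X W \<Longrightarrow> s \<in> F W \<Longrightarrow> (\<lambda>p. sc (a p) (s p)) \<in> F W"
  by (rule subsheaf_local[THEN conjunct2, THEN conjunct2, THEN conjunct1, THEN bspec, THEN bspec])

lemma subsheaf_restrict:
  "openin (opens X) W \<Longrightarrow> openin (opens X) W' \<Longrightarrow> W' \<subseteq> W \<Longrightarrow> s \<in> F W \<Longrightarrow> restrict_section s W' \<in> F W'"
  using subsheaf_local[THEN conjunct2, THEN conjunct2, THEN conjunct2, THEN conjunct1] by simp

lemma subsheaf_glue:
  "s \<in> free_sheaf sc X W \<Longrightarrow>
   (\<And>p. p \<in> W \<Longrightarrow> \<exists>W'. openin (opens X) W' \<and> p \<in> W' \<and> W' \<subseteq> W \<and> restrict_section s W' \<in> F W') \<Longrightarrow>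
   s \<in> F W"
  using subsheaf_local[THEN conjunct2, THEN conjunct2, THEN conjunct2, THEN conjunct2, of W]
    free_sheafD(1)[of s W] by simp

lemma subsheaf_comb:
  assumes W: "openin (opens X) W" and S: "\<And>t. t \<in> S \<Longrightarrow> restrict_section t W \<in> F W" and s: "s \<in> comb W S"
  shows "restrict_section s W \<in> F W"
proof -
  obtain N a u where s: "\<And>i. i < (N::nat) \<Longrightarrow> a i \<in> reg_funs X W" "\<And>i. i < N \<Longrightarrow> u i \<in> S"
   "\<And>q. q \<in> W \<Longrightarrow> s q = (\<Sum>i<N. sc (a i q) (u i q))" using s unfolding comb_def by blast
  have "(\<lambda>q. \<Sum>i<M. sc (a i q) (restrict_section (u i) W q)) \<in> F W" if "M \<le> N" for M
    using that
  proof (induction M)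
    case (Suc M)
    then show ?case
      using subsheaf_add[OF W _ subsheaf_scale[OF W s(1) S[OF s(2)]]] by simp
  qed (simp add: subsheaf_zero W)
  from this[of N] have "(\<lambda>q. \<Sum>i<N. sc (a i q) (restrict_section (u i) W q)) \<in> F W" by simp
  also have "(\<lambda>q. \<Sum>i<N. sc (a i q) (restrict_section (u i) W q)) = restrict_section s W"
    by (auto simp: fun_eq_iff restrict_section_def s(3))
  finally show ?thesis .
qed

text \<open>Universal property behind the inclusions of generated subsheaves: local combinations
  stay in \<open>F\<close> by the module operations, and gluing assembles them.\<close>

lemma generated_least:
  assumes "\<And>W' t. openin (opens X) W' \<Longrightarrow> W' \<subseteq> W \<Longrightarrow> t \<in> G W' \<Longrightarrow> restrict_section t W' \<in> F W'"
  shows "generated_subsheaf sc X G W \<subseteq> F W"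
proof
  fix s assume "s \<in> generated_subsheaf sc X G W"
  then have s: "s \<in> free_sheaf sc X W"
    "\<And>p. p \<in> W \<Longrightarrow> \<exists>W'. openin (opens X) W' \<and> p \<in> W' \<and> W' \<subseteq> W \<and> s \<in> comb W' (G W')"
    unfolding generated_iff by blast+
  from s(1) show "s \<in> F W"
  proof (rule subsheaf_glue)
    fix p assume "p \<in> W"
    then obtain W' where W': "openin (opens X) W'" "p \<in> W'" "W' \<subseteq> W" "s \<in> comb W' (G W')"
      using s(2) by blast
    have "restrict_section s W' \<in> F W'"
      by (rule subsheaf_comb[OF W'(1) assms[OF W'(1,3)] W'(4)])
    with W' show "\<exists>W'. openin (opens X) W' \<and> p \<in> W' \<and> W' \<subseteq> W \<and> restrict_section s W' \<in> F W'"
      by blast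
  qed
qed

end

lemma module_subsheafI:
  assumes "\<And>W s. s \<in> F W \<Longrightarrow> s \<in> free_sheaf sc X W"
    and "\<And>W. openin (opens X) W \<Longrightarrow> (\<lambda>p. 0) \<in> F W"
    and "\<And>W s t. openin (opens X) W \<Longrightarrow> s \<in> F W \<Longrightarrow> t \<in> F W \<Longrightarrow> (\<lambda>p. s p + t p) \<in> F W"
    and "\<And>W a s. openin (opens X) W \<Longrightarrow> a \<in> reg_funs X W \<Longrightarrow> s \<in> F W \<Longrightarrow> (\<lambda>p. sc (a p) (s p)) \<in> F W"
    and "\<And>W W' s. openin (opens X) W \<Longrightarrow> openin (opens X) W' \<Longrightarrow> W' \<subseteq> W \<Longrightarrow> s \<in> F W \<Longrightarrow>
      restrict_section s W' \<in> F W'"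
    and "\<And>W s. s \<in> free_sheaf sc X W \<Longrightarrow>
      (\<And>p. p \<in> W \<Longrightarrow> \<exists>W'. openin (opens X) W' \<and> p \<in> W' \<and> W' \<subseteq> W \<and> restrict_section s W' \<in> F W') \<Longrightarrow>
      s \<in> F W"
  shows "module_subsheaf sc X F"
  unfolding module_subsheaf_def using assms by (simp add: subset_iff)

lemma free_zero: "openin (opens X) W \<Longrightarrow> (\<lambda>p. 0) \<in> free_sheaf sc X W"
  by (simp add: free_sheafI tensor_functions_zero)

text \<open>Monotonicity of the generators lets expressions on two neighbourhoods be added on their
  intersection, and makes restriction to smaller open sets possible.\<close>

lemma module_subsheaf_generated:
  assumes mono: "\<And>W W'. W' \<subseteq> W \<Longrightarrow> G W \<subseteq> G W'"
  shows "module_subsheaf sc X (generated_subsheaf sc X G)"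
proof (rule module_subsheafI)
  fix W assume W: "openin (opens X) W"
  show "(\<lambda>p. 0) \<in> generated_subsheaf sc X G W"
    unfolding generated_iff using W free_zero comb_zero by blast
next
  fix W s t assume "s \<in> generated_subsheaf sc X G W" "t \<in> generated_subsheaf sc X G W"
  then have s: "s \<in> free_sheaf sc X W"
      "\<And>p. p \<in> W \<Longrightarrow> \<exists>W'. openin (opens X) W' \<and> p \<in> W' \<and> W' \<subseteq> W \<and> s \<in> comb W' (G W')"
    and t: "t \<in> free_sheaf sc X W"
      "\<And>p. p \<in> W \<Longrightarrow> \<exists>W'. openin (opens X) W' \<and> p \<in> W' \<and> W' \<subseteq> W \<and> t \<in> comb W' (G W')"
    unfolding generated_iff by blast+
  have "\<exists>W'. openin (opens X) W' \<and> p \<in> W' \<and> W' \<subseteq> W \<and> (\<lambda>p. s p + t p) \<in> comb W' (G W')"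
    if "p \<in> W" for p
  proof -
    obtain W1 where W1: "openin (opens X) W1" "p \<in> W1" "W1 \<subseteq> W" "s \<in> comb W1 (G W1)"
      using s(2) \<open>p \<in> W\<close> by blast
    obtain W2 where W2: "openin (opens X) W2" "p \<in> W2" "W2 \<subseteq> W" "t \<in> comb W2 (G W2)"
      using t(2) \<open>p \<in> W\<close> by blast
    let ?V = "W1 \<inter> W2"
    have V: "openin (opens X) ?V" using W1 W2 by blast
    have "s \<in> comb ?V (G ?V)"
      using comb_restrict[OF W1(1) V _ W1(4)] comb_mono[OF mono[of ?V W1]] by blast
    moreover have "t \<in> comb ?V (G ?V)"
      using comb_restrict[OF W2(1) V _ W2(4)] comb_mono[OF mono[of ?V W2]] by blast
    ultimately have "(\<lambda>p. s p + t p) \<in> comb ?V (G ?V)" by (rule comb_add)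
    with V W1 W2 show ?thesis by blast
  qed
  with free_add[OF s(1) t(1)] show "(\<lambda>p. s p + t p) \<in> generated_subsheaf sc X G W"
    unfolding generated_iff by blast
next
  fix W a s assume W: "openin (opens X) W" and a: "a \<in> reg_funs X W"
    and "s \<in> generated_subsheaf sc X G W"
  then have s: "s \<in> free_sheaf sc X W"
      "\<And>p. p \<in> W \<Longrightarrow> \<exists>W'. openin (opens X) W' \<and> p \<in> W' \<and> W' \<subseteq> W \<and> s \<in> comb W' (G W')"
    unfolding generated_iff by blast+
  have "\<exists>W'. openin (opens X) W' \<and> p \<in> W' \<and> W' \<subseteq> W \<and> (\<lambda>p. sc (a p) (s p)) \<in> comb W' (G W')"
    if "p \<in> W" for p
  proof -
    obtain W1 where W1: "openin (opens X) W1" "p \<in> W1" "W1 \<subseteq> W" "s \<in> comb W1 (G W1)"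
      using s(2) \<open>p \<in> W\<close> by blast
    have "(\<lambda>p. sc (restrict_section a W1 p) (s p)) \<in> comb W1 (G W1)"
      using W1 W a by (intro comb_scale reg_restrict)
    then have "(\<lambda>p. sc (a p) (s p)) \<in> comb W1 (G W1)" by (rule comb_cong) simp
    with W1 show ?thesis by blast
  qed
  with free_scale[OF a s(1)] show "(\<lambda>p. sc (a p) (s p)) \<in> generated_subsheaf sc X G W"
    unfolding generated_iff by blast
next
  fix W V s assume W: "openin (opens X) W" and V: "openin (opens X) V" "V \<subseteq> W"
    and "s \<in> generated_subsheaf sc X G W"
  then have s: "s \<in> free_sheaf sc X W"
      "\<And>p. p \<in> W \<Longrightarrow> \<exists>W'. openin (opens X) W' \<and> p \<in> W' \<and> W' \<subseteq> W \<and> s \<in> comb W' (G W')"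
    unfolding generated_iff by blast+
  have "\<exists>W'. openin (opens X) W' \<and> p \<in> W' \<and> W' \<subseteq> V \<and> restrict_section s V \<in> comb W' (G W')"
    if "p \<in> V" for p
  proof -
    obtain W1 where W1: "openin (opens X) W1" "p \<in> W1" "W1 \<subseteq> W" "s \<in> comb W1 (G W1)"
      using s(2) \<open>p \<in> V\<close> V by blast
    let ?U = "W1 \<inter> V"
    have U: "openin (opens X) ?U" using W1 V by blast
    have "s \<in> comb ?U (G ?U)"
      using comb_restrict[OF W1(1) U _ W1(4)] comb_mono[OF mono[of ?U W1]] by blast
    then have "restrict_section s V \<in> comb ?U (G ?U)" by (rule comb_cong) simp
    with U W1 \<open>p \<in> V\<close> show ?thesis by blast
  qed
  with free_restrict[OF s(1) V] show "restrict_section s V \<in> generated_subsheaf sc X G V"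
    unfolding generated_iff by blast
next
  fix W s assume s: "s \<in> free_sheaf sc X W"
    and loc: "\<And>p. p \<in> W \<Longrightarrow> \<exists>W'. openin (opens X) W' \<and> p \<in> W' \<and> W' \<subseteq> W \<and>
      restrict_section s W' \<in> generated_subsheaf sc X G W'"
  have "\<exists>W'. openin (opens X) W' \<and> p \<in> W' \<and> W' \<subseteq> W \<and> s \<in> comb W' (G W')" if "p \<in> W" for p
  proof -
    obtain W' where W': "p \<in> W'" "W' \<subseteq> W" "restrict_section s W' \<in> generated_subsheaf sc X G W'"
      using loc \<open>p \<in> W\<close> by blast
    then obtain V where V: "openin (opens X) V" "p \<in> V" "V \<subseteq> W'" "restrict_section s W' \<in> comb V (G V)"
      unfolding generated_iff by blast
    from V(4) have "s \<in> comb V (G V)"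
      by (rule comb_cong) (use V(3) in \<open>auto simp: restrict_section_def\<close>)
    with V W' show ?thesis by blast
  qed
  with s show "s \<in> generated_subsheaf sc X G W" unfolding generated_iff by blast
qed (auto simp: generated_iff)

lemma generatedI:
  assumes "s \<in> free_sheaf sc X W" "s \<in> comb W (G W)"
  shows "s \<in> generated_subsheaf sc X G W"
  using assms free_sheafD(1) unfolding generated_iff by blast

text \<open>Both inclusions are the same gluing argument: a section of one subsheaf, restricted to
  members of the cover, is a section of the other.\<close>

lemma subsheaf_eqI:
  assumes F: "module_subsheaf sc X F" and F': "module_subsheaf sc X F'"
    and cover: "\<And>p. p \<in> topspace (opens X) \<Longrightarrow> \<exists>U. openin (opens X) U \<and> p \<in> U \<and>
      (\<forall>W. openin (opens X) W \<and> W \<subseteq> U \<longrightarrow> F W = F' W)"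
  shows "F = F'"
proof -
  have *: "s \<in> F2 W"
    if F1: "module_subsheaf sc X F1" and F2: "module_subsheaf sc X F2" and s: "s \<in> F1 W"
      and cover: "\<And>p. p \<in> topspace (opens X) \<Longrightarrow> \<exists>U. openin (opens X) U \<and> p \<in> U \<and>
        (\<forall>W. openin (opens X) W \<and> W \<subseteq> U \<longrightarrow> F1 W = F2 W)" for F1 F2 s W
  proof (rule subsheaf_glue[OF F2])
    show free: "s \<in> free_sheaf sc X W" using subsheaf_free[OF F1 s] .
    fix p assume p: "p \<in> W"
    have W: "openin (opens X) W" using free_sheafD(1)[OF free] .
    then have "p \<in> topspace (opens X)" using p openin_subset by blast
    then obtain U where U: "openin (opens X) U" "p \<in> U"
      "\<forall>W. openin (opens X) W \<and> W \<subseteq> U \<longrightarrow> F1 W = F2 W" using cover by blast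
    have "openin (opens X) (U \<inter> W)" using U W by blast
    moreover have "restrict_section s (U \<inter> W) \<in> F1 (U \<inter> W)"
      using subsheaf_restrict[OF F1 W _ _ s] calculation by blast
    ultimately show "\<exists>W'. openin (opens X) W' \<and> p \<in> W' \<and> W' \<subseteq> W \<and> restrict_section s W' \<in> F2 W'"
      using U p by (intro exI[of _ "U \<inter> W"]) auto
  qed
  have "F W = F' W" for W
  proof
    show "F W \<subseteq> F' W" using *[OF F F'] cover by blast
    show "F' W \<subseteq> F W"
    proof
      fix s assume "s \<in> F' W"
      then show "s \<in> F W" by (rule *[OF F' F]) (metis cover)
    qed
  qed
  then show ?thesis by blast
qed

end

section \<open>Matrices over a field\<close>

lemma matrix_inv_right: "invertible A \<Longrightarrow> A ** matrix_inv A = mat 1"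
  and matrix_inv_left: "invertible A \<Longrightarrow> matrix_inv A ** A = mat 1"
  for A :: "'a::field^'n^'n"
  unfolding matrix_inv_def invertible_def by (metis (mono_tags, lifting) someI_ex)+

lemma invertible_matrix_inv: "invertible A \<Longrightarrow> invertible (matrix_inv A)"
  for A :: "'a::field^'n^'n"
  using matrix_inv_right matrix_inv_left unfolding invertible_def by blast

lemma matrix_inv_unique:
  fixes A :: "'a::field^'n^'n"
  assumes "A ** B = mat 1" shows "matrix_inv A = B"
proof -
  have "invertible A" using assms invertible_right_inverse by blast
  then have "matrix_inv A ** (A ** B) = B" by (simp add: matrix_mul_assoc matrix_inv_left)
  then show ?thesis by (simp add: assms)
qed

text \<open>Cramer's description: the entry at \<open>i\<close>, \<open>j\<close> is the determinant
  of \<open>A\<close> with column \<open>i\<close> replaced by the unit vector at \<open>j\<close>,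
  hence a polynomial in the entries of \<open>A\<close>.\<close>

definition adjugate :: "'a::field^'n^'n \<Rightarrow> 'a^'n^'n" where
  "adjugate A = (\<chi> i j. det (\<chi> a b. if b = i then (if a = j then 1 else 0) else A $ a $ b))"

lemma matrix_inv_adjugate:
  fixes A :: "'a::field^'n^'n"
  assumes "invertible A"
  shows "matrix_inv A $ i $ j = adjugate A $ i $ j / det A"
proof -
  define B where "B = (\<chi> i j. adjugate A $ i $ j / det A)"
  have d: "det A \<noteq> 0" using assms invertible_det_nz by blast
  have "A *v (\<chi> i. B $ i $ l) = (\<chi> a. if a = l then 1 else 0)" for l
    unfolding cramer[OF d] by (simp add: B_def adjugate_def cong: if_cong)
  then have "(A *v (\<chi> i. B $ i $ l)) $ k = (if k = l then 1 else 0)" for k l by simp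
  then have "(A ** B) $ k $ l = mat 1 $ k $ l" for k l
    by (simp add: matrix_matrix_mult_def matrix_vector_mult_def mat_def)
  then have "A ** B = mat 1" by (simp add: vec_eq_iff)
  then have "matrix_inv A = B" by (rule matrix_inv_unique)
  then show ?thesis by (simp add: B_def)
qed

lemma matrix_polys_sum:
  "finite I \<Longrightarrow> (\<And>i. i \<in> I \<Longrightarrow> f i \<in> matrix_polys) \<Longrightarrow> (\<lambda>A. \<Sum>i\<in>I. f i A) \<in> matrix_polys"
  by (induction I rule: finite_induct) (auto intro: matrix_polys.intros)

lemma matrix_polys_prod:
  "finite I \<Longrightarrow> (\<And>i. i \<in> I \<Longrightarrow> f i \<in> matrix_polys) \<Longrightarrow> (\<lambda>A. \<Prod>i\<in>I. f i A) \<in> matrix_polys"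
  by (induction I rule: finite_induct) (auto intro: matrix_polys.intros)

lemma matrix_polys_power: "f \<in> matrix_polys \<Longrightarrow> (\<lambda>A. f A ^ n) \<in> matrix_polys"
  by (induction n) (auto intro: matrix_polys.intros)

lemma matrix_polys_det:
  assumes "\<And>i j. (\<lambda>A. M A $ i $ j) \<in> matrix_polys"
  shows "(\<lambda>A. det (M A)) \<in> matrix_polys"
  unfolding det_def
  by (intro matrix_polys_sum finite_permutations finite matrix_polys.mult matrix_polys.const
      matrix_polys_prod assms)

lemma matrix_polys_compose:
  assumes "f \<in> matrix_polys" "\<And>i j. (\<lambda>A. M A $ i $ j) \<in> matrix_polys"
  shows "(\<lambda>A. f (M A)) \<in> matrix_polys"
  using assms(1) by induction (auto intro: matrix_polys.intros assms(2))

lemma matrix_polys_adjugate: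
  assumes "\<And>i j. (\<lambda>A. M A $ i $ j) \<in> matrix_polys"
  shows "(\<lambda>A. adjugate (M A) $ i $ j) \<in> matrix_polys"
proof -
  have "(\<lambda>A. (if b = i then (if a = j then 1 else 0) else M A $ a $ b)) \<in> matrix_polys" for a b
    by (cases "b = i") (simp_all add: assms matrix_polys.const)
  then show ?thesis unfolding adjugate_def by (auto intro!: matrix_polys_det)
qed

section \<open>Maximal minors and normal forms of matrices of full rank\<close>

lemma submat_nth [simp]: "submat \<sigma> A $ i = A $ \<sigma> i"
  by (simp add: submat_def)

lemma submat_mult: "submat \<sigma> (A ** g) = submat \<sigma> A ** g"
  by (simp add: submat_def matrix_matrix_mult_def vec_eq_iff)

definition minor :: "('r \<Rightarrow> 'n) \<Rightarrow> 'k::field^'r^'n \<Rightarrow> 'k" where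
  "minor \<sigma> A = det (submat \<sigma> A)"

lemma minor_neq_0_iff: "minor \<sigma> A \<noteq> 0 \<longleftrightarrow> invertible (submat \<sigma> A)"
  by (simp add: minor_def invertible_det_nz)

lemma matrix_polys_minor: "minor \<sigma> \<in> matrix_polys"
  unfolding minor_def[abs_def] by (rule matrix_polys_det) (simp add: matrix_polys.coord)

text \<open>Rank is read as row rank: the rows span the whole space exactly when a left inverse
  exists.\<close>

lemma full_rank_iff_left_invertible:
  fixes A :: "'k::field^'r^'n"
  shows "A \<in> full_rank \<longleftrightarrow> (\<exists>B. B ** A = mat 1)"
proof -
  have "vec.dim (rows A) = CARD('r) \<longleftrightarrow> vec.span (rows A) = UNIV"
    using vec.dim_eq_full[of "rows A"] vec_dim_card vec.dim_UNIV by (metis vec.dimension_def)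
  then show ?thesis
    by (simp add: full_rank_def row_rank_def_gen matrix_left_invertible_span_rows_gen)
qed

lemma minor_full_rank:
  fixes A :: "'k::field^'r^'n"
  assumes "minor \<sigma> A \<noteq> 0"
  shows "A \<in> full_rank"
proof -
  have "x = 0" if "A *v x = 0" for x
  proof -
    have "submat \<sigma> A *v x = 0"
      using that by (simp add: matrix_vector_mult_def vec_eq_iff)
    moreover have "\<forall>x. submat \<sigma> A *v x = 0 \<longrightarrow> x = 0"
      using assms unfolding minor_neq_0_iff invertible_left_inverse matrix_left_invertible_ker .
    ultimately show ?thesis by simp
  qed
  then show ?thesis
    unfolding full_rank_iff_left_invertible matrix_left_invertible_ker by simp
qed

text \<open>The position of \<open>j\<close> in the finite order is the number of smaller elements,
  and this number indexes the sorted list of \<open>I\<close>.\<close>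

lemma ex_strict_mono_range:
  fixes I :: "'n::linorder set"
  assumes "finite I" "card I = CARD('r::{finite,linorder})"
  shows "\<exists>\<sigma>::'r \<Rightarrow> 'n. strict_mono \<sigma> \<and> range \<sigma> = I"
proof -
  define rk where "rk = (\<lambda>j::'r. card {i. i < j})"
  define xs where "xs = sorted_list_of_set I"
  have rk_mono: "rk i < rk j" if "i < j" for i j
    unfolding rk_def by (rule psubset_card_mono) (use that in auto)
  have len: "length xs = CARD('r)" using assms by (simp add: xs_def)
  have rk_less: "rk j < length xs" for j
    unfolding len rk_def by (rule psubset_card_mono) auto
  have sorted: "sorted_wrt (<) xs" by (simp add: xs_def)
  have mono: "strict_mono (\<lambda>j. xs ! rk j)"
    by (rule strict_monoI) (simp add: sorted_wrt_nth_less[OF sorted] rk_mono rk_less)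
  have "xs ! rk j \<in> set xs" for j by (rule nth_mem[OF rk_less])
  then have "range (\<lambda>j. xs ! rk j) \<subseteq> I" using assms(1) by (auto simp: xs_def)
  moreover have "card (range (\<lambda>j. xs ! rk j)) = card I"
    using strict_mono_imp_inj_on[OF mono] by (simp add: card_image assms(2))
  ultimately have "range (\<lambda>j. xs ! rk j) = I" using assms(1) by (simp add: card_subset_eq)
  with mono show ?thesis by blast
qed

text \<open>The rows contain a basis of the row space, with as many members as there are columns;
  the indices of these rows, put in increasing order, select an invertible submatrix.\<close>

lemma full_rank_ex_minor:
  fixes A :: "'k::field^'r::{finite,linorder}^'n::{finite,linorder}"
  assumes "A \<in> full_rank"
  shows "\<exists>\<sigma>. strict_mono \<sigma> \<and> minor \<sigma> A \<noteq> 0"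
proof -
  obtain B where B: "B \<subseteq> rows A" "vec.independent B" "rows A \<subseteq> vec.span B" "card B = vec.dim (rows A)"
    using vec.basis_exists by blast
  have card_B: "card B = CARD('r)" using B(4) assms by (simp add: full_rank_def row_rank_def_gen)
  have "\<exists>i. A $ i = b" if "b \<in> B" for b using B(1) that by (auto simp: rows_def row_def)
  then have "\<forall>b\<in>B. \<exists>i. A $ i = b" by simp
  from bchoice[OF this] obtain f where f: "\<forall>b\<in>B. A $ f b = b" by blast
  have inj: "inj_on f B" by (rule inj_on_inverseI[of _ "\<lambda>i. A $ i"]) (use f in simp)
  obtain \<sigma> :: "'r \<Rightarrow> 'n" where \<sigma>: "strict_mono \<sigma>" "range \<sigma> = f ` B"
    using ex_strict_mono_range[of "f ` B"] card_image[OF inj] card_B by auto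
  have "rows (submat \<sigma> A) = (\<lambda>i. A $ i) ` range \<sigma>"
    by (auto simp: rows_def row_def image_def)
  also have "\<dots> = B" using f by (simp add: \<sigma>(2) image_image)
  finally have "vec.span (rows (submat \<sigma> A)) = vec.span (rows A)"
    using vec.span_mono[OF B(1)] vec.span_minimal[OF B(3) vec.subspace_span] by simp
  then have "invertible (submat \<sigma> A)"
    using assms unfolding full_rank_iff_left_invertible invertible_left_inverse
      matrix_left_invertible_span_rows_gen by simp
  with \<sigma>(1) minor_neq_0_iff show ?thesis by blast
qed

text \<open>Where the minor is nonzero this is the composite of \<open>column_span\<close> with
  \<open>chart_matrix \<sigma>\<close>, given by a formula on matrices that makes its algebraic
  nature visible.\<close>

definition col_reduce :: "('r \<Rightarrow> 'n) \<Rightarrow> 'k::field^'r^'n \<Rightarrow> 'k^'r^'n" where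
  "col_reduce \<sigma> A = A ** matrix_inv (submat \<sigma> A)"

lemma submat_col_reduce: "minor \<sigma> A \<noteq> 0 \<Longrightarrow> submat \<sigma> (col_reduce \<sigma> A) = mat 1"
  by (simp add: col_reduce_def submat_mult matrix_inv_right minor_neq_0_iff)

lemma col_reduce_mult_submat: "minor \<sigma> A \<noteq> 0 \<Longrightarrow> col_reduce \<sigma> A ** submat \<sigma> A = A"
  by (simp add: col_reduce_def minor_neq_0_iff matrix_inv_left flip: matrix_mul_assoc)

lemma minor_col_reduce: "minor \<sigma> A \<noteq> 0 \<Longrightarrow> minor \<sigma> (col_reduce \<sigma> A) = 1"
  by (simp add: minor_def submat_col_reduce[unfolded minor_def])

text \<open>By Cramer's rule the entries of the reduced matrix are polynomials divided by the minor,
  so a power of the minor clears the denominators of any polynomial expression in them.\<close>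

lemma col_reduce_poly:
  fixes f :: "'k::field^'r^'n \<Rightarrow> 'k" and \<sigma> :: "'r \<Rightarrow> 'n"
  assumes "f \<in> matrix_polys"
  shows "\<exists>F\<in>matrix_polys. \<exists>N. \<forall>A. minor \<sigma> A \<noteq> 0 \<longrightarrow> f (col_reduce \<sigma> A) * minor \<sigma> A ^ N = F A"
  using assms
proof induction
  case (const c)
  show ?case by (rule bexI[OF _ matrix_polys.const[of c]], rule exI[of _ 0]) simp
next
  case (coord i j)
  let ?F = "\<lambda>A::'k^'r^'n. \<Sum>k\<in>UNIV. A $ i $ k * adjugate (submat \<sigma> A) $ k $ j"
  have 1: "?F \<in> matrix_polys"
    by (intro matrix_polys_sum finite matrix_polys.mult matrix_polys.coord matrix_polys_adjugate)
      (simp add: matrix_polys.coord)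
  have 2: "col_reduce \<sigma> A $ i $ j * minor \<sigma> A ^ 1 = ?F A" if "minor \<sigma> A \<noteq> 0" for A
    using that minor_neq_0_iff[of \<sigma> A]
    by (simp add: col_reduce_def matrix_matrix_mult_def matrix_inv_adjugate sum_distrib_right)
      (simp add: minor_def)
  show ?case by (rule bexI[OF _ 1], rule exI[of _ 1]) (use 2 in blast)
next
  case (add f g)
  from add.IH(1) obtain F N where F: "F \<in> matrix_polys"
    and FN: "\<forall>A. minor \<sigma> A \<noteq> 0 \<longrightarrow> f (col_reduce \<sigma> A) * minor \<sigma> A ^ N = F A" by blast
  from add.IH(2) obtain G M where G: "G \<in> matrix_polys"
    and GM: "\<forall>A. minor \<sigma> A \<noteq> 0 \<longrightarrow> g (col_reduce \<sigma> A) * minor \<sigma> A ^ M = G A" by blast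
  let ?F = "\<lambda>A. F A * minor \<sigma> A ^ M + G A * minor \<sigma> A ^ N"
  have 1: "?F \<in> matrix_polys"
    by (intro matrix_polys.add matrix_polys.mult F G matrix_polys_power matrix_polys_minor)
  have 2: "(f (col_reduce \<sigma> A) + g (col_reduce \<sigma> A)) * minor \<sigma> A ^ (N + M) = ?F A"
    if "minor \<sigma> A \<noteq> 0" for A
    using FN[rule_format, OF that, symmetric] GM[rule_format, OF that, symmetric]
    by (simp add: power_add algebra_simps)
  show ?case by (rule bexI[OF _ 1], rule exI[of _ "N + M"]) (use 2 in blast)
next
  case (mult f g)
  from mult.IH(1) obtain F N where F: "F \<in> matrix_polys"
    and FN: "\<forall>A. minor \<sigma> A \<noteq> 0 \<longrightarrow> f (col_reduce \<sigma> A) * minor \<sigma> A ^ N = F A" by blast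
  from mult.IH(2) obtain G M where G: "G \<in> matrix_polys"
    and GM: "\<forall>A. minor \<sigma> A \<noteq> 0 \<longrightarrow> g (col_reduce \<sigma> A) * minor \<sigma> A ^ M = G A" by blast
  have 2: "(f (col_reduce \<sigma> A) * g (col_reduce \<sigma> A)) * minor \<sigma> A ^ (N + M) = F A * G A"
    if "minor \<sigma> A \<noteq> 0" for A
    using FN[rule_format, OF that, symmetric] GM[rule_format, OF that, symmetric]
    by (simp add: power_add algebra_simps)
  show ?case by (rule bexI[OF _ matrix_polys.mult[OF F G]], rule exI[of _ "N + M"]) (use 2 in blast)
qed

section \<open>Regular functions on the matrices of full rank\<close>

type_synonym ('k, 'n, 'r) mat = "(('k, 'r) vec, 'n) vec"

lemma ex2I: "P a b \<Longrightarrow> \<exists>x y. P x y"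
  by blast

lemma openin_zariski_iff:
  fixes W :: "('k::field^'r^'n) set"
  shows "openin zariski W \<longleftrightarrow> (\<forall>A\<in>W. \<exists>f\<in>matrix_polys. f A \<noteq> 0 \<and> (\<forall>B. f B \<noteq> 0 \<longrightarrow> B \<in> W))"
proof
  assume "openin zariski W"
  then obtain S where "S \<subseteq> matrix_polys" "W = nonvanishing_locus S" unfolding openin_zariski by blast
  then show "\<forall>A\<in>W. \<exists>f\<in>matrix_polys. f A \<noteq> 0 \<and> (\<forall>B. f B \<noteq> 0 \<longrightarrow> B \<in> W)"
    by (auto simp: nonvanishing_locus_def)
next
  assume *: "\<forall>A\<in>W. \<exists>f\<in>matrix_polys. f A \<noteq> 0 \<and> (\<forall>B. f B \<noteq> 0 \<longrightarrow> B \<in> W)"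
  let ?S = "{f \<in> matrix_polys. \<forall>B. f B \<noteq> 0 \<longrightarrow> B \<in> W}"
  have "W = nonvanishing_locus ?S" using * by (auto simp: nonvanishing_locus_def)
  then show "openin zariski W" unfolding openin_zariski by (intro exI[of _ ?S]) auto
qed

lemma openin_zariski_nonzero: "h \<in> matrix_polys \<Longrightarrow> openin zariski {A. h A \<noteq> 0}"
  unfolding openin_zariski_iff by auto

lemma openin_full_rank: "openin zariski (full_rank :: ('k::field, 'n::{finite,linorder}, 'r::{finite,linorder}) mat set)"
  unfolding openin_zariski_iff
proof
  fix A :: "('k, 'n, 'r) mat" assume "A \<in> full_rank"
  then obtain \<sigma> :: "'r \<Rightarrow> 'n" where "minor \<sigma> A \<noteq> 0" using full_rank_ex_minor by blast
  then show "\<exists>f\<in>matrix_polys. f A \<noteq> 0 \<and> (\<forall>B. f B \<noteq> 0 \<longrightarrow> B \<in> full_rank)"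
    using minor_full_rank by (intro bexI[OF _ matrix_polys_minor[of \<sigma>]]) blast
qed

lemma openin_Mo_iff:
  fixes W :: "('k::field, 'n::{finite,linorder}, 'r::{finite,linorder}) mat set"
  shows "openin (opens Mo) W \<longleftrightarrow> openin zariski W \<and> W \<subseteq> full_rank"
  by (simp add: Mo_def openin_open_subtopology openin_full_rank)

text \<open>The neighbourhood can be absorbed into the fraction: multiplying numerator and
  denominator by a polynomial that cuts out a principal open set inside it makes nonvanishing of the
  denominator the only condition.\<close>

lemma regular_functions_iff:
  fixes W :: "('k::field^'r^'n) set"
  shows "a \<in> regular_functions W \<longleftrightarrow> (\<forall>A. A \<notin> W \<longrightarrow> a A = 0) \<and>
    (\<forall>A\<in>W. \<exists>g\<in>matrix_polys. \<exists>h\<in>matrix_polys. h A \<noteq> 0 \<and> (\<forall>B. h B \<noteq> 0 \<longrightarrow> B \<in> W \<and> a B = g B / h B))"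
    (is "_ \<longleftrightarrow> ?out \<and> (\<forall>A\<in>W. ?loc A)")
proof -
  have "(\<exists>W' g h. openin zariski W' \<and> A \<in> W' \<and> W' \<subseteq> W \<and>
            g \<in> matrix_polys \<and> h \<in> matrix_polys \<and> (\<forall>B\<in>W'. h B \<noteq> 0 \<and> a B = g B / h B)) \<longleftrightarrow> ?loc A"
    (is "?L \<longleftrightarrow> _") for A
  proof
    assume ?L
    then obtain W' g h where W': "openin zariski W'" "A \<in> W'" "W' \<subseteq> W"
      and gh: "g \<in> matrix_polys" "h \<in> matrix_polys" "\<And>B. B \<in> W' \<Longrightarrow> h B \<noteq> 0 \<and> a B = g B / h B" by blast
    obtain f where f: "f \<in> matrix_polys" "f A \<noteq> 0" "\<And>B. f B \<noteq> 0 \<Longrightarrow> B \<in> W'"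
      using W' unfolding openin_zariski_iff by blast
    show "?loc A"
    proof (rule bexI[OF _ matrix_polys.mult[OF gh(1) f(1)]], rule bexI[OF _ matrix_polys.mult[OF gh(2) f(1)]],
        intro conjI allI impI)
      show "h A * f A \<noteq> 0" using gh(3)[OF W'(2)] f(2) by simp
      fix B assume "h B * f B \<noteq> 0"
      then show "B \<in> W" "a B = g B * f B / (h B * f B)"
        using f(3)[of B] W'(3) gh(3)[of B] by auto
    qed
  next
    assume "?loc A"
    then obtain g h where gh: "g \<in> matrix_polys" "h \<in> matrix_polys" "h A \<noteq> 0"
      "\<forall>B. h B \<noteq> 0 \<longrightarrow> B \<in> W \<and> a B = g B / h B" by blast
    show ?L
      by (rule exI[of _ "{B. h B \<noteq> 0}"], rule exI[of _ g], rule exI[of _ h])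
        (use gh openin_zariski_nonzero[OF gh(2)] in auto)
  qed
  then show ?thesis by (simp add: regular_functions_def)
qed

lemma regular_functionsD:
  assumes "a \<in> regular_functions W" "A \<in> W"
  shows "\<exists>g h. g \<in> matrix_polys \<and> h \<in> matrix_polys \<and> h A \<noteq> 0 \<and> (\<forall>B. h B \<noteq> 0 \<longrightarrow> B \<in> W \<and> a B = g B / h B)"
  using assms unfolding regular_functions_iff by blast

lemma regular_functionsI:
  assumes "\<And>A. A \<notin> W \<Longrightarrow> a A = 0"
    and "\<And>A. A \<in> W \<Longrightarrow> \<exists>g h. g \<in> matrix_polys \<and> h \<in> matrix_polys \<and> h A \<noteq> 0 \<and>
      (\<forall>B. h B \<noteq> 0 \<longrightarrow> B \<in> W \<and> a B = g B / h B)"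
  shows "a \<in> regular_functions W"
  using assms unfolding regular_functions_iff by blast

lemma regular_functions_outside: "a \<in> regular_functions W \<Longrightarrow> A \<notin> W \<Longrightarrow> a A = 0"
  unfolding regular_functions_iff by blast

lemma regular_fraction:
  assumes W: "openin zariski W" and g: "g \<in> matrix_polys" and h: "h \<in> matrix_polys"
    and nz: "\<And>A. A \<in> W \<Longrightarrow> h A \<noteq> 0"
  shows "restrict_section (\<lambda>A. g A / h A) W \<in> regular_functions W"
proof (rule regular_functionsI)
  fix A assume A: "A \<in> W"
  then obtain f where f: "f \<in> matrix_polys" "f A \<noteq> 0" "\<And>B. f B \<noteq> 0 \<Longrightarrow> B \<in> W"
    using W unfolding openin_zariski_iff by blast
  have "h A * f A \<noteq> 0" using nz[OF A] f(2) by simp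
  moreover have "B \<in> W \<and> restrict_section (\<lambda>A. g A / h A) W B = g B * f B / (h B * f B)"
    if "h B * f B \<noteq> 0" for B
    using that f(3)[of B] by auto
  ultimately show "\<exists>g' h'. g' \<in> matrix_polys \<and> h' \<in> matrix_polys \<and> h' A \<noteq> 0 \<and>
      (\<forall>B. h' B \<noteq> 0 \<longrightarrow> B \<in> W \<and> restrict_section (\<lambda>A. g A / h A) W B = g' B / h' B)"
    using matrix_polys.mult[OF g f(1)] matrix_polys.mult[OF h f(1)]
    by (intro ex2I[of _ "\<lambda>B. g B * f B" "\<lambda>B. h B * f B"]) simp
qed simp

lemma regular_poly:
  assumes "openin zariski W" "g \<in> matrix_polys"
  shows "restrict_section g W \<in> regular_functions W"
  using regular_fraction[OF assms matrix_polys.const[of 1]] by simp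

lemma regular_restrict:
  assumes a: "a \<in> regular_functions W" and W': "openin zariski W'" "W' \<subseteq> W"
  shows "restrict_section a W' \<in> regular_functions W'"
proof (rule regular_functionsI)
  fix A assume A: "A \<in> W'"
  then obtain g h where gh: "g \<in> matrix_polys" "h \<in> matrix_polys" "h A \<noteq> 0"
      "\<And>B. h B \<noteq> 0 \<Longrightarrow> B \<in> W \<and> a B = g B / h B" using regular_functionsD[OF a, of A] W'(2) by blast
  obtain f where f: "f \<in> matrix_polys" "f A \<noteq> 0" "\<And>B. f B \<noteq> 0 \<Longrightarrow> B \<in> W'"
    using W'(1) A unfolding openin_zariski_iff by blast
  have "B \<in> W' \<and> a B = g B * f B / (h B * f B)" if "h B * f B \<noteq> 0" for B
    using that f(3)[of B] gh(4)[of B] by auto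
  then show "\<exists>g' h'. g' \<in> matrix_polys \<and> h' \<in> matrix_polys \<and> h' A \<noteq> 0 \<and>
      (\<forall>B. h' B \<noteq> 0 \<longrightarrow> B \<in> W' \<and> restrict_section a W' B = g' B / h' B)"
    using matrix_polys.mult[OF gh(1) f(1)] matrix_polys.mult[OF gh(2) f(1)] gh(3) f(2)
    by (intro ex2I[of _ "\<lambda>B. g B * f B" "\<lambda>B. h B * f B"]) simp
qed simp

lemma regular_add_mult:
  assumes a: "a \<in> regular_functions W" and b: "b \<in> regular_functions W"
  shows "(\<lambda>A. a A + b A) \<in> regular_functions W" "(\<lambda>A. a A * b A) \<in> regular_functions W"
proof -
  have loc: "\<exists>g g' h h'. g \<in> matrix_polys \<and> g' \<in> matrix_polys \<and> h \<in> matrix_polys \<and> h' \<in> matrix_polys \<and>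
      h A * h' A \<noteq> 0 \<and> (\<forall>B. h B * h' B \<noteq> 0 \<longrightarrow> B \<in> W \<and> a B = g B / h B \<and> b B = g' B / h' B)"
    if AW: "A \<in> W" for A
  proof -
    obtain g h where gh: "g \<in> matrix_polys" "h \<in> matrix_polys" "h A \<noteq> 0"
      "\<forall>B. h B \<noteq> 0 \<longrightarrow> B \<in> W \<and> a B = g B / h B" using regular_functionsD[OF a AW] by blast
    obtain g' h' where gh': "g' \<in> matrix_polys" "h' \<in> matrix_polys" "h' A \<noteq> 0"
      "\<forall>B. h' B \<noteq> 0 \<longrightarrow> B \<in> W \<and> b B = g' B / h' B" using regular_functionsD[OF b AW] by blast
    show ?thesis
      by (rule exI[of _ g], rule exI[of _ g'], rule exI[of _ h], rule exI[of _ h']) (use gh gh' in simp)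
  qed
  show "(\<lambda>A. a A + b A) \<in> regular_functions W"
  proof (rule regular_functionsI)
    fix A assume "A \<in> W"
    then obtain g g' h h' where p: "g \<in> matrix_polys" "g' \<in> matrix_polys" "h \<in> matrix_polys" "h' \<in> matrix_polys"
      and h: "h A * h' A \<noteq> 0" "\<forall>B. h B * h' B \<noteq> 0 \<longrightarrow> B \<in> W \<and> a B = g B / h B \<and> b B = g' B / h' B"
      using loc by blast
    have "(\<lambda>B. g B * h' B + g' B * h B) \<in> matrix_polys" "(\<lambda>B. h B * h' B) \<in> matrix_polys"
      by (intro matrix_polys.add matrix_polys.mult p)+
    then show "\<exists>G H. G \<in> matrix_polys \<and> H \<in> matrix_polys \<and> H A \<noteq> 0 \<and>
      (\<forall>B. H B \<noteq> 0 \<longrightarrow> B \<in> W \<and> a B + b B = G B / H B)"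
      using h by (intro ex2I[of _ "\<lambda>B. g B * h' B + g' B * h B" "\<lambda>B. h B * h' B"])
        (simp add: add_frac_eq)
  qed (simp add: regular_functions_outside[OF a] regular_functions_outside[OF b])
  show "(\<lambda>A. a A * b A) \<in> regular_functions W"
  proof (rule regular_functionsI)
    fix A assume "A \<in> W"
    then obtain g g' h h' where p: "g \<in> matrix_polys" "g' \<in> matrix_polys" "h \<in> matrix_polys" "h' \<in> matrix_polys"
      and h: "h A * h' A \<noteq> 0" "\<forall>B. h B * h' B \<noteq> 0 \<longrightarrow> B \<in> W \<and> a B = g B / h B \<and> b B = g' B / h' B"
      using loc by blast
    have "(\<lambda>B. g B * g' B) \<in> matrix_polys" "(\<lambda>B. h B * h' B) \<in> matrix_polys"
      by (intro matrix_polys.mult p)+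
    then show "\<exists>G H. G \<in> matrix_polys \<and> H \<in> matrix_polys \<and> H A \<noteq> 0 \<and>
      (\<forall>B. H B \<noteq> 0 \<longrightarrow> B \<in> W \<and> a B * b B = G B / H B)"
      using h by (intro ex2I[of _ "\<lambda>B. g B * g' B" "\<lambda>B. h B * h' B"]) simp
  qed (simp add: regular_functions_outside[OF a] regular_functions_outside[OF b])
qed

lemma function_sheaf_Mo:
  fixes sc :: "'k::field \<Rightarrow> 'm::ab_group_add \<Rightarrow> 'm"
  assumes "vector_space sc"
  shows "function_sheaf sc (Mo :: (('k, 'n::{finite,linorder}, 'r::{finite,linorder}) mat, 'k) function_space)"
proof -
  interpret vector_space sc by fact
  show ?thesis
  proof
    fix W :: "('k, 'n, 'r) mat set" and c
    assume "openin (opens Mo) W"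
    then have "restrict_section (\<lambda>_. c) W \<in> regular_functions W"
      by (intro regular_poly matrix_polys.const) (simp add: openin_Mo_iff)
    then show "(\<lambda>p. if p \<in> W then c else 0) \<in> reg_funs Mo W"
      by (simp add: Mo_def restrict_section_def)
  qed (simp_all add: openin_Mo_iff, simp_all add: Mo_def regular_functions_outside regular_add_mult regular_restrict)
qed

text \<open>Clearing denominators turns the condition
  \<open>f (col_reduce \<sigma> A) \<noteq> 0\<close> into nonvanishing of a polynomial; a further
  factor \<open>minor \<sigma>\<close> keeps the reduction meaningful.\<close>

lemma openin_col_reduce_vimage:
  fixes W :: "('k::field^'r^'n) set"
  assumes "openin zariski W"
  shows "openin zariski {A. minor \<sigma> A \<noteq> 0 \<and> col_reduce \<sigma> A \<in> W}"
  unfolding openin_zariski_iff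
proof
  fix A assume "A \<in> {A. minor \<sigma> A \<noteq> 0 \<and> col_reduce \<sigma> A \<in> W}"
  then have A: "minor \<sigma> A \<noteq> 0" "col_reduce \<sigma> A \<in> W" by auto
  then obtain f where f: "f \<in> matrix_polys" "f (col_reduce \<sigma> A) \<noteq> 0" "\<And>B. f B \<noteq> 0 \<Longrightarrow> B \<in> W"
    using assms unfolding openin_zariski_iff by blast
  obtain F N where F: "F \<in> matrix_polys" "\<forall>A. minor \<sigma> A \<noteq> 0 \<longrightarrow> f (col_reduce \<sigma> A) * minor \<sigma> A ^ N = F A"
    using col_reduce_poly[OF f(1)] by blast
  have "(\<lambda>B. F B * minor \<sigma> B) \<in> matrix_polys" by (intro matrix_polys.mult F matrix_polys_minor)
  moreover have "F A * minor \<sigma> A \<noteq> 0" using A(1) f(2) F(2)[rule_format, OF A(1), symmetric] by simp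
  moreover have "minor \<sigma> B \<noteq> 0 \<and> col_reduce \<sigma> B \<in> W" if "F B * minor \<sigma> B \<noteq> 0" for B
  proof -
    have B: "minor \<sigma> B \<noteq> 0" "F B \<noteq> 0" using that by auto
    then have "f (col_reduce \<sigma> B) \<noteq> 0" using F(2)[rule_format, OF B(1), symmetric] by auto
    with B f(3) show ?thesis by simp
  qed
  ultimately show "\<exists>f\<in>matrix_polys. f A \<noteq> 0 \<and> (\<forall>B. f B \<noteq> 0 \<longrightarrow> B \<in> {A. minor \<sigma> A \<noteq> 0 \<and> col_reduce \<sigma> A \<in> W})"
    by (intro bexI[of _ "\<lambda>B. F B * minor \<sigma> B"]) auto
qed

lemma regular_col_reduce:
  fixes W :: "('k::field^'r^'n) set" and \<sigma> :: "'r \<Rightarrow> 'n"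
  assumes a: "a \<in> regular_functions W"
  defines "W' \<equiv> {A. minor \<sigma> A \<noteq> 0 \<and> col_reduce \<sigma> A \<in> W}"
  shows "restrict_section (\<lambda>A. a (col_reduce \<sigma> A)) W' \<in> regular_functions W'"
proof (rule regular_functionsI)
  fix A assume "A \<in> W'"
  then have A: "minor \<sigma> A \<noteq> 0" "col_reduce \<sigma> A \<in> W" by (auto simp: W'_def)
  obtain g h where gh: "g \<in> matrix_polys" "h \<in> matrix_polys" "h (col_reduce \<sigma> A) \<noteq> 0"
    "\<And>B. h B \<noteq> 0 \<Longrightarrow> B \<in> W \<and> a B = g B / h B" using regular_functionsD[OF a A(2)] by blast
  obtain G N where G: "G \<in> matrix_polys" "\<forall>A. minor \<sigma> A \<noteq> 0 \<longrightarrow> g (col_reduce \<sigma> A) * minor \<sigma> A ^ N = G A"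
    using col_reduce_poly[OF gh(1)] by blast
  obtain H M where H: "H \<in> matrix_polys" "\<forall>A. minor \<sigma> A \<noteq> 0 \<longrightarrow> h (col_reduce \<sigma> A) * minor \<sigma> A ^ M = H A"
    using col_reduce_poly[OF gh(2)] by blast
  \<comment> \<open>The exponents are crossed because fractions with denominators
    \<open>minor \<sigma> B ^ N\<close> and \<open>minor \<sigma> B ^ M\<close> are divided by each
    other. One further factor on both sides ensures that a nonzero \<open>?H B\<close> forces a
    nonzero minor, even if \<open>N = 0\<close>.\<close>
  let ?G = "\<lambda>B. G B * minor \<sigma> B ^ Suc M" and ?H = "\<lambda>B. H B * minor \<sigma> B ^ Suc N"
  have p: "?G \<in> matrix_polys" "?H \<in> matrix_polys"
    by (intro matrix_polys.mult G H matrix_polys_power matrix_polys_minor)+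
  have nz: "?H A \<noteq> 0" using A(1) gh(3) H(2)[rule_format, OF A(1), symmetric] by simp
  have "B \<in> W' \<and> a (col_reduce \<sigma> B) = ?G B / ?H B" if "?H B \<noteq> 0" for B
  proof -
    have B: "minor \<sigma> B \<noteq> 0" "H B \<noteq> 0" using that by auto
    then have "h (col_reduce \<sigma> B) \<noteq> 0" using H(2)[rule_format, OF B(1), symmetric] by auto
    note * = gh(4)[OF this]
    then have "B \<in> W'" using B by (simp add: W'_def)
    with * show ?thesis
      using B(1) by (simp add: G(2)[rule_format, OF B(1), symmetric] H(2)[rule_format, OF B(1), symmetric])
  qed
  with p nz show "\<exists>g h. g \<in> matrix_polys \<and> h \<in> matrix_polys \<and> h A \<noteq> 0 \<and>
      (\<forall>B. h B \<noteq> 0 \<longrightarrow> B \<in> W' \<and> restrict_section (\<lambda>A. a (col_reduce \<sigma> A)) W' B = g B / h B)"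
    by (intro ex2I[of _ ?G ?H]) simp
qed simp

context vector_space
begin

lemma tensor_polys_scale:
  "f \<in> matrix_polys \<Longrightarrow> s \<in> tensor_functions scale matrix_polys \<Longrightarrow>
   (\<lambda>A. scale (f A) (s A)) \<in> tensor_functions scale matrix_polys"
  by (rule tensor_functions_map[where \<phi> = "\<lambda>g A. f A * g A" and h = "\<lambda>A. A"]) (auto intro: matrix_polys.mult)

lemma tensor_polys_compose:
  assumes "s \<in> tensor_functions scale matrix_polys" "\<And>i j. (\<lambda>A. M A $ i $ j) \<in> matrix_polys"
  shows "(\<lambda>A. s (M A)) \<in> tensor_functions scale matrix_polys"
  using tensor_functions_map[OF assms(1), where \<phi> = "\<lambda>g A. g (M A)" and h = M and c = "\<lambda>_. 1"]
    matrix_polys_compose[OF _ assms(2)] by simp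

text \<open>The finitely many local denominators are multiplied into one, leaving a polynomial
  vector-valued numerator; the nonvanishing locus of \<open>h\<close> is kept inside
  \<open>W\<close>.\<close>

lemma tensor_regular_local:
  assumes W: "openin zariski W" and s: "s \<in> tensor_functions scale (regular_functions W)" and A: "A \<in> W"
  shows "\<exists>G h. G \<in> tensor_functions scale matrix_polys \<and> h \<in> matrix_polys \<and> h A \<noteq> 0 \<and>
    (\<forall>B. h B \<noteq> 0 \<longrightarrow> B \<in> W \<and> scale (h B) (s B) = G B)"
proof -
  obtain N f m where f: "\<forall>i<(N::nat). f i \<in> regular_functions W" and s: "s = (\<lambda>p. \<Sum>i<N. scale (f i p) (m i))"
    using s unfolding tensor_functions_iff by blast
  have "\<exists>G h. G \<in> tensor_functions scale matrix_polys \<and> h \<in> matrix_polys \<and> h A \<noteq> 0 \<and>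
    (\<forall>B. h B \<noteq> 0 \<longrightarrow> B \<in> W \<and> scale (h B) (\<Sum>i<n. scale (f i B) (m i)) = G B)" if "n \<le> N" for n
    using that
  proof (induction n)
    case 0
    obtain h where "h \<in> matrix_polys" "h A \<noteq> 0" "\<forall>B. h B \<noteq> 0 \<longrightarrow> B \<in> W"
      using W A unfolding openin_zariski_iff by blast
    then show ?case
      using tensor_functions_zero by (intro ex2I[of _ "\<lambda>_. 0" h]) simp
  next
    case (Suc n)
    then obtain G h where G: "G \<in> tensor_functions scale matrix_polys" and h: "h \<in> matrix_polys" "h A \<noteq> 0"
      and eq: "\<forall>B. h B \<noteq> 0 \<longrightarrow> B \<in> W \<and> scale (h B) (\<Sum>i<n. scale (f i B) (m i)) = G B" by force
    obtain g' h' where g': "g' \<in> matrix_polys" and h': "h' \<in> matrix_polys" "h' A \<noteq> 0"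
      and eq': "\<forall>B. h' B \<noteq> 0 \<longrightarrow> B \<in> W \<and> f n B = g' B / h' B"
      using regular_functionsD[of "f n" W A] f Suc.prems A by auto
    let ?G = "\<lambda>B. scale (h' B) (G B) + scale (h B * g' B) (m n)" and ?h = "\<lambda>B. h' B * h B"
    have "?G \<in> tensor_functions scale matrix_polys"
      by (intro tensor_functions_add tensor_polys_scale G h' tensor_functions_pure matrix_polys.mult h g')
    moreover have "?h \<in> matrix_polys" by (intro matrix_polys.mult h h')
    moreover have "?h A \<noteq> 0" using h h' by simp
    moreover have "B \<in> W \<and> scale (?h B) (\<Sum>i<Suc n. scale (f i B) (m i)) = ?G B" if "?h B \<noteq> 0" for B
    proof -
      have B: "h B \<noteq> 0" "h' B \<noteq> 0" using that by auto
      note e = eq[rule_format, OF B(1)] eq'[rule_format, OF B(2)]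
      have "scale (h' B * h B) (\<Sum>i<n. scale (f i B) (m i)) = scale (h' B) (G B)"
        using e(1) by (simp flip: scale_scale)
      moreover have "h' B * h B * f n B = h B * g' B" using e(2) B by simp
      ultimately show ?thesis using e by (simp add: scale_right_distrib)
    qed
    ultimately show ?case by (intro ex2I[of _ ?G ?h]) blast
  qed
  from this[of N] show ?thesis by (simp add: s)
qed

end

section \<open>Linear algebra of the Grassmannian\<close>

lemma vector_space_kscale:
  fixes act :: "('e::comm_monoid_add \<Rightarrow>\<^sub>0 'k::field) \<Rightarrow> 'm::ab_group_add \<Rightarrow> 'm"
  assumes "module act"
  shows "vector_space (kscale act)"
proof -
  interpret module act by fact
  show ?thesis
  proof
    show "kscale act a (v + w) = kscale act a v + kscale act a w" for a v w
      by (simp add: kscale_def scale_right_distrib)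
    show "kscale act (a + b) v = kscale act a v + kscale act b v" for a b v
      by (simp add: kscale_def single_add scale_left_distrib)
    show "kscale act a (kscale act b v) = kscale act (a * b) v" for a b v
      by (simp add: kscale_def mult_single)
    show "kscale act 1 v = v" for v
      by (simp add: kscale_def)
  qed
qed

lemma module_mult: "module ((*) :: 'a::comm_ring_1 \<Rightarrow> 'a \<Rightarrow> 'a)"
  by standard (simp_all add: algebra_simps)

context vector_space
begin

lemma independent_range_zero:
  fixes c :: "'i::finite \<Rightarrow> 'b"
  assumes "inj c" "independent (range c)" "(\<Sum>j\<in>UNIV. scale (u j) (c j)) = 0"
  shows "u j = 0"
proof -
  have "(\<Sum>v\<in>range c. scale (u (inv c v)) v) = 0"
    using assms(3) by (subst sum.reindex[OF assms(1)]) (simp add: inv_f_f[OF assms(1)])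
  then have "u (inv c (c j)) = 0"
    by (intro independentD[OF assms(2) _ order_refl, where u = "\<lambda>v. u (inv c v)"]) auto
  then show ?thesis by (simp add: inv_f_f[OF assms(1)])
qed

text \<open>Injectivity belongs to the conclusion: if \<open>c i = c j\<close> for distinct indices,
  the coefficients \<open>1\<close> at \<open>i\<close> and \<open>-1\<close> at \<open>j\<close>
  form a nontrivial relation.\<close>

lemma independent_rangeI:
  fixes c :: "'i::finite \<Rightarrow> 'b"
  assumes *: "\<And>u. (\<Sum>j\<in>UNIV. scale (u j) (c j)) = 0 \<Longrightarrow> \<forall>j. u j = 0"
  shows "inj c" "independent (range c)"
proof -
  show "inj c"
  proof (rule injI)
    fix i j assume eq: "c i = c j"
    show "i = j"
    proof (rule ccontr)
      assume "i \<noteq> j"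
      let ?u = "\<lambda>l. (if l = i then 1 else 0) - (if l = j then 1 else 0) :: 'a"
      have "(\<Sum>l\<in>UNIV. scale (?u l) (c l)) =
          (\<Sum>l\<in>UNIV. if l = i then c l else 0) - (\<Sum>l\<in>UNIV. if l = j then c l else 0)"
        unfolding sum_subtractf[symmetric] by (rule sum.cong) (auto simp: scale_left_diff_distrib)
      also have "\<dots> = 0" by (simp add: eq)
      finally have "\<forall>l. ?u l = 0" by (rule *)
      then have "?u i = 0" by (rule spec)
      with \<open>i \<noteq> j\<close> show False by simp
    qed
  qed
  show "independent (range c)"
    unfolding dependent_finite[OF finite_imageI[OF finite]]
  proof
    assume "\<exists>u. (\<exists>v\<in>range c. u v \<noteq> 0) \<and> (\<Sum>v\<in>range c. scale (u v) v) = 0"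
    then obtain u j where u: "u (c j) \<noteq> 0" "(\<Sum>v\<in>range c. scale (u v) v) = 0" by blast
    then have "(\<Sum>j\<in>UNIV. scale (u (c j)) (c j)) = 0"
      by (simp add: sum.reindex[OF \<open>inj c\<close>])
    then have "\<forall>j. u (c j) = 0" by (rule *)
    then show False using u(1) by blast
  qed
qed

lemma span_range_sum:
  fixes c :: "'i::finite \<Rightarrow> 'b"
  shows "span (range c) = range (\<lambda>u. \<Sum>j\<in>UNIV. scale (u j) (c j))"
proof
  show "span (range c) \<subseteq> range (\<lambda>u. \<Sum>j\<in>UNIV. scale (u j) (c j))"
  proof (rule span_minimal)
    show "range c \<subseteq> range (\<lambda>u. \<Sum>j\<in>UNIV. scale (u j) (c j))"
    proof clarify
      fix i
      have "(\<Sum>j\<in>UNIV. scale (if j = i then 1 else 0) (c j)) = (\<Sum>j\<in>UNIV. if j = i then c j else 0)"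
        by (rule sum.cong) auto
      then have "c i = (\<Sum>j\<in>UNIV. scale (if j = i then 1 else 0) (c j))" by simp
      then show "c i \<in> range (\<lambda>u. \<Sum>j\<in>UNIV. scale (u j) (c j))"
        by (rule range_eqI[of _ _ "\<lambda>j. if j = i then 1 else 0"])
    qed
    show "subspace (range (\<lambda>u. \<Sum>j\<in>UNIV. scale (u j) (c j)))"
    proof (rule subspaceI)
      show "0 \<in> range (\<lambda>u. \<Sum>j\<in>UNIV. scale (u j) (c j))"
        by (rule range_eqI[of _ _ "\<lambda>_. 0"]) simp
    next
      fix v w assume "v \<in> range (\<lambda>u. \<Sum>j\<in>UNIV. scale (u j) (c j))"
        "w \<in> range (\<lambda>u. \<Sum>j\<in>UNIV. scale (u j) (c j))"
      then obtain u u' where "v = (\<Sum>j\<in>UNIV. scale (u j) (c j))" "w = (\<Sum>j\<in>UNIV. scale (u' j) (c j))"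
        by (elim rangeE)
      then show "v + w \<in> range (\<lambda>u. \<Sum>j\<in>UNIV. scale (u j) (c j))"
        by (intro range_eqI[of _ _ "\<lambda>j. u j + u' j"]) (simp add: scale_left_distrib sum.distrib)
    next
      fix a v assume "v \<in> range (\<lambda>u. \<Sum>j\<in>UNIV. scale (u j) (c j))"
      then obtain u where "v = (\<Sum>j\<in>UNIV. scale (u j) (c j))" by (elim rangeE)
      then show "scale a v \<in> range (\<lambda>u. \<Sum>j\<in>UNIV. scale (u j) (c j))"
        by (intro range_eqI[of _ _ "\<lambda>j. a * u j"]) (simp add: scale_sum_right)
    qed
  qed
  show "range (\<lambda>u. \<Sum>j\<in>UNIV. scale (u j) (c j)) \<subseteq> span (range c)"
    by (intro image_subsetI span_sum span_scale span_base rangeI)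
qed

end

lemma mult_axis_eq_column: "A *v axis j 1 = column j A" for A :: "'k::field^'r^'n"
  by (simp add: matrix_vector_mult_def axis_def column_def vec_eq_iff if_distrib[of "(*) _"] cong: if_cong)

lemma matrix_eqI_mult_axis:
  fixes A B :: "'k::field^'r^'n"
  assumes "\<And>j. A *v axis j 1 = B *v axis j 1"
  shows "A = B"
proof -
  have "column j A = column j B" for j
    using assms[of j] by (simp add: mult_axis_eq_column)
  then show ?thesis by (simp add: vec_eq_iff column_def)
qed

locale grassmannian =
  fixes x :: "'n::{finite,linorder} \<Rightarrow> ('e::ab_group_add \<Rightarrow>\<^sub>0 'k::field)"
  assumes inj_x: "inj x" and indep_x: "\<not> module.dependent (kscale (*)) (range x)"
begin

sublocale kE: vector_space "kscale (*) :: 'k \<Rightarrow> ('e \<Rightarrow>\<^sub>0 'k) \<Rightarrow> _"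
  by (rule vector_space_kscale[OF module_mult])

text \<open>Coordinates with respect to \<open>x\<close>: an isomorphism of column vectors onto the
  span of \<open>x\<close>, through which subspaces of the group algebra are handled as column
  spaces.\<close>

definition lin :: "('k, 'n) vec \<Rightarrow> ('e \<Rightarrow>\<^sub>0 'k)" where
  "lin v = (\<Sum>i\<in>UNIV. kscale (*) (v $ i) (x i))"

lemma lin_add: "lin (v + w) = lin v + lin w"
  by (simp add: lin_def kE.scale_left_distrib sum.distrib)

lemma lin_eq_0_iff: "lin v = 0 \<longleftrightarrow> v = 0"
proof
  assume "lin v = 0"
  then have "v $ i = 0" for i
    unfolding lin_def by (rule kE.independent_range_zero[OF inj_x indep_x])
  then show "v = 0" by (simp add: vec_eq_iff)
qed (simp add: lin_def)

lemma lin_inj: "lin v = lin w \<longleftrightarrow> v = w"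
proof
  assume "lin v = lin w"
  moreover have "lin v = lin (v - w) + lin w" by (simp flip: lin_add)
  ultimately have "lin (v - w) = 0" by simp
  then show "v = w" by (simp add: lin_eq_0_iff)
qed simp

lemma range_lin: "range lin = kE.span (range x)"
proof -
  have "range (\<lambda>u. \<Sum>j\<in>UNIV. kscale (*) (u j) (x j)) = range lin"
  proof (intro subset_antisym image_subsetI)
    fix u
    have "(\<Sum>j\<in>UNIV. kscale (*) (u j) (x j)) = lin (\<chi> j. u j)" by (simp add: lin_def)
    then show "(\<Sum>j\<in>UNIV. kscale (*) (u j) (x j)) \<in> range lin" by simp
  qed (auto simp: lin_def)
  then show ?thesis by (simp add: kE.span_range_sum)
qed

lemma lin_mult: "lin (A *v w) = (\<Sum>j\<in>UNIV. kscale (*) (w $ j) (\<Sum>i\<in>UNIV. kscale (*) (A $ i $ j) (x i)))"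
proof -
  have "lin (A *v w) = (\<Sum>i\<in>UNIV. \<Sum>j\<in>UNIV. kscale (*) (w $ j * A $ i $ j) (x i))"
    by (simp add: lin_def matrix_vector_mult_def kE.scale_sum_left mult.commute)
  then show ?thesis
    by (subst (asm) sum.swap) (simp add: kE.scale_sum_right)
qed

lemma column_span_eq: "column_span x A = range (\<lambda>w. lin (A *v w))"
proof -
  have "range (\<lambda>u. \<Sum>j\<in>UNIV. kscale (*) (u j) (\<Sum>i\<in>UNIV. kscale (*) (A $ i $ j) (x i))) =
      range (\<lambda>w. lin (A *v w))"
  proof (intro subset_antisym image_subsetI)
    fix u
    have "(\<Sum>j\<in>UNIV. kscale (*) (u j) (\<Sum>i\<in>UNIV. kscale (*) (A $ i $ j) (x i))) = lin (A *v (\<chi> j. u j))"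
      by (simp add: lin_mult)
    then show "(\<Sum>j\<in>UNIV. kscale (*) (u j) (\<Sum>i\<in>UNIV. kscale (*) (A $ i $ j) (x i)))
      \<in> range (\<lambda>w. lin (A *v w))" by simp
  qed (auto simp: lin_mult)
  then show ?thesis by (simp add: column_span_def kE.span_range_sum)
qed

text \<open>Each column of \<open>B\<close> is \<open>A\<close> applied to some vector, and these
  vectors are the columns of \<open>g\<close>.\<close>

lemma column_span_subsetD:
  assumes "column_span x B \<subseteq> column_span x A"
  shows "\<exists>g. B = A ** g"
proof -
  have "\<exists>w. B *v axis j 1 = A *v w" for j
  proof -
    have "lin (B *v axis j 1) \<in> column_span x A" using assms unfolding column_span_eq by blast
    then show ?thesis by (auto simp: column_span_eq lin_inj)
  qed
  then have "\<forall>j. \<exists>w. B *v axis j 1 = A *v w" by blast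
  from choice[OF this] obtain w where w: "\<forall>j. B *v axis j 1 = A *v w j" by blast
  let ?g = "\<chi> i j. w j $ i"
  have "column j ?g = w j" for j by (simp add: column_def vec_eq_iff)
  then have "B *v axis j 1 = (A ** ?g) *v axis j 1" for j
    using w by (simp add: mult_axis_eq_column[of ?g] flip: matrix_vector_mul_assoc)
  then have "B = A ** ?g" by (rule matrix_eqI_mult_axis)
  then show ?thesis by blast
qed

lemma column_span_mult_subset: "column_span x (A ** g) \<subseteq> column_span x A"
  unfolding column_span_eq by (auto simp flip: matrix_vector_mul_assoc)

lemma column_span_mult:
  fixes g :: "'k^'r^'r"
  assumes "invertible g"
  shows "column_span x (A ** g) = column_span x A"
proof -
  have "A = (A ** g) ** matrix_inv g"
    by (simp add: matrix_inv_right[OF assms] flip: matrix_mul_assoc)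
  then show ?thesis
    using column_span_mult_subset[of A g] column_span_mult_subset[of "A ** g" "matrix_inv g"] by simp
qed

text \<open>The fibres of \<open>column_span\<close> on matrices of full rank are single orbits of
  the general linear group: in \<open>A = A ** (g ** h)\<close> a left inverse cancels
  \<open>A\<close>, so \<open>g\<close> is invertible.\<close>

lemma column_span_eqD:
  fixes A B :: "('k, 'n, 'r::finite) mat"
  assumes eq: "column_span x A = column_span x B" and A: "A \<in> full_rank"
  shows "\<exists>g. invertible g \<and> B = A ** g"
proof -
  obtain g where g: "B = A ** g" using column_span_subsetD[of B A] eq by blast
  obtain h where h: "A = B ** h" using column_span_subsetD[of A B] eq by blast
  obtain L where L: "L ** A = mat 1" using A full_rank_iff_left_invertible by blast
  have "A = A ** (g ** h)" using g h by (simp add: matrix_mul_assoc)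
  then have "L ** A = L ** (A ** (g ** h))" by simp
  then have "mat 1 = g ** h" by (simp only: L matrix_mul_assoc matrix_mul_lid)
  then have "invertible g" using invertible_right_inverse[of g] by metis
  with g show ?thesis by blast
qed

lemma column_span_subspaces_of_dim:
  fixes A :: "('k, 'n, 'r::finite) mat"
  assumes "A \<in> full_rank"
  shows "column_span x A \<in> subspaces_of_dim (kE.span (range x)) CARD('r)"
proof -
  let ?c = "\<lambda>j. \<Sum>i\<in>UNIV. kscale (*) (A $ i $ j) (x i)"
  have ker: "\<forall>w. A *v w = 0 \<longrightarrow> w = 0"
    using assms unfolding full_rank_iff_left_invertible matrix_left_invertible_ker .
  have "\<forall>j. u j = 0" if "(\<Sum>j\<in>UNIV. kscale (*) (u j) (?c j)) = 0" for u
  proof -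
    have "lin (A *v (\<chi> j. u j)) = 0" using that by (simp add: lin_mult)
    then have "(\<chi> j. u j) = 0" using ker by (simp add: lin_eq_0_iff)
    then show ?thesis by (simp add: vec_eq_iff)
  qed
  note c = kE.independent_rangeI[OF this]
  have "kE.dim (column_span x A) = card (range ?c)"
    unfolding column_span_def by (rule kE.dim_span_eq_card_independent[OF c(2)])
  also have "\<dots> = CARD('r)" using card_image[OF c(1)] by simp
  finally have "kE.dim (column_span x A) = CARD('r)" .
  moreover have "kE.subspace (column_span x A)" by (simp add: column_span_def)
  moreover have "column_span x A \<subseteq> kE.span (range x)"
    unfolding range_lin[symmetric] column_span_eq by blast
  ultimately show ?thesis by (simp add: subspaces_of_dim_def)
qed

lemma ex_column_span:
  assumes "U \<in> subspaces_of_dim (kE.span (range x)) CARD('r::finite)"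
  shows "\<exists>A::('k, 'n, 'r) mat. A \<in> full_rank \<and> column_span x A = U"
proof -
  have U: "kE.subspace U" "U \<subseteq> kE.span (range x)" "kE.dim U = CARD('r)"
    using assms by (auto simp: subspaces_of_dim_def)
  obtain B where B: "B \<subseteq> U" "kE.independent B" "U \<subseteq> kE.span B" "card B = kE.dim U"
    by (rule kE.basis_exists)
  have card_B: "card B = CARD('r)" using B(4) U(3) by simp
  then have "finite B" by (metis card_eq_0_iff finite_UNIV_card_ge_0 finite less_not_refl)
  then obtain e :: "'r \<Rightarrow> _" where e: "bij_betw e UNIV B"
    using finite_same_card_bij[of "UNIV :: 'r set" B] card_B by auto
  then have range_e: "range e = B" and inj_e: "inj e" by (auto simp: bij_betw_def)
  have "\<exists>a. lin a = e j" for j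
  proof -
    have "e j \<in> range lin" using range_e B(1) U(2) unfolding range_lin by blast
    then show ?thesis by (metis rangeE)
  qed
  then have "\<forall>j. \<exists>a. lin a = e j" by blast
  from choice[OF this] obtain a where a: "\<forall>j. lin (a j) = e j" by blast
  define A :: "('k, 'n, 'r) mat" where "A = (\<chi> i j. a j $ i)"
  have col: "(\<Sum>i\<in>UNIV. kscale (*) (A $ i $ j) (x i)) = e j" for j
    using a by (simp add: A_def lin_def)
  have "column_span x A = kE.span B" by (simp add: column_span_def col range_e)
  also have "\<dots> = U" using B(1,3) U(1) by (simp add: kE.span_subspace)
  finally have "column_span x A = U" .
  moreover have "w = 0" if "A *v w = 0" for w
  proof -
    have "(\<Sum>j\<in>UNIV. kscale (*) (w $ j) (e j)) = 0"
      using lin_mult[of A w] that by (simp add: col iffD2[OF lin_eq_0_iff refl])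
    then have "w $ j = 0" for j
      by (rule kE.independent_range_zero[OF inj_e, unfolded range_e, OF B(2)])
    then show ?thesis by (simp add: vec_eq_iff)
  qed
  then have "A \<in> full_rank"
    unfolding full_rank_iff_left_invertible matrix_left_invertible_ker by blast
  ultimately show ?thesis by blast
qed

lemma representatives_iff: "A \<in> representatives x W \<longleftrightarrow> A \<in> full_rank \<and> column_span x A \<in> W"
  by (simp add: representatives_def)

text \<open>Changing the representative multiplies the submatrix on the right by an invertible
  matrix, so the minor can be tested on any representative of full rank.\<close>

lemma column_span_in_chart_iff:
  fixes A :: "('k, 'n, 'r::finite) mat"
  assumes "A \<in> full_rank"
  shows "column_span x A \<in> chart x \<sigma> \<longleftrightarrow> minor \<sigma> A \<noteq> 0"
proof
  assume "column_span x A \<in> chart x \<sigma>"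
  then obtain B :: "('k, 'n, 'r) mat" where B: "column_span x A = column_span x B" "B \<in> full_rank" "minor \<sigma> B \<noteq> 0"
    by (auto simp: chart_def minor_neq_0_iff)
  then obtain g where g: "invertible g" "A = B ** g" using column_span_eqD[of B A] by metis
  then show "minor \<sigma> A \<noteq> 0"
    using B(3) invertible_mult[of "submat \<sigma> B" g] by (simp add: minor_neq_0_iff submat_mult)
qed (use assms in \<open>auto simp: chart_def minor_neq_0_iff\<close>)

lemma col_reduce_full_rank: "minor \<sigma> A \<noteq> 0 \<Longrightarrow> col_reduce \<sigma> A \<in> full_rank"
  by (rule minor_full_rank[of \<sigma>]) (simp add: minor_col_reduce)

lemma column_span_col_reduce: "minor \<sigma> A \<noteq> 0 \<Longrightarrow> column_span x (col_reduce \<sigma> A) = column_span x A"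
  unfolding col_reduce_def
  by (rule column_span_mult) (simp add: invertible_matrix_inv minor_neq_0_iff)

text \<open>A normalised representative has the form \<open>A ** g\<close>, and normalisation reads
  \<open>submat \<sigma> A ** g = mat 1\<close>, which determines \<open>g\<close>.\<close>

lemma chart_matrix_column_span:
  fixes A :: "('k, 'n, 'r::finite) mat"
  assumes A: "minor \<sigma> A \<noteq> 0"
  shows "chart_matrix x \<sigma> (column_span x A) = col_reduce \<sigma> A"
  unfolding chart_matrix_def
proof (rule the_equality, intro conjI)
  show "col_reduce \<sigma> A \<in> full_rank" by (rule col_reduce_full_rank[OF A])
  show "column_span x (col_reduce \<sigma> A) = column_span x A" by (rule column_span_col_reduce[OF A])
  show "submat \<sigma> (col_reduce \<sigma> A) = mat 1" by (rule submat_col_reduce[OF A])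
next
  fix B :: "('k, 'n, 'r) mat" assume B: "B \<in> full_rank \<and> column_span x B = column_span x A \<and> submat \<sigma> B = mat 1"
  then obtain g where g: "invertible g" "B = A ** g"
    using column_span_eqD[of A B] minor_full_rank[OF A] by metis
  then have "submat \<sigma> A ** g = mat 1" using B by (simp add: submat_mult)
  then have "matrix_inv (submat \<sigma> A) = g" by (rule matrix_inv_unique)
  then show "B = col_reduce \<sigma> A" by (simp add: col_reduce_def g(2))
qed

lemma chart_matrix:
  fixes \<sigma> :: "'r::finite \<Rightarrow> 'n"
  assumes "U \<in> chart x \<sigma>"
  shows "column_span x (chart_matrix x \<sigma> U) = U" "submat \<sigma> (chart_matrix x \<sigma> U) = mat 1"
    "minor \<sigma> (chart_matrix x \<sigma> U) = 1" "chart_matrix x \<sigma> U \<in> full_rank"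
    "col_reduce \<sigma> (chart_matrix x \<sigma> U) = chart_matrix x \<sigma> U"
proof -
  obtain A :: "('k, 'n, 'r) mat" where A: "U = column_span x A" "minor \<sigma> A \<noteq> 0"
    using assms by (auto simp: chart_def minor_neq_0_iff)
  then have C: "chart_matrix x \<sigma> U = col_reduce \<sigma> A" by (simp add: chart_matrix_column_span)
  show U: "column_span x (chart_matrix x \<sigma> U) = U" unfolding C using A by (simp add: column_span_col_reduce)
  show "submat \<sigma> (chart_matrix x \<sigma> U) = mat 1" unfolding C using A by (simp add: submat_col_reduce)
  show m: "minor \<sigma> (chart_matrix x \<sigma> U) = 1" unfolding C using A by (simp add: minor_col_reduce)
  then show "chart_matrix x \<sigma> U \<in> full_rank" by (intro minor_full_rank[of \<sigma>]) (simp add: m)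
  show "col_reduce \<sigma> (chart_matrix x \<sigma> U) = chart_matrix x \<sigma> U"
    using chart_matrix_column_span[of \<sigma> "chart_matrix x \<sigma> U"] m U by simp
qed

end

section \<open>The sheaf of functions on the Grassmannian\<close>

text \<open>The parameter \<open>r\<close> makes the type \<open>'r\<close> visible in the abbreviations below. As equality of all
  elements of \<open>'r itself\<close> is not provable, it is assumed to be \<open>TYPE('r)\<close>.\<close>

locale grassmannian_module = grassmannian x + M: module act
  for x :: "'n::{finite,linorder} \<Rightarrow> ('e::ab_group_add \<Rightarrow>\<^sub>0 'k::field)"
    and act :: "('e \<Rightarrow>\<^sub>0 'k) \<Rightarrow> 'm::ab_group_add \<Rightarrow> 'm" +
  fixes r :: "'r::{finite,linorder} itself"
  assumes r_eq: "r = TYPE('r)"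
begin

abbreviation sc :: "'k \<Rightarrow> 'm \<Rightarrow> 'm" where
  "sc \<equiv> kscale act"

abbreviation Mats :: "(('k, 'n, 'r) mat, 'k) function_space" where
  "Mats \<equiv> Mo"

abbreviation Gr :: "(('e \<Rightarrow>\<^sub>0 'k) set, 'k) function_space" where
  "Gr \<equiv> Grass r x"

abbreviation \<pi> :: "('k, 'n, 'r) mat \<Rightarrow> ('e \<Rightarrow>\<^sub>0 'k) set" where
  "\<pi> \<equiv> column_span x"

abbreviation reps :: "('e \<Rightarrow>\<^sub>0 'k) set set \<Rightarrow> ('k, 'n, 'r) mat set" where
  "reps \<equiv> representatives x"

abbreviation crt :: "('r \<Rightarrow> 'n) \<Rightarrow> ('e \<Rightarrow>\<^sub>0 'k) set set" where
  "crt \<equiv> chart x"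

abbreviation cm :: "('r \<Rightarrow> 'n) \<Rightarrow> ('e \<Rightarrow>\<^sub>0 'k) set \<Rightarrow> ('k, 'n, 'r) mat" where
  "cm \<equiv> chart_matrix x"

sublocale Mk: vector_space sc
  by (rule vector_space_kscale) (rule M.module_axioms)

sublocale Y: function_sheaf sc Mats
  by (rule function_sheaf_Mo) (rule Mk.vector_space_axioms)

lemma openin_Gr_iff:
  "openin (opens Gr) W \<longleftrightarrow>
     W \<subseteq> subspaces_of_dim (kE.span (range x)) CARD('r) \<and> openin zariski (reps W)"
proof -
  have "reps W \<subseteq> full_rank" by (auto simp: representatives_iff)
  then show ?thesis by (simp add: r_eq Grass_def openin_grass openin_Mo_iff)
qed

lemma openin_reps: "openin (opens Gr) W \<Longrightarrow> openin (opens Mats) (reps W)"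
  unfolding openin_Gr_iff openin_Mo_iff by (auto simp: representatives_iff)

lemma reg_Gr_iff:
  "f \<in> reg_funs Gr W \<longleftrightarrow> (\<forall>U. U \<notin> W \<longrightarrow> f U = 0) \<and>
     restrict_section (\<lambda>A. f (\<pi> A)) (reps W) \<in> regular_functions (reps W)"
  by (simp add: Grass_def grass_functions_def Mo_def)

sublocale G: function_sheaf sc Gr
proof
  show "a p = 0" if "a \<in> reg_funs Gr W" "p \<notin> W" for a W p
    using that by (simp add: reg_Gr_iff)
next
  fix W and c :: 'k assume W: "openin (opens Gr) W"
  have "restrict_section (\<lambda>A. if \<pi> A \<in> W then c else 0) (reps W) = restrict_section (\<lambda>_. c) (reps W)"
    by (rule restrict_section_cong) (auto simp: representatives_iff)
  then show "(\<lambda>p. if p \<in> W then c else 0) \<in> reg_funs Gr W"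
    using regular_poly[of "reps W" "\<lambda>_. c"] W by (simp add: reg_Gr_iff openin_Gr_iff matrix_polys.const)
next
  fix W a b assume "a \<in> reg_funs Gr W" "b \<in> reg_funs Gr W"
  then have a: "\<forall>U. U \<notin> W \<longrightarrow> a U = 0" "restrict_section (\<lambda>A. a (\<pi> A)) (reps W) \<in> regular_functions (reps W)"
    and b: "\<forall>U. U \<notin> W \<longrightarrow> b U = 0" "restrict_section (\<lambda>A. b (\<pi> A)) (reps W) \<in> regular_functions (reps W)"
    by (simp_all add: reg_Gr_iff)
  have "restrict_section (\<lambda>A. a (\<pi> A) + b (\<pi> A)) (reps W) =
      (\<lambda>A. restrict_section (\<lambda>A. a (\<pi> A)) (reps W) A + restrict_section (\<lambda>A. b (\<pi> A)) (reps W) A)"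
    by (simp add: restrict_section_def fun_eq_iff)
  then show "(\<lambda>p. a p + b p) \<in> reg_funs Gr W"
    using a b regular_add_mult(1)[OF a(2) b(2)] by (simp add: reg_Gr_iff)
  have "restrict_section (\<lambda>A. a (\<pi> A) * b (\<pi> A)) (reps W) =
      (\<lambda>A. restrict_section (\<lambda>A. a (\<pi> A)) (reps W) A * restrict_section (\<lambda>A. b (\<pi> A)) (reps W) A)"
    by (simp add: restrict_section_def fun_eq_iff)
  then show "(\<lambda>p. a p * b p) \<in> reg_funs Gr W"
    using a b regular_add_mult(2)[OF a(2) b(2)] by (simp add: reg_Gr_iff)
next
  fix W W' a
  assume W: "openin (opens Gr) W" "openin (opens Gr) W'" "W' \<subseteq> W" and "a \<in> reg_funs Gr W"
  then have a: "restrict_section (\<lambda>A. a (\<pi> A)) (reps W) \<in> regular_functions (reps W)"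
    by (simp add: reg_Gr_iff)
  have sub: "reps W' \<subseteq> reps W" using W(3) by (auto simp: representatives_iff)
  have "restrict_section (\<lambda>A. restrict_section a W' (\<pi> A)) (reps W') =
      restrict_section (restrict_section (\<lambda>A. a (\<pi> A)) (reps W)) (reps W')"
    using sub by (auto simp: restrict_section_def fun_eq_iff representatives_iff)
  moreover have "openin zariski (reps W')" using W(2) by (simp add: openin_Gr_iff)
  ultimately show "restrict_section a W' \<in> reg_funs Gr W'"
    using regular_restrict[OF a _ sub] by (simp add: reg_Gr_iff)
qed

section \<open>Transport of functions and sections between matrices and the Grassmannian\<close>

lemma free_pullback:
  assumes "s \<in> free_sheaf sc Gr W"
  shows "restrict_section (\<lambda>A. s (\<pi> A)) (reps W) \<in> free_sheaf sc Mats (reps W)"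
proof (rule Y.free_sheafI)
  show "openin (opens Mats) (reps W)" by (rule openin_reps[OF G.free_sheafD(1)[OF assms]])
  have "(\<lambda>A. sc (if A \<in> reps W then 1 else 0) (s (\<pi> A))) \<in> tensor_functions sc (reg_funs Mats (reps W))"
    by (rule Mk.tensor_functions_map[OF G.free_sheafD(2)[OF assms],
          where \<phi> = "\<lambda>f. restrict_section (\<lambda>A. f (\<pi> A)) (reps W)"])
      (simp_all add: reg_Gr_iff restrict_section_def Mo_def)
  also have "(\<lambda>A. sc (if A \<in> reps W then 1 else 0) (s (\<pi> A))) = restrict_section (\<lambda>A. s (\<pi> A)) (reps W)"
    by (auto simp: restrict_section_def fun_eq_iff)
  finally show "restrict_section (\<lambda>A. s (\<pi> A)) (reps W) \<in> tensor_functions sc (reg_funs Mats (reps W))" .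
qed

text \<open>Preimage of a set of matrices under the chart section. Its representatives are the
  matrices whose column reduction lies in the set, which is how openness and regularity get tested
  on \<open>Mo\<close>.\<close>

definition cpull :: "('r \<Rightarrow> 'n) \<Rightarrow> ('k, 'n, 'r) mat set \<Rightarrow> ('e \<Rightarrow>\<^sub>0 'k) set set" where
  "cpull \<sigma> W = {U \<in> crt \<sigma>. cm \<sigma> U \<in> W}"

lemma cpull_UNIV: "cpull \<sigma> UNIV = crt \<sigma>"
  by (simp add: cpull_def)

lemma column_span_in_chart: "minor \<sigma> A \<noteq> 0 \<Longrightarrow> \<pi> A \<in> crt \<sigma>"
  by (simp add: column_span_in_chart_iff minor_full_rank[of \<sigma>])

lemma reps_chart: "reps (crt \<sigma>) = {A. minor \<sigma> A \<noteq> 0}"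
proof -
  have "A \<in> reps (crt \<sigma>) \<longleftrightarrow> minor \<sigma> A \<noteq> 0" for A
    using minor_full_rank[of \<sigma> A] column_span_in_chart_iff[of A \<sigma>] by (auto simp: representatives_iff)
  then show ?thesis by blast
qed

lemma reps_cpull: "reps (cpull \<sigma> W) = {A. minor \<sigma> A \<noteq> 0 \<and> col_reduce \<sigma> A \<in> W}"
proof -
  have "A \<in> reps (cpull \<sigma> W) \<longleftrightarrow> minor \<sigma> A \<noteq> 0 \<and> col_reduce \<sigma> A \<in> W" for A
    using minor_full_rank[of \<sigma> A] chart_matrix_column_span[of \<sigma> A] column_span_in_chart_iff[of A \<sigma>]
    by (auto simp: representatives_iff cpull_def)
  then show ?thesis by blast
qed

lemma chart_subset: "crt \<sigma> \<subseteq> subspaces_of_dim (kE.span (range x)) CARD('r)"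
  unfolding chart_def using column_span_subspaces_of_dim by blast

lemma openin_cpull: "openin zariski W \<Longrightarrow> openin (opens Gr) (cpull \<sigma> W)"
  unfolding openin_Gr_iff reps_cpull using chart_subset[of \<sigma>]
  by (auto simp: openin_col_reduce_vimage cpull_def)

lemma openin_zariski_UNIV: "openin zariski (UNIV :: ('k, 'n, 'r) mat set)"
  by (auto simp: openin_zariski_iff intro!: bexI[of _ "\<lambda>_. 1"] matrix_polys.const)

lemma openin_chart: "openin (opens Gr) (crt \<sigma>)"
  using openin_cpull[OF openin_zariski_UNIV, of \<sigma>] by (simp add: cpull_UNIV)

lemma topspace_Gr: "U \<in> topspace (opens Gr) \<Longrightarrow> \<exists>\<sigma>. strict_mono \<sigma> \<and> U \<in> crt \<sigma>"
proof -
  assume "U \<in> topspace (opens Gr)"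
  then have "U \<in> subspaces_of_dim (kE.span (range x)) CARD('r)"
    using openin_topspace[of "opens Gr"] unfolding openin_Gr_iff by blast
  then obtain A :: "('k, 'n, 'r) mat" where A: "A \<in> full_rank" "\<pi> A = U" using ex_column_span by blast
  then obtain \<sigma> where "strict_mono \<sigma>" "minor \<sigma> A \<noteq> 0" using full_rank_ex_minor by blast
  then show ?thesis using column_span_in_chart_iff[OF A(1), of \<sigma>] A(2) by blast
qed

text \<open>Regularity on the Grassmannian is tested after composing with \<open>\<pi>\<close>;
  there \<open>cm \<sigma>\<close> becomes \<open>col_reduce \<sigma>\<close>, whose denominators
  are powers of the minor.\<close>

lemma reg_cpull:
  assumes "a \<in> regular_functions W"
  shows "restrict_section (\<lambda>U. a (cm \<sigma> U)) (cpull \<sigma> W) \<in> reg_funs Gr (cpull \<sigma> W)"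
proof -
  have "restrict_section (\<lambda>A. restrict_section (\<lambda>U. a (cm \<sigma> U)) (cpull \<sigma> W) (\<pi> A)) (reps (cpull \<sigma> W)) =
    restrict_section (\<lambda>A. a (col_reduce \<sigma> A)) {A. minor \<sigma> A \<noteq> 0 \<and> col_reduce \<sigma> A \<in> W}"
    unfolding reps_cpull
    by (rule restrict_section_cong)
      (auto simp: cpull_def column_span_in_chart chart_matrix_column_span)
  then show ?thesis using regular_col_reduce[OF assms, of \<sigma>] by (simp add: reg_Gr_iff reps_cpull)
qed

lemma free_cpull:
  assumes "openin zariski W" "s \<in> tensor_functions sc (regular_functions W)"
  shows "restrict_section (\<lambda>U. s (cm \<sigma> U)) (cpull \<sigma> W) \<in> free_sheaf sc Gr (cpull \<sigma> W)"
proof (rule G.free_sheafI)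
  show "openin (opens Gr) (cpull \<sigma> W)" by (rule openin_cpull[OF assms(1)])
  have "(\<lambda>U. sc (if U \<in> cpull \<sigma> W then 1 else 0) (s (cm \<sigma> U))) \<in> tensor_functions sc (reg_funs Gr (cpull \<sigma> W))"
    by (rule Mk.tensor_functions_map[OF assms(2),
          where \<phi> = "\<lambda>f. restrict_section (\<lambda>U. f (cm \<sigma> U)) (cpull \<sigma> W)", OF reg_cpull])
      (simp_all add: restrict_section_def)
  also have "(\<lambda>U. sc (if U \<in> cpull \<sigma> W then 1 else 0) (s (cm \<sigma> U))) =
      restrict_section (\<lambda>U. s (cm \<sigma> U)) (cpull \<sigma> W)"
    by (auto simp: restrict_section_def fun_eq_iff)
  finally show "restrict_section (\<lambda>U. s (cm \<sigma> U)) (cpull \<sigma> W) \<in> tensor_functions sc (reg_funs Gr (cpull \<sigma> W))" .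
qed

lemma regular_UNIV: "f \<in> matrix_polys \<Longrightarrow> f \<in> regular_functions (UNIV :: ('k, 'n, 'r) mat set)"
  using regular_poly[OF openin_zariski_UNIV, of f] by (simp add: restrict_section_def)

lemma tensor_functions_mono: "A \<subseteq> B \<Longrightarrow> tensor_functions sc A \<subseteq> tensor_functions sc B"
  unfolding tensor_functions_def by blast

lemma free_chart:
  assumes "t \<in> tensor_functions sc matrix_polys"
  shows "restrict_section (\<lambda>U. t (cm \<sigma> U)) (crt \<sigma>) \<in> free_sheaf sc Gr (crt \<sigma>)"
  using free_cpull[OF openin_zariski_UNIV, of t \<sigma>] assms tensor_functions_mono[of matrix_polys "regular_functions UNIV"]
    regular_UNIV unfolding cpull_UNIV by blast

lemma comb_cpull:
  assumes "openin (opens Mats) W" "s \<in> Y.comb W S"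
  shows "(\<lambda>U. s (cm \<sigma> U)) \<in> G.comb (cpull \<sigma> W) ((\<lambda>t U. t (cm \<sigma> U)) ` S)"
proof -
  obtain N a t where *: "\<forall>i<(N::nat). a i \<in> reg_funs Mats W \<and> t i \<in> S"
    "\<forall>q\<in>W. s q = (\<Sum>i<N. sc (a i q) (t i q))"
    using assms(2) unfolding Y.comb_def by blast
  show ?thesis
  proof (rule G.combI[of N "\<lambda>i. restrict_section (\<lambda>U. a i (cm \<sigma> U)) (cpull \<sigma> W)" _ "\<lambda>i U. t i (cm \<sigma> U)"])
    show "restrict_section (\<lambda>U. a i (cm \<sigma> U)) (cpull \<sigma> W) \<in> reg_funs Gr (cpull \<sigma> W)" if "i < N" for i
      using *(1) that by (intro reg_cpull) (simp add: Mo_def)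
    show "(\<lambda>U. t i (cm \<sigma> U)) \<in> (\<lambda>t U. t (cm \<sigma> U)) ` S" if "i < N" for i
      using *(1) that by blast
    show "s (cm \<sigma> q) = (\<Sum>i<N. sc (restrict_section (\<lambda>U. a i (cm \<sigma> U)) (cpull \<sigma> W) q) (t i (cm \<sigma> q)))"
      if "q \<in> cpull \<sigma> W" for q
      using *(2) that by (simp add: cpull_def)
  qed
qed

end

section \<open>Noetherianity and linear functionals\<close>

locale vector_functions = vector_space scale
  for scale :: "'a::field \<Rightarrow> 'b::ab_group_add \<Rightarrow> 'b"
begin

text \<open>Vector-valued functions form a module over the ring of all scalar functions. Polynomial
  functions enter later through the set of operators.\<close>

definition fscale :: "('p \<Rightarrow> 'a) \<Rightarrow> ('p \<Rightarrow> 'b) \<Rightarrow> 'p \<Rightarrow> 'b" where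
  "fscale f s = (\<lambda>p. scale (f p) (s p))"

lemma fscale_apply: "fscale f s p = scale (f p) (s p)"
  by (simp add: fscale_def)

lemma operator_module_fscale: "operator_module (fscale :: ('p \<Rightarrow> 'a) \<Rightarrow> ('p \<Rightarrow> 'b) \<Rightarrow> 'p \<Rightarrow> 'b)"
  by (intro operator_module.intro module.intro)
    (simp_all add: fun_eq_iff fscale_apply scale_right_distrib scale_left_distrib)

interpretation F: operator_module "fscale :: ('p \<Rightarrow> 'a) \<Rightarrow> ('p \<Rightarrow> 'b) \<Rightarrow> 'p \<Rightarrow> 'b"
  by (rule operator_module_fscale)

text \<open>Base case of the basis theorem: a stable set of constant functions is a subspace of a
  finite dimensional space and is generated by a basis.\<close>

lemma noetherian_constants:
  assumes "finite B" "span B = UNIV"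
  shows "F.noetherian (range (\<lambda>c (p::'p). c)) (range (\<lambda>m (p::'p). m))"
  unfolding F.noetherian_def
proof (intro conjI allI impI)
  show "F.stable (range (\<lambda>c (p::'p). c)) (range (\<lambda>m (p::'p). m))"
    by (rule F.stableI) (auto simp: fscale_def plus_fun_def zero_fun_def)
  fix L :: "('p \<Rightarrow> 'b) set" assume sub: "L \<subseteq> range (\<lambda>m p. m)" and L: "F.stable (range (\<lambda>c p. c)) L"
  define L0 where "L0 = {m. (\<lambda>p::'p. m) \<in> L}"
  obtain C where C: "C \<subseteq> L0" "independent C" "L0 \<subseteq> span C"
    using basis_exists[of L0] by metis
  have "finite C" using independent_span_bound[OF assms(1) C(2)] assms(2) by simp
  define S where "S = (\<lambda>m (p::'p). m) ` C"
  define H where "H = F.stable_hull (range (\<lambda>c (p::'p). c)) S"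
  have H: "F.stable (range (\<lambda>c (p::'p). c)) H" by (simp add: H_def F.stable_stable_hull)
  have "(\<lambda>p. m) \<in> H" if "m \<in> span C" for m
    using that
  proof (induction rule: span_induct_alt)
    case base
    show ?case using F.stableD(1)[OF H] by (simp add: zero_fun_def)
  next
    case (step c m n)
    have "(\<lambda>p. m) \<in> S" using step(1) by (simp add: S_def)
    then have "(\<lambda>p. m) \<in> H" unfolding H_def using F.stable_hull_superset by blast
    then have "fscale (\<lambda>p. c) (\<lambda>p. m) \<in> H" by (rule F.stableD(3)[OF H, rotated]) simp
    from F.stableD(2)[OF H this step(2)] show ?case by (simp add: fscale_def plus_fun_def)
  qed
  then have "L \<subseteq> H" using sub C(3) by (auto simp: L0_def)
  moreover have "S \<subseteq> L" using C(1) by (auto simp: S_def L0_def)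
  moreover have "finite S" using \<open>finite C\<close> by (simp add: S_def)
  ultimately show "\<exists>S\<subseteq>L. finite S \<and> L \<subseteq> F.stable_hull (range (\<lambda>c p. c)) S"
    unfolding H_def by blast
qed

text \<open>Each coordinate is adjoined by one application of \<open>noetherian_poly_module\<close>.
  The module is left existential; it is an iterated \<open>poly_module\<close> over the constant
  functions.\<close>

lemma noetherian_coordinates:
  fixes Y :: "('n::finite \<times> 'r::finite) set"
  assumes "finite B" "span B = UNIV" "finite Y"
  shows "\<exists>N. F.noetherian (range (\<lambda>c p. c) \<union> (\<lambda>(i, j) (A :: ('a, 'n, 'r) mat). A $ i $ j) ` Y) N \<and> range (\<lambda>m p. m) \<subseteq> N"
  using assms(3)
proof (induction Y)
  case empty
  show ?case
    by (intro exI[of _ "range (\<lambda>m p. m)"]) (simp add: noetherian_constants[OF assms(1,2)])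
next
  case (insert y Y)
  let ?A = "range (\<lambda>c p. c) \<union> (\<lambda>(i, j) (A :: ('a, 'n, 'r) mat). A $ i $ j) ` Y"
  let ?y = "case y of (i, j) \<Rightarrow> \<lambda>A :: ('a, 'n, 'r) mat. A $ i $ j"
  obtain N where N: "F.noetherian ?A N" "range (\<lambda>m p. m) \<subseteq> N" using insert.IH by blast
  have "(\<lambda>p. -1) \<in> ?A" by blast
  moreover have "(-1 :: ('a, 'n, 'r) mat \<Rightarrow> 'a) = (\<lambda>p. -1)"
    by (simp add: fun_eq_iff fun_Compl_def one_fun_def)
  ultimately have "-1 \<in> ?A" by metis
  from F.noetherian_poly_module[OF N(1) this, of ?y]
  have noeth: "F.noetherian (insert ?y ?A) (F.poly_module ?y N)" .
  have sub: "N \<subseteq> F.poly_module ?y N"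
  proof
    fix s assume s: "s \<in> N"
    have eq: "s = F.poly_eval ?y 1 (\<lambda>_. s)" by (simp add: F.poly_eval_def)
    show "s \<in> F.poly_module ?y N"
      unfolding F.poly_module_def mem_Collect_eq
      by (rule ex2I[of _ 1 "\<lambda>_. s"], rule conjI[OF eq]) (simp add: s)
  qed
  have eq: "insert ?y ?A = range (\<lambda>c p. c) \<union> (\<lambda>(i, j) (A :: ('a, 'n, 'r) mat). A $ i $ j) ` insert y Y"
    by auto
  show ?case by (rule exI, rule conjI, rule noeth[unfolded eq], rule order_trans[OF N(2) sub])
qed

text \<open>Closure under constants and coordinates implies closure under all polynomial functions,
  by induction on \<open>matrix_polys\<close>. Hence the noetherian module for these operators
  contains all polynomial tensors, and \<open>L\<close> is one of its stable subsets.\<close>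

theorem noetherian_tensor_polys:
  fixes L :: "(('a, 'n::finite, 'r::finite) mat \<Rightarrow> 'b) set"
  assumes B: "finite B" "span B = UNIV"
    and L: "L \<subseteq> tensor_functions scale matrix_polys" "F.stable matrix_polys L"
  shows "\<exists>S\<subseteq>L. finite S \<and> L \<subseteq> F.stable_hull matrix_polys S"
proof -
  let ?A = "range (\<lambda>c p. c) \<union> (\<lambda>(i, j) (A :: ('a, 'n, 'r) mat). A $ i $ j) ` UNIV"
  obtain N where N: "F.noetherian ?A N" "range (\<lambda>m p. m) \<subseteq> N"
    using noetherian_coordinates[OF B finite[of "UNIV :: ('n \<times> 'r) set"]] by blast
  have st: "F.stable ?A N" using N(1) by (simp add: F.noetherian_def)
  have A: "?A \<subseteq> matrix_polys" by (auto intro: matrix_polys.intros)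
  have mult: "fscale f s \<in> N" if "f \<in> matrix_polys" "s \<in> N" for f s
    using that
  proof (induction arbitrary: s)
    case (add f g)
    have eq: "fscale (\<lambda>A. f A + g A) s = fscale f s + fscale g s" by (simp add: fun_eq_iff fscale_apply scale_left_distrib)
    show ?case unfolding eq by (intro F.stableD(2)[OF st] add.IH add.prems)
  next
    case (mult f g)
    have eq: "fscale (\<lambda>A. f A * g A) s = fscale f (fscale g s)" by (simp add: fun_eq_iff fscale_apply)
    show ?case unfolding eq by (intro mult.IH mult.prems)
  next
    case (coord i j)
    have "(case (i, j) of (i, j) \<Rightarrow> \<lambda>A :: ('a, 'n, 'r) mat. A $ i $ j) \<in> ?A" by blast
    then show ?case using F.stableD(3)[OF st _ coord] by simp
  next
    case (const c)
    show ?case by (rule F.stableD(3)[OF st _ const]) blast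
  qed
  have "tensor_functions scale matrix_polys \<subseteq> N"
  proof
    fix s :: "('a, 'n, 'r) mat \<Rightarrow> 'b" assume "s \<in> tensor_functions scale matrix_polys"
    then obtain K f m where f: "\<forall>i<(K::nat). f i \<in> matrix_polys" and s: "s = (\<lambda>p. \<Sum>i<K. scale (f i p) (m i))"
      unfolding tensor_functions_iff by blast
    have "(\<lambda>p. \<Sum>i<k. scale (f i p) (m i)) \<in> N" if "k \<le> K" for k
      using that
    proof (induction k)
      case 0
      then show ?case using F.stableD(1)[OF st] by (simp add: zero_fun_def)
    next
      case (Suc k)
      have "fscale (f k) (\<lambda>p. m k) \<in> N" using Suc.prems f N(2) by (intro mult) auto
      then have "(\<lambda>p. \<Sum>i<k. scale (f i p) (m i)) + fscale (f k) (\<lambda>p. m k) \<in> N"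
        using Suc by (intro F.stableD(2)[OF st]) auto
      then show ?case by (simp add: fscale_def plus_fun_def)
    qed
    from this[of K] show "s \<in> N" by (simp add: s)
  qed
  then have "L \<subseteq> N" using L(1) by blast
  moreover have "F.stable ?A L"
  proof (rule F.stableI)
    fix a s assume "a \<in> ?A" "s \<in> L"
    then have "a \<in> matrix_polys" using A by blast
    then show "fscale a s \<in> L" using \<open>s \<in> L\<close> by (rule F.stableD(3)[OF L(2)])
  qed (use F.stableD(1,2)[OF L(2)] in auto)
  ultimately obtain S where S: "S \<subseteq> L" "finite S" "L \<subseteq> F.stable_hull ?A S"
    using N(1) unfolding F.noetherian_def by blast
  have "F.stable ?A (F.stable_hull matrix_polys S)"
  proof (rule F.stableI)
    fix a s assume "a \<in> ?A" and s: "s \<in> F.stable_hull matrix_polys S"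
    then have "a \<in> matrix_polys" using A by blast
    then show "fscale a s \<in> F.stable_hull matrix_polys S" using s by (rule F.stable_hullD(3))
  qed (use F.stable_hullD(1,2) in auto)
  from F.stable_hull_least[OF this F.stable_hull_superset]
  have "F.stable_hull ?A S \<subseteq> F.stable_hull matrix_polys S" .
  with S show ?thesis by blast
qed

text \<open>The vector \<open>u\<close> is independent of a basis of \<open>N\<close>, so the
  function that is \<open>1\<close> at \<open>u\<close> and \<open>0\<close> on this basis extends
  linearly.\<close>

lemma ex_functional:
  assumes N: "subspace N" and u: "u \<notin> N"
  shows "\<exists>\<phi>. Vector_Spaces.linear scale (*) \<phi> \<and> (\<forall>v\<in>N. \<phi> v = 0) \<and> \<phi> u = 1"
proof -
  interpret K: vector_space_pair scale "(*) :: 'a \<Rightarrow> 'a \<Rightarrow> 'a"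
    by (intro vector_space_pair.intro vector_space_axioms vector_space_over_itself.vector_space_axioms)
  obtain B where B: "B \<subseteq> N" "independent B" "N \<subseteq> span B" using basis_exists[of N] by metis
  have "span B \<subseteq> N" using B(1) N by (rule span_minimal)
  then have "independent (insert u B)" using u B(2) by (intro independent_insertI) auto
  from K.linear_independent_extend[OF this, of "\<lambda>v. if v = u then 1 else 0"]
  obtain \<phi> where \<phi>: "Vector_Spaces.linear scale (*) \<phi>" "\<forall>v\<in>insert u B. \<phi> v = (if v = u then 1 else 0)"
    by blast
  have "\<phi> v = 0" if "v \<in> N" for v
  proof -
    have "\<phi> b = 0" if "b \<in> B" for b using \<phi>(2) that B(1) u by auto
    moreover have "v \<in> span B" using that B(3) by blast
    ultimately show ?thesis using K.linear_eq_0_on_span[OF \<phi>(1)] by blast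
  qed
  with \<phi> show ?thesis by auto
qed

end

section \<open>Separated expansions\<close>

lemma (in module) scale_sum_list: "scale c (\<Sum>q\<leftarrow>qs. f q) = (\<Sum>q\<leftarrow>qs. scale c (f q))"
  by (induction qs) (simp_all add: scale_right_distrib)

context vector_functions
begin

text \<open>An element of the tensor product of \<open>A\<close> with functions of \<open>p\<close>,
  given by a list so that its length can serve as induction measure.\<close>

definition separated :: "('g \<Rightarrow> 'a) set \<Rightarrow> ('p \<Rightarrow> 'g \<Rightarrow> 'b) \<Rightarrow> bool" where
  "separated A \<phi> \<longleftrightarrow> (\<exists>ps. (\<forall>q\<in>set ps. fst q \<in> A) \<and>
     (\<forall>p g. \<phi> p g = (\<Sum>q\<leftarrow>ps. scale (fst q g) (snd q p))))"

lemma separatedI: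
  "(\<And>q. q \<in> set ps \<Longrightarrow> fst q \<in> A) \<Longrightarrow> (\<And>p g. \<phi> p g = (\<Sum>q\<leftarrow>ps. scale (fst q g) (snd q p))) \<Longrightarrow>
   separated A \<phi>"
  unfolding separated_def by blast

lemma separated_zero: "separated A (\<lambda>p g. 0)"
  by (rule separatedI[of "[]"]) simp_all

lemma separated_left: "(\<lambda>_. 1) \<in> A \<Longrightarrow> separated A (\<lambda>p g. u p)"
  by (rule separatedI[of "[(\<lambda>_. 1, u)]"]) simp_all

lemma separated_add:
  assumes "separated A \<phi>" "separated A \<psi>"
  shows "separated A (\<lambda>p g. \<phi> p g + \<psi> p g)"
proof -
  obtain ps qs where ps: "\<forall>q\<in>set ps. fst q \<in> A" "\<forall>p g. \<phi> p g = (\<Sum>q\<leftarrow>ps. scale (fst q g) (snd q p))"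
    and qs: "\<forall>q\<in>set qs. fst q \<in> A" "\<forall>p g. \<psi> p g = (\<Sum>q\<leftarrow>qs. scale (fst q g) (snd q p))"
    using assms unfolding separated_def by blast
  show ?thesis by (rule separatedI[of "ps @ qs"]) (use ps qs in auto)
qed

lemma separated_sum:
  "finite I \<Longrightarrow> (\<And>i. i \<in> I \<Longrightarrow> separated A (\<phi> i)) \<Longrightarrow> separated A (\<lambda>p g. \<Sum>i\<in>I. \<phi> i p g)"
  by (induction I rule: finite_induct) (auto intro: separated_zero separated_add)

lemma separated_scale:
  assumes "separated A \<phi>" and a: "\<And>b. b \<in> A \<Longrightarrow> (\<lambda>g. a g * b g) \<in> A"
  shows "separated A (\<lambda>p g. scale (a g * f p) (\<phi> p g))"
proof -
  obtain ps where ps: "\<forall>q\<in>set ps. fst q \<in> A" "\<forall>p g. \<phi> p g = (\<Sum>q\<leftarrow>ps. scale (fst q g) (snd q p))"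
    using assms unfolding separated_def by blast
  show ?thesis
    by (rule separatedI[of "map (\<lambda>q. (\<lambda>g. a g * fst q g, \<lambda>p. scale (f p) (snd q p))) ps"])
      (use ps a in \<open>auto simp: scale_sum_list o_def ac_simps\<close>)
qed

text \<open>An entry of \<open>B ** g\<close> is a sum of products of an entry of \<open>B\<close>
  and an entry of \<open>g\<close>. The factor \<open>\<phi>\<close> is generalised so that a
  product of polynomials is handled one factor at a time.\<close>

lemma separated_mult_poly:
  fixes f :: "('a, 'n::finite, 'r::finite) mat \<Rightarrow> 'a"
  assumes "f \<in> matrix_polys" "separated matrix_polys \<phi>"
  shows "separated matrix_polys (\<lambda>B g :: 'a^'r^'r. scale (f (B ** g)) (\<phi> B g))"
  using assms
proof (induction arbitrary: \<phi>)
  case (const c)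
  then show ?case
    using separated_scale[OF const, of "\<lambda>_. 1" "\<lambda>_. c"] by simp
next
  case (coord i j)
  have "separated matrix_polys (\<lambda>B g :: 'a^'r^'r. \<Sum>k\<in>UNIV. scale (g $ k $ j * B $ i $ k) (\<phi> B g))"
    by (intro separated_sum separated_scale coord finite matrix_polys.mult matrix_polys.coord)
  then show ?case by (simp add: matrix_matrix_mult_def scale_sum_left mult.commute)
next
  case (add f g)
  then show ?case by (simp add: scale_left_distrib separated_add)
next
  case (mult f g)
  from mult.IH(1)[OF mult.IH(2)[OF mult.prems]] show ?case by simp
qed

lemma separated_tensor:
  fixes t :: "('a, 'n::finite, 'r::finite) mat \<Rightarrow> 'b"
  assumes "t \<in> tensor_functions scale matrix_polys"
  shows "separated matrix_polys (\<lambda>B g :: 'a^'r^'r. t (B ** g))"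
proof -
  obtain N f m where f: "\<forall>i<(N::nat). f i \<in> matrix_polys" and t: "t = (\<lambda>p. \<Sum>i<N. scale (f i p) (m i))"
    using assms unfolding tensor_functions_iff by blast
  have "separated matrix_polys (\<lambda>B g :: 'a^'r^'r. \<Sum>i<N. scale (f i (B ** g)) (m i))"
    using f by (intro separated_sum separated_mult_poly separated_left matrix_polys.const) auto
  then show ?thesis by (simp add: t)
qed

definition cscale :: "'a \<Rightarrow> ('p \<Rightarrow> 'b) \<Rightarrow> 'p \<Rightarrow> 'b" where
  "cscale c s = (\<lambda>p. scale c (s p))"

lemma vector_functions_cscale: "vector_functions (cscale :: 'a \<Rightarrow> ('p \<Rightarrow> 'b) \<Rightarrow> 'p \<Rightarrow> 'b)"
  by (intro vector_functions.intro vector_space.intro)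
    (simp_all add: fun_eq_iff cscale_def scale_right_distrib scale_left_distrib)

lemma sum_list_cscale_apply:
  "(\<Sum>q\<leftarrow>ps. cscale (f q) (u q)) p = (\<Sum>q\<leftarrow>ps. scale (f q) (u q p))"
  by (induction ps) (simp_all add: cscale_def)

text \<open>A separated expansion of minimal length of a family of elements of \<open>N\<close> has its right factors in
  \<open>N\<close>: a functional that vanishes on \<open>N\<close> but not on some right factor would yield a linear relation
  among the left factors and hence a shorter expansion.\<close>

lemma separated_in_subspace:
  assumes N: "module.subspace (cscale :: 'a \<Rightarrow> ('p \<Rightarrow> 'b) \<Rightarrow> 'p \<Rightarrow> 'b) N"
    and R: "\<And>g. g \<in> P \<Longrightarrow> R g \<in> N"
    and ps: "\<And>g. g \<in> P \<Longrightarrow> R g = (\<Sum>q\<leftarrow>ps. cscale (fst q g) (snd q))" "\<And>q. q \<in> set ps \<Longrightarrow> fst q \<in> A"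
  shows "\<exists>ps. (\<forall>q\<in>set ps. fst q \<in> A \<and> snd q \<in> N) \<and>
    (\<forall>g\<in>P. R g = (\<Sum>q\<leftarrow>ps. cscale (fst q g) (snd q)))"
  using ps
proof (induction "length ps" arbitrary: ps rule: less_induct)
  case less
  interpret V: vector_functions "cscale :: 'a \<Rightarrow> ('p \<Rightarrow> 'b) \<Rightarrow> 'p \<Rightarrow> 'b"
    by (rule vector_functions_cscale)
  show ?case
  proof (cases "\<forall>q\<in>set ps. snd q \<in> N")
    case True
    then show ?thesis using less.prems by (intro exI[of _ ps]) auto
  next
    case False
    then obtain q0 where q0: "q0 \<in> set ps" "snd q0 \<notin> N" by blast
    obtain xs ys where split: "ps = xs @ q0 # ys" using split_list[OF q0(1)] by blast
    obtain \<phi> where \<phi>: "Vector_Spaces.linear cscale (*) \<phi>" "\<forall>v\<in>N. \<phi> v = 0" "\<phi> (snd q0) = 1"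
      using V.ex_functional[OF N q0(2)] by blast
    interpret \<phi>: Vector_Spaces.linear "cscale :: 'a \<Rightarrow> ('p \<Rightarrow> 'b) \<Rightarrow> 'p \<Rightarrow> 'b" "(*)" \<phi> by (rule \<phi>(1))
    have \<phi>_list: "\<phi> (\<Sum>q\<leftarrow>zs. cscale (f q) (snd q)) = (\<Sum>q\<leftarrow>zs. f q * \<phi> (snd q))"
      for zs :: "(('c \<Rightarrow> 'a) \<times> ('p \<Rightarrow> 'b)) list" and f
      by (induction zs) (simp_all only: list.map sum_list.Nil sum_list.Cons \<phi>.zero \<phi>.add \<phi>.scale)
    define zs where "zs = xs @ ys"
    \<comment> \<open>Projection along \<open>snd q0\<close> onto the kernel of
      \<open>\<phi>\<close>, applied to right factors only; the left factors are those of the old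
      expansion and thus remain in \<open>A\<close>.\<close>
    define h where "h = (\<lambda>q :: ('c \<Rightarrow> 'a) \<times> ('p \<Rightarrow> 'b). (fst q, snd q - cscale (\<phi> (snd q)) (snd q0)))"
    have expand: "R g = (\<Sum>q\<leftarrow>map h zs. cscale (fst q g) (snd q))" if g: "g \<in> P" for g
    proof -
      have R_eq: "R g = (\<Sum>q\<leftarrow>zs. cscale (fst q g) (snd q)) + cscale (fst q0 g) (snd q0)"
        using less.prems(1)[OF g] by (simp only: split zs_def map_append sum_list_append list.map sum_list.Cons ac_simps)
      have "\<phi> (R g) = 0" using \<phi>(2) R[OF g] by blast
      then have "(\<Sum>q\<leftarrow>zs. fst q g * \<phi> (snd q)) + fst q0 g = 0"
        unfolding R_eq \<phi>.add \<phi>_list \<phi>.scale by (simp add: \<phi>(3))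
      then have a0: "fst q0 g = - (\<Sum>q\<leftarrow>zs. fst q g * \<phi> (snd q))" by (simp add: eq_neg_iff_add_eq_0 add.commute)
      have "(\<Sum>q\<leftarrow>map h zs. cscale (fst q g) (snd q)) =
          (\<Sum>q\<leftarrow>zs. cscale (fst q g) (snd q)) - cscale (\<Sum>q\<leftarrow>zs. fst q g * \<phi> (snd q)) (snd q0)"
      proof (induction zs)
        case (Cons q zs)
        then show ?case
          by (simp only: list.map sum_list.Cons h_def fst_conv snd_conv V.scale_right_diff_distrib
              V.scale_scale V.scale_left_distrib) (simp add: algebra_simps)
      qed simp
      also have "\<dots> = R g" unfolding R_eq a0 by (simp only: V.scale_minus_left) simp
      finally show ?thesis by simp
    qed
    have "length (map h zs) < length ps" by (simp add: zs_def split)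
    moreover have "fst q \<in> A" if qz: "q \<in> set (map h zs)" for q
    proof -
      obtain q' where q': "q' \<in> set zs" "q = h q'" using qz by auto
      then have "q' \<in> set ps" by (auto simp: zs_def split)
      then show ?thesis using less.prems(2) by (simp add: q'(2) h_def)
    qed
    ultimately show ?thesis using expand by (intro less.hyps[of "map h zs"])
  qed
qed

text \<open>The shortening argument is applied to the translates of \<open>t\<close>, indexed by the
  invertible matrices. The resulting coefficients are polynomial in \<open>g\<close>, so a matrix
  depending on the point may be substituted for \<open>g\<close>.\<close>

lemma equivariant_expansion:
  fixes t :: "('a, 'n::finite, 'r::finite) mat \<Rightarrow> 'b"
  assumes t: "t \<in> tensor_functions scale matrix_polys" and N: "module.subspace cscale N"
    and equiv: "\<And>g :: 'a^'r^'r. invertible g \<Longrightarrow> (\<lambda>B. t (B ** g)) \<in> N"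
  shows "\<exists>ps. (\<forall>q\<in>set ps. fst q \<in> matrix_polys \<and> snd q \<in> N) \<and>
    (\<forall>g :: 'a^'r^'r. \<forall>B. invertible g \<longrightarrow> t (B ** g) = (\<Sum>q\<leftarrow>ps. scale (fst q g) (snd q B)))"
proof -
  obtain ps where ps: "\<forall>q\<in>set ps. fst q \<in> (matrix_polys :: ('a^'r^'r \<Rightarrow> 'a) set)"
    "\<forall>B g. t (B ** g) = (\<Sum>q\<leftarrow>ps. scale (fst q g) (snd q B))"
    using separated_tensor[OF t] unfolding separated_def by blast
  have "\<exists>ps. (\<forall>q\<in>set ps. fst q \<in> (matrix_polys :: ('a^'r^'r \<Rightarrow> 'a) set) \<and> snd q \<in> N) \<and>
    (\<forall>g\<in>Collect invertible. (\<lambda>B. t (B ** g)) = (\<Sum>q\<leftarrow>ps. cscale (fst q g) (snd q)))"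
  proof (rule separated_in_subspace[OF N])
    show "(\<lambda>B. t (B ** g)) \<in> N" if "g \<in> Collect invertible" for g :: "'a^'r^'r"
      using equiv that by simp
    show "(\<lambda>B. t (B ** g)) = (\<Sum>q\<leftarrow>ps. cscale (fst q g) (snd q))" for g :: "'a^'r^'r"
      using ps(2) by (simp add: fun_eq_iff sum_list_cscale_apply)
    show "fst q \<in> matrix_polys" if "q \<in> set ps" for q using ps(1) that by blast
  qed
  then obtain ps where ps: "\<forall>q\<in>set ps. fst q \<in> (matrix_polys :: ('a^'r^'r \<Rightarrow> 'a) set) \<and> snd q \<in> N"
    "\<forall>g\<in>Collect invertible. (\<lambda>B. t (B ** g)) = (\<Sum>q\<leftarrow>ps. cscale (fst q g) (snd q))" by blast
  have "t (B ** g) = (\<Sum>q\<leftarrow>ps. scale (fst q g) (snd q B))" if "invertible g" for g :: "'a^'r^'r" and B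
    using fun_cong[OF ps(2)[rule_format, of g], of B] that by (simp add: sum_list_cscale_apply)
  with ps(1) show ?thesis by blast
qed

end

section \<open>Descent of equivariant submodules\<close>

context function_sheaf
begin

lemma comb_sum_list: "(\<And>q. q \<in> set qs \<Longrightarrow> s q \<in> comb W S) \<Longrightarrow> (\<lambda>p. \<Sum>q\<leftarrow>qs. s q p) \<in> comb W S"
  by (induction qs) (auto intro: comb_zero comb_add)

end

context grassmannian_module
begin

sublocale VF: vector_functions sc
  by (rule vector_functions.intro) (rule Mk.vector_space_axioms)

text \<open>Pull-back is injective on subsheaves. Since \<open>\<pi> (cm \<sigma> U) = U\<close>, a
  local combination of functions \<open>t \<circ> \<pi>\<close> becomes, after composing with
  \<open>cm \<sigma>\<close>, a combination of the sections \<open>t\<close> themselves.\<close>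

lemma subsheaf_iff_pullback:
  assumes F: "module_subsheaf sc Gr F" and W: "openin (opens Gr) W"
  shows "s \<in> F W \<longleftrightarrow> s \<in> free_sheaf sc Gr W \<and>
    restrict_section (\<lambda>A. s (\<pi> A)) (reps W) \<in> pullback_subsheaf x act F (reps W)"
    (is "_ \<longleftrightarrow> _ \<and> ?s \<in> _")
proof -
  define P where "P = (\<lambda>W :: ('k, 'n, 'r) mat set. {t \<circ> \<pi> | t V. openin (opens Gr) V \<and> \<pi> ` W \<subseteq> V \<and> t \<in> F V})"
  have pb: "pullback_subsheaf x act F = generated_subsheaf sc Mats P"
    unfolding pullback_subsheaf_def P_def r_eq ..
  show ?thesis
  proof (intro iffI conjI; (elim conjE)?)
    assume s: "s \<in> F W"
    show free: "s \<in> free_sheaf sc Gr W" by (rule G.subsheaf_free[OF F s])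
    have "\<pi> ` reps W \<subseteq> W" by (auto simp: representatives_iff)
    then have "s \<circ> \<pi> \<in> P (reps W)" unfolding P_def using W s by blast
    then have "s \<circ> \<pi> \<in> Y.comb (reps W) (P (reps W))" by (rule Y.comb_base[OF openin_reps[OF W]])
    then have "?s \<in> Y.comb (reps W) (P (reps W))" by (rule Y.comb_cong) simp
    with free_pullback[OF free] show "?s \<in> pullback_subsheaf x act F (reps W)"
      unfolding pb by (rule Y.generatedI)
  next
    assume free: "s \<in> free_sheaf sc Gr W" and gen: "?s \<in> pullback_subsheaf x act F (reps W)"
    from free show "s \<in> F W"
    proof (rule G.subsheaf_glue[OF F])
      fix p assume p: "p \<in> W"
      then have "p \<in> topspace (opens Gr)" using W openin_subset by blast
      then obtain \<sigma> :: "'r \<Rightarrow> 'n" where p\<sigma>: "p \<in> crt \<sigma>" using topspace_Gr by blast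
      have "cm \<sigma> p \<in> reps W" using p chart_matrix(1,4)[OF p\<sigma>] by (simp add: representatives_iff)
      then obtain W' where W': "openin (opens Mats) W'" "cm \<sigma> p \<in> W'" "W' \<subseteq> reps W" "?s \<in> Y.comb W' (P W')"
        using gen unfolding pb Y.generated_iff by blast
      \<comment> \<open>The neighbourhood \<open>W'\<close> lives among matrices and need not be a
        union of orbits; its preimage under \<open>cm \<sigma>\<close> is nevertheless an open
        neighbourhood of \<open>p\<close>.\<close>
      define V where "V = cpull \<sigma> W'"
      have V: "openin (opens Gr) V" using W'(1) unfolding V_def by (intro openin_cpull) (simp add: openin_Mo_iff)
      have pV: "p \<in> V" using p\<sigma> W'(2) by (simp add: V_def cpull_def)
      have cmV: "\<pi> (cm \<sigma> U) = U" "cm \<sigma> U \<in> W'" if "U \<in> V" for U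
        using that chart_matrix(1)[of U \<sigma>] by (auto simp: V_def cpull_def)
      have VW: "V \<subseteq> W"
      proof
        fix U assume "U \<in> V"
        then have "cm \<sigma> U \<in> reps W" using cmV(2) W'(3) by blast
        then show "U \<in> W" using cmV(1)[OF \<open>U \<in> V\<close>] by (simp add: representatives_iff)
      qed
      have "(\<lambda>U. ?s (cm \<sigma> U)) \<in> G.comb V ((\<lambda>t U. t (cm \<sigma> U)) ` P W')"
        unfolding V_def by (rule comb_cpull[OF W'(1,4)])
      moreover have "s U = ?s (cm \<sigma> U)" if "U \<in> V" for U
        using cmV[OF that] W'(3) by auto
      ultimately have comb: "s \<in> G.comb V ((\<lambda>t U. t (cm \<sigma> U)) ` P W')" by (rule G.comb_cong)
      have "restrict_section s V \<in> F V"
      proof (rule G.subsheaf_comb[OF F V _ comb])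
        fix u assume "u \<in> (\<lambda>t U. t (cm \<sigma> U)) ` P W'"
        then obtain t Vt where t: "u = (\<lambda>U. (t \<circ> \<pi>) (cm \<sigma> U))" "openin (opens Gr) Vt" "\<pi> ` W' \<subseteq> Vt" "t \<in> F Vt"
          unfolding P_def by blast
        have "V \<subseteq> Vt"
        proof
          fix U assume "U \<in> V"
          then have "\<pi> (cm \<sigma> U) \<in> Vt" using t(3) cmV(2) by blast
          then show "U \<in> Vt" using cmV(1)[OF \<open>U \<in> V\<close>] by simp
        qed
        then have "restrict_section t V \<in> F V" by (rule G.subsheaf_restrict[OF F t(2) V _ t(4)])
        also have "restrict_section t V = restrict_section u V"
          by (rule restrict_section_cong) (simp_all add: t(1) cmV(1))
        finally show "restrict_section u V \<in> F V" .
      qed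
      with V pV VW show "\<exists>W'. openin (opens Gr) W' \<and> p \<in> W' \<and> W' \<subseteq> W \<and> restrict_section s W' \<in> F W'"
        by blast
    qed
  qed
qed

lemma reg_poly_Mats: "openin (opens Mats) W \<Longrightarrow> f \<in> matrix_polys \<Longrightarrow> restrict_section f W \<in> reg_funs Mats W"
  using regular_poly[of W f] by (simp add: openin_Mo_iff) (simp add: Mo_def)

lemma free_poly_Mats:
  assumes W: "openin (opens Mats) W" and t: "t \<in> tensor_functions sc matrix_polys"
  shows "restrict_section t W \<in> free_sheaf sc Mats W"
proof (rule Y.free_sheafI[OF W])
  have "(\<lambda>A. sc (if A \<in> W then 1 else 0) (t A)) \<in> tensor_functions sc (reg_funs Mats W)"
    by (rule Mk.tensor_functions_map[OF t, where \<phi> = "\<lambda>f. restrict_section f W", OF reg_poly_Mats[OF W]])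
      (simp_all add: restrict_section_def)
  also have "(\<lambda>A. sc (if A \<in> W then 1 else 0) (t A)) = restrict_section t W"
    by (auto simp: restrict_section_def fun_eq_iff)
  finally show "restrict_section t W \<in> tensor_functions sc (reg_funs Mats W)" .
qed

end

text \<open>What kernels and images have in common. \<open>Nc\<close> is tied to \<open>N\<close> in
  both directions: \<open>N_chart\<close> restricts along a chart section,
  \<open>Nc_pullback\<close> goes back up to matrices. \<open>N_equivariant\<close> speaks of one
  invertible matrix over \<open>k\<close> at a time.\<close>

locale descent = grassmannian_module x act r
  for x :: "'n::{finite,linorder} \<Rightarrow> ('e::ab_group_add \<Rightarrow>\<^sub>0 'k::field)"
    and act :: "('e \<Rightarrow>\<^sub>0 'k) \<Rightarrow> 'm::ab_group_add \<Rightarrow> 'm"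
    and r :: "'r::{finite,linorder} itself" +
  fixes N :: "(('k, 'n, 'r) mat \<Rightarrow> 'm) set"
    and Nc :: "('r \<Rightarrow> 'n) \<Rightarrow> (('e \<Rightarrow>\<^sub>0 'k) set \<Rightarrow> 'm) set"
  assumes finite_dim: "\<exists>B. finite B \<and> Mk.span B = UNIV"
    and N_tensor: "N \<subseteq> tensor_functions sc matrix_polys"
    and N_zero: "(\<lambda>A. 0) \<in> N"
    and N_add: "\<And>s t. s \<in> N \<Longrightarrow> t \<in> N \<Longrightarrow> (\<lambda>A. s A + t A) \<in> N"
    and N_scale: "\<And>f t. f \<in> matrix_polys \<Longrightarrow> t \<in> N \<Longrightarrow> (\<lambda>A. sc (f A) (t A)) \<in> N"
    and N_equivariant: "\<And>t g. t \<in> N \<Longrightarrow> invertible g \<Longrightarrow> (\<lambda>A. t (A ** g)) \<in> N"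
    and N_chart: "\<And>t \<sigma>. t \<in> N \<Longrightarrow> restrict_section (\<lambda>U. t (cm \<sigma> U)) (crt \<sigma>) \<in> Nc \<sigma>"
    and Nc_free: "\<And>t \<sigma>. t \<in> Nc \<sigma> \<Longrightarrow> t \<in> free_sheaf sc Gr (crt \<sigma>)"
    and Nc_pullback: "\<And>t \<sigma>. t \<in> Nc \<sigma> \<Longrightarrow> restrict_section (\<lambda>A. t (\<pi> A)) (reps (crt \<sigma>)) \<in>
      restriction_to_Mo act N (reps (crt \<sigma>))"
begin

abbreviation Nt :: "('k, 'n, 'r) mat set \<Rightarrow> (('k, 'n, 'r) mat \<Rightarrow> 'm) set" where
  "Nt \<equiv> restriction_to_Mo act N"

lemma Nt_def: "Nt = generated_subsheaf sc Mats (\<lambda>_. N)"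
  by (rule restriction_to_Mo_def)

lemma Nt_subsheaf: "module_subsheaf sc Mats Nt"
  unfolding Nt_def by (rule Y.module_subsheaf_generated) simp

definition descended :: "('e \<Rightarrow>\<^sub>0 'k) set set \<Rightarrow> (('e \<Rightarrow>\<^sub>0 'k) set \<Rightarrow> 'm) set" where
  "descended W = {s \<in> free_sheaf sc Gr W. restrict_section (\<lambda>A. s (\<pi> A)) (reps W) \<in> Nt (reps W)}"

lemma reps_mono: "W' \<subseteq> W \<Longrightarrow> reps W' \<subseteq> reps W"
  by (auto simp: representatives_iff)

lemma restrict_pullback:
  assumes "W' \<subseteq> W"
  shows "restrict_section (restrict_section (\<lambda>A. s (\<pi> A)) (reps W)) (reps W') =
    restrict_section (\<lambda>A. restrict_section s W' (\<pi> A)) (reps W')"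
  using reps_mono[OF assms] by (auto simp: restrict_section_def fun_eq_iff representatives_iff)

lemma descended_subsheaf: "module_subsheaf sc Gr descended"
proof (rule G.module_subsheafI)
  fix W s assume "s \<in> descended W"
  then show "s \<in> free_sheaf sc Gr W" by (simp add: descended_def)
next
  fix W assume W: "openin (opens Gr) W"
  have "restrict_section (\<lambda>A. 0 :: 'm) (reps W) = (\<lambda>A. 0)" by (simp add: restrict_section_def)
  then show "(\<lambda>p. 0) \<in> descended W"
    using G.free_zero[OF W] Y.subsheaf_zero[OF Nt_subsheaf openin_reps[OF W]] by (simp add: descended_def)
next
  fix W s t assume W: "openin (opens Gr) W" and s: "s \<in> descended W" and t: "t \<in> descended W"
  have "restrict_section (\<lambda>A. s (\<pi> A) + t (\<pi> A)) (reps W) =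
      (\<lambda>A. restrict_section (\<lambda>A. s (\<pi> A)) (reps W) A + restrict_section (\<lambda>A. t (\<pi> A)) (reps W) A)"
    by (simp add: restrict_section_def fun_eq_iff)
  then show "(\<lambda>p. s p + t p) \<in> descended W"
    using s t Y.subsheaf_add[OF Nt_subsheaf openin_reps[OF W]] by (simp add: descended_def G.free_add)
next
  fix W a s assume W: "openin (opens Gr) W" and a: "a \<in> reg_funs Gr W" and s: "s \<in> descended W"
  have "restrict_section (\<lambda>A. sc (a (\<pi> A)) (s (\<pi> A))) (reps W) =
      (\<lambda>A. sc (restrict_section (\<lambda>A. a (\<pi> A)) (reps W) A) (restrict_section (\<lambda>A. s (\<pi> A)) (reps W) A))"
    by (simp add: restrict_section_def fun_eq_iff)
  moreover have "restrict_section (\<lambda>A. a (\<pi> A)) (reps W) \<in> reg_funs Mats (reps W)"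
    using a by (simp add: reg_Gr_iff Mo_def)
  ultimately show "(\<lambda>p. sc (a p) (s p)) \<in> descended W"
    using s a Y.subsheaf_scale[OF Nt_subsheaf openin_reps[OF W]] by (simp add: descended_def G.free_scale)
next
  fix W W' s assume W: "openin (opens Gr) W" "openin (opens Gr) W'" "W' \<subseteq> W" and s: "s \<in> descended W"
  then have "restrict_section (restrict_section (\<lambda>A. s (\<pi> A)) (reps W)) (reps W') \<in> Nt (reps W')"
    by (intro Y.subsheaf_restrict[OF Nt_subsheaf openin_reps openin_reps reps_mono]) (auto simp: descended_def)
  then show "restrict_section s W' \<in> descended W'"
    using s G.free_restrict[OF _ W(2,3)] unfolding restrict_pullback[OF W(3)] by (simp add: descended_def)
next
  fix W s assume s: "s \<in> free_sheaf sc Gr W"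
    and loc: "\<And>p. p \<in> W \<Longrightarrow> \<exists>W'. openin (opens Gr) W' \<and> p \<in> W' \<and> W' \<subseteq> W \<and> restrict_section s W' \<in> descended W'"
  have "restrict_section (\<lambda>A. s (\<pi> A)) (reps W) \<in> Nt (reps W)"
  proof (rule Y.subsheaf_glue[OF Nt_subsheaf free_pullback[OF s]])
    fix A assume A: "A \<in> reps W"
    then obtain W' where W': "openin (opens Gr) W'" "\<pi> A \<in> W'" "W' \<subseteq> W" "restrict_section s W' \<in> descended W'"
      using loc[of "\<pi> A"] by (auto simp: representatives_iff)
    have "A \<in> reps W'" using A W'(2) by (simp add: representatives_iff)
    moreover have "restrict_section (restrict_section (\<lambda>A. s (\<pi> A)) (reps W)) (reps W') \<in> Nt (reps W')"
      unfolding restrict_pullback[OF W'(3)] using W'(4) by (simp add: descended_def)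
    ultimately show "\<exists>V. openin (opens Mats) V \<and> A \<in> V \<and> V \<subseteq> reps W \<and>
        restrict_section (restrict_section (\<lambda>A. s (\<pi> A)) (reps W)) V \<in> Nt V"
      using openin_reps[OF W'(1)] reps_mono[OF W'(3)] by blast
  qed
  with s show "s \<in> descended W" by (simp add: descended_def)
qed

text \<open>Over a chart \<open>s U\<close> is the value of the pulled back section at the
  representative \<open>cm \<sigma> U\<close>, so a local expression through \<open>N\<close> on
  matrices descends to one through the functions \<open>t \<circ> cm \<sigma>\<close>.\<close>

lemma descended_local:
  assumes s: "s \<in> descended W" and p: "p \<in> W" and W: "W \<subseteq> crt \<sigma>"
  shows "\<exists>V. openin (opens Gr) V \<and> p \<in> V \<and> V \<subseteq> W \<and> s \<in> G.comb V ((\<lambda>t U. t (cm \<sigma> U)) ` N)"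
proof -
  let ?s = "restrict_section (\<lambda>A. s (\<pi> A)) (reps W)"
  have p\<sigma>: "p \<in> crt \<sigma>" using p W by blast
  have "cm \<sigma> p \<in> reps W" using p chart_matrix(1,4)[OF p\<sigma>] by (simp add: representatives_iff)
  moreover have "?s \<in> Nt (reps W)" using s by (simp add: descended_def)
  ultimately obtain W' where W': "openin (opens Mats) W'" "cm \<sigma> p \<in> W'" "W' \<subseteq> reps W" "?s \<in> Y.comb W' N"
    unfolding Nt_def Y.generated_iff by blast
  define V where "V = cpull \<sigma> W'"
  have V: "openin (opens Gr) V" using W'(1) unfolding V_def by (intro openin_cpull) (simp add: openin_Mo_iff)
  have pV: "p \<in> V" using p\<sigma> W'(2) by (simp add: V_def cpull_def)
  have cmV: "\<pi> (cm \<sigma> U) = U" "cm \<sigma> U \<in> reps W" if "U \<in> V" for U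
    using that chart_matrix(1)[of U \<sigma>] W'(3) by (auto simp: V_def cpull_def)
  have VW: "V \<subseteq> W"
  proof
    fix U assume "U \<in> V"
    then show "U \<in> W" using cmV[OF \<open>U \<in> V\<close>] by (simp add: representatives_iff)
  qed
  have "(\<lambda>U. ?s (cm \<sigma> U)) \<in> G.comb V ((\<lambda>t U. t (cm \<sigma> U)) ` N)"
    unfolding V_def by (rule comb_cpull[OF W'(1,4)])
  then have "s \<in> G.comb V ((\<lambda>t U. t (cm \<sigma> U)) ` N)"
    by (rule G.comb_cong) (simp add: cmV)
  with V pV VW show ?thesis by blast
qed

lemma Nc_descended: "t \<in> Nc \<sigma> \<Longrightarrow> t \<in> descended (crt \<sigma>)"
  using Nc_free Nc_pullback by (simp add: descended_def)

lemma generated_subset_descended: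
  assumes "S \<subseteq> Nc \<sigma>" "openin (opens Gr) W" "W \<subseteq> crt \<sigma>"
  shows "generated_subsheaf sc Gr (\<lambda>_. S) W \<subseteq> descended W"
proof (rule G.generated_least[OF descended_subsheaf])
  fix W' t assume W': "openin (opens Gr) W'" "W' \<subseteq> W" and "t \<in> S"
  then have t: "t \<in> descended (crt \<sigma>)" using assms(1) Nc_descended by blast
  have "W' \<subseteq> crt \<sigma>" using W'(2) assms(3) by blast
  then show "restrict_section t W' \<in> descended W'"
    by (rule G.subsheaf_restrict[OF descended_subsheaf openin_chart W'(1) _ t])
qed

text \<open>The set \<open>S\<close> is left open so that the same argument serves the full chart
  module and, for coherence, a finite set of sections.\<close>

lemma descended_subset_generated:
  assumes W: "W \<subseteq> crt \<sigma>"
    and S: "\<And>V t. openin (opens Gr) V \<Longrightarrow> V \<subseteq> crt \<sigma> \<Longrightarrow> t \<in> N \<Longrightarrow> (\<lambda>U. t (cm \<sigma> U)) \<in> G.comb V S"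
  shows "descended W \<subseteq> generated_subsheaf sc Gr (\<lambda>_. S) W"
proof
  fix s assume s: "s \<in> descended W"
  have "\<exists>V. openin (opens Gr) V \<and> p \<in> V \<and> V \<subseteq> W \<and> s \<in> G.comb V S" if p: "p \<in> W" for p
  proof -
    obtain V where V: "openin (opens Gr) V" "p \<in> V" "V \<subseteq> W" "s \<in> G.comb V ((\<lambda>t U. t (cm \<sigma> U)) ` N)"
      using descended_local[OF s p W] by blast
    have "(\<lambda>t U. t (cm \<sigma> U)) ` N \<subseteq> G.comb V S"
      using S[OF V(1)] V(3) W by blast
    then have "s \<in> G.comb V S" by (rule G.comb_trans[OF V(1) _ V(4)])
    with V show ?thesis by blast
  qed
  moreover have "s \<in> free_sheaf sc Gr W" using s by (simp add: descended_def)
  ultimately show "s \<in> generated_subsheaf sc Gr (\<lambda>_. S) W" unfolding G.generated_iff by blast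
qed

lemma descended_chart:
  assumes "openin (opens Gr) W" "W \<subseteq> crt \<sigma>"
  shows "descended W = generated_subsheaf sc Gr (\<lambda>_. Nc \<sigma>) W"
proof
  show "generated_subsheaf sc Gr (\<lambda>_. Nc \<sigma>) W \<subseteq> descended W"
    by (rule generated_subset_descended[OF order_refl assms])
  show "descended W \<subseteq> generated_subsheaf sc Gr (\<lambda>_. Nc \<sigma>) W"
  proof (rule descended_subset_generated[OF assms(2)])
    fix V t assume V: "openin (opens Gr) V" "V \<subseteq> crt \<sigma>" and t: "t \<in> N"
    from G.comb_base[OF V(1) N_chart[OF t]]
    show "(\<lambda>U. t (cm \<sigma> U)) \<in> G.comb V (Nc \<sigma>)"
      by (rule G.comb_cong) (use V(2) in auto)
  qed
qed

theorem has_chart_modules_descended: "has_chart_modules x act Nc descended"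
  unfolding has_chart_modules_def r_eq[symmetric]
  using descended_subsheaf descended_chart by blast

text \<open>The charts of increasing index maps cover the Grassmannian, because a matrix of full
  rank has a nonzero minor with rows in increasing order; a subsheaf is determined on a
  cover.\<close>

theorem has_chart_modules_unique:
  assumes "has_chart_modules x act Nc F"
  shows "F = descended"
proof (rule G.subsheaf_eqI)
  have F: "module_subsheaf sc Gr F" "\<And>\<sigma> W. strict_mono \<sigma> \<Longrightarrow> openin (opens Gr) W \<Longrightarrow> W \<subseteq> crt \<sigma> \<Longrightarrow>
      F W = generated_subsheaf sc Gr (\<lambda>_. Nc \<sigma>) W"
    using assms unfolding has_chart_modules_def r_eq[symmetric] by blast+
  show "module_subsheaf sc Gr F" by (rule F(1))
  show "module_subsheaf sc Gr descended" by (rule descended_subsheaf)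
  fix p assume "p \<in> topspace (opens Gr)"
  then obtain \<sigma> :: "'r \<Rightarrow> 'n" where \<sigma>: "strict_mono \<sigma>" "p \<in> crt \<sigma>" using topspace_Gr by blast
  have "F W = descended W" if "openin (opens Gr) W" "W \<subseteq> crt \<sigma>" for W
    using F(2)[OF \<sigma>(1) that] descended_chart[OF that] by simp
  with openin_chart[of \<sigma>] \<sigma>(2)
  show "\<exists>U. openin (opens Gr) U \<and> p \<in> U \<and> (\<forall>W. openin (opens Gr) W \<and> W \<subseteq> U \<longrightarrow> F W = descended W)"
    by blast
qed

text \<open>Finite generation is expressed through all submodules \<open>L\<close> containing
  \<open>S\<close>, so that a property can be proved for all of \<open>N\<close> by taking
  \<open>L\<close> to be the set of functions that have it.\<close>

lemma N_finitely_generated: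
  "\<exists>S\<subseteq>N. finite S \<and> (\<forall>L. (\<lambda>A. 0) \<in> L \<and> (\<forall>s\<in>L. \<forall>t\<in>L. (\<lambda>A. s A + t A) \<in> L) \<and>
     (\<forall>f\<in>matrix_polys. \<forall>t\<in>L. (\<lambda>A. sc (f A) (t A)) \<in> L) \<and> S \<subseteq> L \<longrightarrow> N \<subseteq> L)"
proof -
  interpret F: operator_module "VF.fscale :: (('k, 'n, 'r) mat \<Rightarrow> 'k) \<Rightarrow> (('k, 'n, 'r) mat \<Rightarrow> 'm) \<Rightarrow> _"
    by (rule VF.operator_module_fscale)
  have stable_iff: "F.stable A L \<longleftrightarrow> (\<lambda>A. 0) \<in> L \<and> (\<forall>s\<in>L. \<forall>t\<in>L. (\<lambda>A. s A + t A) \<in> L) \<and>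
     (\<forall>f\<in>A. \<forall>t\<in>L. (\<lambda>A. sc (f A) (t A)) \<in> L)" for A L
    unfolding F.stable_def VF.fscale_def plus_fun_def zero_fun_def ..
  obtain B where "finite B" "Mk.span B = UNIV" using finite_dim by blast
  moreover have "F.stable matrix_polys N" unfolding stable_iff using N_zero N_add N_scale by blast
  ultimately obtain S where S: "S \<subseteq> N" "finite S" "N \<subseteq> F.stable_hull matrix_polys S"
    using VF.noetherian_tensor_polys[OF _ _ N_tensor] by blast
  have "N \<subseteq> L" if "F.stable matrix_polys L" "S \<subseteq> L" for L
    using F.stable_hull_least[OF that] S(3) by blast
  with S(1,2) show ?thesis unfolding stable_iff by (intro exI[of _ S]) simp
qed

theorem coherent_descended: "coherent_subsheaf sc Gr descended"
  unfolding coherent_subsheaf_def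
proof (intro conjI ballI)
  show "module_subsheaf sc Gr descended" by (rule descended_subsheaf)
  fix p assume "p \<in> topspace (opens Gr)"
  then obtain \<sigma> :: "'r \<Rightarrow> 'n" where p: "p \<in> crt \<sigma>" using topspace_Gr by blast
  obtain S0 where S0_gen: "S0 \<subseteq> N \<and> finite S0 \<and> (\<forall>L. (\<lambda>A. 0) \<in> L \<and>
     (\<forall>s\<in>L. \<forall>t\<in>L. (\<lambda>A. s A + t A) \<in> L) \<and>
     (\<forall>f\<in>matrix_polys. \<forall>t\<in>L. (\<lambda>A. sc (f A) (t A)) \<in> L) \<and> S0 \<subseteq> L \<longrightarrow> N \<subseteq> L)"
    using N_finitely_generated by (rule exE)
  then have S0: "S0 \<subseteq> N" "finite S0" by simp_all
  note gen = S0_gen[THEN conjunct2, THEN conjunct2, rule_format, OF conjI[OF _ conjI[OF _ conjI]]]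
  define S where "S = (\<lambda>t. restrict_section (\<lambda>U. t (cm \<sigma> U)) (crt \<sigma>)) ` S0"
  have S_Nc: "S \<subseteq> Nc \<sigma>" unfolding S_def using S0(1) N_chart by blast
  have comb: "(\<lambda>U. t (cm \<sigma> U)) \<in> G.comb V S"
    if V: "openin (opens Gr) V" "V \<subseteq> crt \<sigma>" and t: "t \<in> N" for V t
  proof -
    \<comment> \<open>Being a combination of \<open>S\<close> over \<open>V\<close> is additive and
      stable under polynomial functions, which become regular functions after composing with
      \<open>cm \<sigma>\<close>; so it suffices to check the generators \<open>S0\<close>.\<close>
    let ?L = "{t. (\<lambda>U. t (cm \<sigma> U)) \<in> G.comb V S}"
    have "N \<subseteq> ?L"
    proof (rule gen)
      show "(\<lambda>A. 0) \<in> ?L" using G.comb_zero by simp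
      have "(\<lambda>A. s A + t A) \<in> ?L" if "s \<in> ?L" "t \<in> ?L" for s t
        using that G.comb_add[of "\<lambda>U. s (cm \<sigma> U)" V S "\<lambda>U. t (cm \<sigma> U)"] by simp
      then show "\<forall>s\<in>?L. \<forall>t\<in>?L. (\<lambda>A. s A + t A) \<in> ?L" by (intro ballI)
      have "(\<lambda>A. sc (f A) (t A)) \<in> ?L" if f: "f \<in> matrix_polys" and t: "t \<in> ?L" for f t
      proof -
        have "restrict_section (\<lambda>U. f (cm \<sigma> U)) (crt \<sigma>) \<in> reg_funs Gr (crt \<sigma>)"
          using reg_cpull[OF regular_UNIV[OF f], of \<sigma>] by (simp add: cpull_UNIV)
        then have "restrict_section (restrict_section (\<lambda>U. f (cm \<sigma> U)) (crt \<sigma>)) V \<in> reg_funs Gr V"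
          by (rule G.reg_restrict[OF openin_chart V])
        moreover have "(\<lambda>U. t (cm \<sigma> U)) \<in> G.comb V S" using t by simp
        ultimately have "(\<lambda>U. sc (restrict_section (restrict_section (\<lambda>U. f (cm \<sigma> U)) (crt \<sigma>)) V U) (t (cm \<sigma> U)))
            \<in> G.comb V S" by (rule G.comb_scale[OF V(1)])
        then have "(\<lambda>U. sc (f (cm \<sigma> U)) (t (cm \<sigma> U))) \<in> G.comb V S"
          by (rule G.comb_cong) (use V(2) in auto)
        then show ?thesis by simp
      qed
      then show "\<forall>f\<in>matrix_polys. \<forall>t\<in>?L. (\<lambda>A. sc (f A) (t A)) \<in> ?L" by (intro ballI)
      show "S0 \<subseteq> ?L"
      proof
        fix t assume "t \<in> S0"
        then have "restrict_section (\<lambda>U. t (cm \<sigma> U)) (crt \<sigma>) \<in> S" by (simp add: S_def)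
        from G.comb_base[OF V(1) this] have "(\<lambda>U. t (cm \<sigma> U)) \<in> G.comb V S"
          by (rule G.comb_cong) (use V(2) in auto)
        then show "t \<in> ?L" by simp
      qed
    qed
    then show ?thesis using t by blast
  qed
  have "descended W = generated_subsheaf sc Gr (\<lambda>_. S) W" if "openin (opens Gr) W" "W \<subseteq> crt \<sigma>" for W
    using generated_subset_descended[OF S_Nc that] descended_subset_generated[OF that(2) comb] by blast
  moreover have "S \<subseteq> descended (crt \<sigma>)" using S_Nc Nc_descended by blast
  moreover have "finite S" using S0(2) by (simp add: S_def)
  ultimately show "\<exists>U S. openin (opens Gr) U \<and> p \<in> U \<and> finite S \<and> S \<subseteq> descended U \<and>
      (\<forall>W. openin (opens Gr) W \<and> W \<subseteq> U \<longrightarrow> descended W = generated_subsheaf sc Gr (\<lambda>_. S) W)"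
    using openin_chart[of \<sigma>] p by (intro exI[of _ "crt \<sigma>"] exI[of _ S]) simp
qed

text \<open>One inclusion unfolds the definition of \<open>descended\<close>. The other is where
  equivariance enters: near \<open>A\<close> some minor is nonzero, and there \<open>t\<close> has
  to be rewritten through functions constant on the orbits.\<close>

theorem pullback_descended: "pullback_subsheaf x act descended = Nt"
proof -
  define P where "P = (\<lambda>W :: ('k, 'n, 'r) mat set.
    {t \<circ> \<pi> | t V. openin (opens Gr) V \<and> \<pi> ` W \<subseteq> V \<and> t \<in> descended V})"
  have pb: "pullback_subsheaf x act descended = generated_subsheaf sc Mats P"
    unfolding pullback_subsheaf_def P_def r_eq ..
  have P_sub: "module_subsheaf sc Mats (generated_subsheaf sc Mats P)"
  proof (rule Y.module_subsheaf_generated)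
    fix W W' :: "('k, 'n, 'r) mat set" assume "W' \<subseteq> W"
    show "P W \<subseteq> P W'"
    proof
      fix u assume "u \<in> P W"
      then obtain t V where t: "u = t \<circ> \<pi>" "openin (opens Gr) V" "\<pi> ` W \<subseteq> V" "t \<in> descended V"
        unfolding P_def by blast
      have "\<pi> ` W' \<subseteq> V" using t(3) \<open>W' \<subseteq> W\<close> by blast
      with t(2,4) show "u \<in> P W'" unfolding P_def t(1) by blast
    qed
  qed
  have "generated_subsheaf sc Mats P W \<subseteq> Nt W" for W
  proof (rule Y.generated_least[OF Nt_subsheaf])
    fix W' u assume W': "openin (opens Mats) W'" and "u \<in> P W'"
    then obtain t V where t: "u = t \<circ> \<pi>" "openin (opens Gr) V" "\<pi> ` W' \<subseteq> V" "t \<in> descended V"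
      unfolding P_def by blast
    have sub: "W' \<subseteq> reps V"
    proof
      fix A assume "A \<in> W'"
      then have "A \<in> full_rank" "\<pi> A \<in> V" using W' t(3) unfolding openin_Mo_iff by blast+
      then show "A \<in> reps V" by (simp add: representatives_iff)
    qed
    have "restrict_section (\<lambda>A. t (\<pi> A)) (reps V) \<in> Nt (reps V)" using t(4) by (simp add: descended_def)
    then have "restrict_section (restrict_section (\<lambda>A. t (\<pi> A)) (reps V)) W' \<in> Nt W'"
      by (rule Y.subsheaf_restrict[OF Nt_subsheaf openin_reps[OF t(2)] W' sub])
    also have "restrict_section (restrict_section (\<lambda>A. t (\<pi> A)) (reps V)) W' = restrict_section u W'"
      unfolding restrict_section_restrict using sub by (intro restrict_section_cong) (auto simp: t(1))
    finally show "restrict_section u W' \<in> Nt W'" .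
  qed
  moreover have "Nt W \<subseteq> generated_subsheaf sc Mats P W" for W
    unfolding Nt_def
  proof (rule Y.generated_least[OF P_sub])
    fix W t assume W: "openin (opens Mats) W" and t: "t \<in> N"
    have t_tensor: "t \<in> tensor_functions sc matrix_polys" using N_tensor t by blast
    have "\<exists>V. openin (opens Mats) V \<and> A \<in> V \<and> V \<subseteq> W \<and> restrict_section t W \<in> Y.comb V (P V)" if A: "A \<in> W" for A
    proof -
      have "A \<in> full_rank" using W A unfolding openin_Mo_iff by blast
      then obtain \<sigma> :: "'r \<Rightarrow> 'n" where \<sigma>: "minor \<sigma> A \<noteq> 0" using full_rank_ex_minor by blast
      define V where "V = W \<inter> {A. minor \<sigma> A \<noteq> 0}"
      have V: "openin (opens Mats) V"
        using W openin_zariski_nonzero[OF matrix_polys_minor, of \<sigma>] by (auto simp: openin_Mo_iff V_def)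
      have "module.subspace VF.cscale N"
      proof -
        interpret C: vector_functions "VF.cscale :: 'k \<Rightarrow> (('k, 'n, 'r) mat \<Rightarrow> 'm) \<Rightarrow> _"
          by (rule VF.vector_functions_cscale)
        show ?thesis
          by (rule C.subspaceI)
            (use N_zero N_add N_scale[OF matrix_polys.const] in \<open>auto simp: VF.cscale_def plus_fun_def zero_fun_def\<close>)
      qed
      from VF.equivariant_expansion[OF t_tensor this N_equivariant[OF t]]
      obtain ps where ps: "\<forall>q\<in>set ps. fst q \<in> (matrix_polys :: (('k, 'r, 'r) mat \<Rightarrow> 'k) set) \<and> snd q \<in> N"
        "\<forall>g B. invertible g \<longrightarrow> t (B ** g) = (\<Sum>q\<leftarrow>ps. sc (fst q g) (snd q B))" by blast
      \<comment> \<open>\<open>u q\<close> carries the right factor along the chart section, so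
        \<open>u q \<circ> \<pi>\<close> has the value \<open>snd q (col_reduce \<sigma> B)\<close>
        at \<open>B\<close> in \<open>V\<close>; the left factor, evaluated at
        \<open>submat \<sigma> B\<close>, is a regular coefficient on \<open>V\<close>.\<close>
      define u where "u q = restrict_section (\<lambda>U. snd q (cm \<sigma> U)) (crt \<sigma>)" for q :: "(('k, 'r, 'r) mat \<Rightarrow> 'k) \<times> (('k, 'n, 'r) mat \<Rightarrow> 'm)"
      define v where "v q B = sc (restrict_section (\<lambda>B. fst q (submat \<sigma> B)) V B) ((u q \<circ> \<pi>) B)"
        for q :: "(('k, 'r, 'r) mat \<Rightarrow> 'k) \<times> (('k, 'n, 'r) mat \<Rightarrow> 'm)" and B
      have v: "v q \<in> Y.comb V (P V)" if q: "q \<in> set ps" for q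
      proof -
        have "fst q \<in> matrix_polys" using ps(1) q by blast
        then have "(\<lambda>B. fst q (submat \<sigma> B)) \<in> matrix_polys"
          by (rule matrix_polys_compose) (simp add: matrix_polys.coord)
        note reg = reg_poly_Mats[OF V this]
        have "u q \<in> descended (crt \<sigma>)" unfolding u_def using ps(1) q by (intro Nc_descended N_chart) auto
        moreover have "\<pi> ` V \<subseteq> crt \<sigma>" using column_span_in_chart by (auto simp: V_def)
        ultimately have "u q \<circ> \<pi> \<in> P V" unfolding P_def using openin_chart by blast
        then have "u q \<circ> \<pi> \<in> Y.comb V (P V)" by (rule Y.comb_base[OF V])
        from Y.comb_scale[OF V reg this] show ?thesis unfolding v_def[abs_def] .
      qed
      have "(\<lambda>B. \<Sum>q\<leftarrow>ps. v q B) \<in> Y.comb V (P V)"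
        using v by (rule Y.comb_sum_list)
      moreover have "restrict_section t W B = (\<Sum>q\<leftarrow>ps. v q B)" if B: "B \<in> V" for B
      proof -
        have m: "minor \<sigma> B \<noteq> 0" and BW: "B \<in> W" using B by (auto simp: V_def)
        have "t B = t (col_reduce \<sigma> B ** submat \<sigma> B)" by (simp add: col_reduce_mult_submat[OF m])
        also have "\<dots> = (\<Sum>q\<leftarrow>ps. sc (fst q (submat \<sigma> B)) (snd q (col_reduce \<sigma> B)))"
          using ps(2) m by (simp add: minor_neq_0_iff)
        also have "\<dots> = (\<Sum>q\<leftarrow>ps. v q B)"
          using B by (simp add: v_def u_def column_span_in_chart[OF m] chart_matrix_column_span[OF m])
        finally show ?thesis using BW by simp
      qed
      ultimately have "restrict_section t W \<in> Y.comb V (P V)" by (rule Y.comb_cong)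
      moreover have "A \<in> V" using A \<sigma> by (simp add: V_def)
      ultimately show ?thesis using V by (intro exI[of _ V]) (auto simp: V_def)
    qed
    with free_poly_Mats[OF W t_tensor] show "restrict_section t W \<in> generated_subsheaf sc Mats P W"
      unfolding Y.generated_iff by blast
  qed
  ultimately show ?thesis unfolding pb by (intro ext subset_antisym)
qed

theorem descends_to_descended: "descends_to x act N descended"
  unfolding descends_to_def r_eq[symmetric] using coherent_descended pullback_descended by blast

theorem descends_to_unique:
  assumes "descends_to x act N F"
  shows "F = descended"
proof -
  have F: "module_subsheaf sc Gr F" and pb: "pullback_subsheaf x act F = Nt"
    using assms unfolding descends_to_def coherent_subsheaf_def r_eq[symmetric] by blast+
  have "F W = descended W" for W
  proof (cases "openin (opens Gr) W")
    case True
    then show ?thesis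
      using subsheaf_iff_pullback[OF F True] unfolding pb descended_def by blast
  next
    case False
    then show ?thesis
      using G.subsheaf_free[OF F] G.subsheaf_free[OF descended_subsheaf] G.free_sheafD(1) by blast
  qed
  then show ?thesis by blast
qed

theorem chart_modules_descend:
  "\<exists>!F. has_chart_modules x act Nc F" "\<exists>!F. descends_to x act N F"
  "(THE F. has_chart_modules x act Nc F) = \<R> x act N"
proof -
  show 1: "\<exists>!F. has_chart_modules x act Nc F"
    using has_chart_modules_descended has_chart_modules_unique by (rule ex1I)
  show 2: "\<exists>!F. descends_to x act N F"
    using descends_to_descended descends_to_unique by (rule ex1I)
  have "(THE F. has_chart_modules x act Nc F) = descended"
    using has_chart_modules_descended has_chart_modules_unique by (rule the_equality)
  moreover have "\<R> x act N = descended"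
    unfolding \<R>_def using descends_to_descended descends_to_unique by (rule the_equality)
  ultimately show "(THE F. has_chart_modules x act Nc F) = \<R> x act N" by simp
qed

end

section \<open>Kernels\<close>

lemma matrix_polys_mult_right:
  fixes g :: "'k::field^'r^'r"
  shows "(\<lambda>A::('k, 'n::finite, 'r) mat. (A ** g) $ i $ j) \<in> matrix_polys"
proof -
  have "(\<lambda>A::('k, 'n, 'r) mat. \<Sum>k\<in>UNIV. A $ i $ k * g $ k $ j) \<in> matrix_polys"
    by (intro matrix_polys_sum finite matrix_polys.mult matrix_polys.coord matrix_polys.const)
  then show ?thesis by (simp add: matrix_matrix_mult_def)
qed

context grassmannian_module
begin

section \<open>Words in the operators and their behaviour under change of columns\<close>

lemma act_scale: "act a (sc c m) = sc c (act a m)"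
  by (simp add: kscale_def mult.commute)

text \<open>At a matrix \<open>A\<close> the operator \<open>theta_global x act j\<close> is the
  action of this element of the group algebra, and likewise \<open>theta_chart\<close> at the chart
  matrix. Operator words thus become products in a commutative ring acting pointwise.\<close>

definition column_elt :: "('k, 'n, 'r) mat \<Rightarrow> 'r \<Rightarrow> ('e \<Rightarrow>\<^sub>0 'k)" where
  "column_elt A j = (\<Sum>i\<in>UNIV. kscale (*) (A $ i $ j) (x i))"

definition word_elt :: "('k, 'n, 'r) mat \<Rightarrow> 'r list \<Rightarrow> ('e \<Rightarrow>\<^sub>0 'k)" where
  "word_elt A js = prod_list (map (column_elt A) js)"

lemma word_elt_simps: "word_elt A [] = 1" "word_elt A (j # js) = column_elt A j * word_elt A js"
  by (simp_all add: word_elt_def)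

lemma act_column_elt: "act (column_elt A j) m = (\<Sum>i\<in>UNIV. sc (A $ i $ j) (act (x i) m))"
  by (simp add: column_elt_def kscale_def M.scale_sum_left)

lemma word_op_global: "word_op (theta_global x act) js s A = act (word_elt A js) (s A)"
proof (induction js)
  case (Cons j js)
  have "word_op (theta_global x act) (j # js) s A = act (column_elt A j) (word_op (theta_global x act) js s A)"
    by (simp add: word_op_def theta_global_def theta_def act_column_elt)
  then show ?case by (simp add: Cons word_elt_simps)
qed (simp add: word_op_def word_elt_simps)

lemma word_op_chart: "word_op (theta_chart x act \<sigma>) js s U = act (word_elt (cm \<sigma> U) js) (s U)"
proof (induction js)
  case (Cons j js)
  have "word_op (theta_chart x act \<sigma>) (j # js) s U = act (column_elt (cm \<sigma> U) j) (word_op (theta_chart x act \<sigma>) js s U)"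
    by (simp add: word_op_def theta_chart_def theta_def act_column_elt)
  then show ?case by (simp add: Cons word_elt_simps)
qed (simp add: word_op_def word_elt_simps)

text \<open>For words of equal length, the coefficient of the word \<open>ls\<close> in the columns
  of \<open>A\<close> when the word \<open>js\<close> in the columns of \<open>A ** g\<close> is
  multiplied out.\<close>

definition word_coef :: "('k, 'r, 'r) mat \<Rightarrow> 'r list \<Rightarrow> 'r list \<Rightarrow> 'k" where
  "word_coef g ls js = (\<Prod>q\<leftarrow>zip ls js. g $ fst q $ snd q)"

lemma column_elt_mult: "column_elt (A ** g) j = (\<Sum>l\<in>UNIV. kscale (*) (g $ l $ j) (column_elt A l))"
proof -
  have "column_elt (A ** g) j = (\<Sum>i\<in>UNIV. \<Sum>l\<in>UNIV. kscale (*) (g $ l $ j * A $ i $ l) (x i))"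
    by (simp add: column_elt_def matrix_matrix_mult_def kE.scale_sum_left mult.commute)
  then show ?thesis
    by (subst (asm) sum.swap) (simp add: column_elt_def kE.scale_sum_right)
qed

lemma sum_lists_Suc:
  fixes f :: "'r list \<Rightarrow> 'z::comm_monoid_add"
  shows "(\<Sum>ls | length ls = Suc n. f ls) = (\<Sum>l\<in>UNIV. \<Sum>ls | length ls = n. f (l # ls))"
proof -
  have "{ls :: 'r list. length ls = Suc n} = (\<lambda>(l, ls). l # ls) ` (UNIV \<times> {ls. length ls = n})"
    by (auto simp: length_Suc_conv image_def)
  moreover have "inj_on (\<lambda>(l, ls). l # ls) (UNIV \<times> {ls :: 'r list. length ls = n})"
    by (auto simp: inj_on_def)
  ultimately have "(\<Sum>ls | length ls = Suc n. f ls) =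
      (\<Sum>q\<in>UNIV \<times> {ls. length ls = n}. f (case q of (l, ls) \<Rightarrow> l # ls))"
    by (simp only: sum.reindex o_def)
  also have "\<dots> = (\<Sum>(l, ls)\<in>UNIV \<times> {ls. length ls = n}. f (l # ls))"
    by (rule sum.cong) auto
  finally show ?thesis by (simp add: sum.cartesian_product)
qed

text \<open>Multilinear expansion of a product. Summing over words instead of commutative monomials
  avoids multinomial coefficients.\<close>

lemma word_elt_mult: "word_elt (A ** g) js = (\<Sum>ls | length ls = length js. kscale (*) (word_coef g ls js) (word_elt A ls))"
proof (induction js)
  case Nil
  have "{ls :: 'r list. length ls = 0} = {[]}" by auto
  then show ?case by (simp add: word_coef_def word_elt_simps kscale_def)
next
  case (Cons j js)
  have mult: "kscale (*) a v * kscale (*) b w = kscale (*) (a * b) (v * w)" for a b :: 'k and v w :: "'e \<Rightarrow>\<^sub>0 'k"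
  proof -
    have "Poly_Mapping.single (0::'e) (a * b) = Poly_Mapping.single 0 a * Poly_Mapping.single 0 b"
      by (simp add: mult_single)
    then show ?thesis by (simp add: kscale_def ac_simps)
  qed
  have "word_elt (A ** g) (j # js) = (\<Sum>l\<in>UNIV. \<Sum>ls | length ls = length js.
      kscale (*) (g $ l $ j * word_coef g ls js) (column_elt A l * word_elt A ls))"
    by (simp add: word_elt_simps column_elt_mult Cons sum_product mult)
  also have "\<dots> = (\<Sum>ls | length ls = Suc (length js). kscale (*) (word_coef g ls (j # js)) (word_elt A ls))"
    by (simp add: sum_lists_Suc word_coef_def word_elt_simps)
  finally show ?case by simp
qed

lemma act_word_elt_mult:
  "act (word_elt (A ** g) js) m = (\<Sum>ls | length ls = length js. sc (word_coef g ls js) (act (word_elt A ls) m))"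
proof -
  have "act (kscale (*) c v) m = sc c (act v m)" for c v by (simp add: kscale_def)
  then show ?thesis by (simp add: word_elt_mult M.scale_sum_left)
qed

text \<open>Interchanging the sums moves the coefficients from the operators to the arguments, so a
  sum of images at \<open>A ** g\<close> is a sum of images at \<open>A\<close>. This serves both
  translation and the change to the chart matrix.\<close>

lemma sum_act_word_elt_mult:
  "(\<Sum>js | length js = l. act (word_elt (A ** g) js) (m js)) =
   (\<Sum>ls | length ls = l. act (word_elt A ls) (\<Sum>js | length js = l. sc (word_coef g ls js) (m js)))"
proof -
  have "(\<Sum>js | length js = l. act (word_elt (A ** g) js) (m js)) =
      (\<Sum>js | length js = l. \<Sum>ls | length ls = l. sc (word_coef g ls js) (act (word_elt A ls) (m js)))"
    by (rule sum.cong) (simp_all add: act_word_elt_mult)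
  also have "\<dots> = (\<Sum>ls | length ls = l. \<Sum>js | length js = l. sc (word_coef g ls js) (act (word_elt A ls) (m js)))"
    by (rule sum.swap)
  finally show ?thesis by (simp add: M.scale_sum_right act_scale)
qed

lemma finite_words: "finite {js :: 'r list. length js = l}"
  using finite_lists_length_eq[of "UNIV :: 'r set" l] by simp

definition killed :: "nat \<Rightarrow> ('k, 'n, 'r) mat \<Rightarrow> 'm \<Rightarrow> bool" where
  "killed l A m \<longleftrightarrow> (\<forall>js. length js = l \<longrightarrow> act (word_elt A js) m = 0)"

lemma killed_mult: "killed l A m \<Longrightarrow> killed l (A ** g) m"
  by (simp add: killed_def act_word_elt_mult)

lemma killed_zero: "killed l A 0"
  by (simp add: killed_def)

lemma killed_add: "killed l A m \<Longrightarrow> killed l A m' \<Longrightarrow> killed l A (m + m')"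
  by (simp add: killed_def M.scale_right_distrib)

lemma killed_scale: "killed l A m \<Longrightarrow> killed l A (sc c m)"
  by (simp add: killed_def act_scale)

lemma killed_col_reduce:
  assumes "minor \<sigma> A \<noteq> 0" "killed l (col_reduce \<sigma> A) m"
  shows "killed l A m"
  using killed_mult[OF assms(2), of "submat \<sigma> A"] by (simp add: col_reduce_mult_submat[OF assms(1)])

abbreviation KerM :: "nat \<Rightarrow> (('k, 'n, 'r) mat \<Rightarrow> 'm) set" where
  "KerM l \<equiv> Ker_module x act l"

lemma Ker_module_iff:
  "s \<in> KerM l \<longleftrightarrow> s \<in> tensor_functions sc matrix_polys \<and> (\<forall>A. killed l A (s A))"
  by (auto simp: Ker_module_def common_kernel_def fun_eq_iff word_op_global killed_def)

lemma Ker_chart_iff: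
  "s \<in> Ker_chart x act l \<sigma> \<longleftrightarrow> s \<in> free_sheaf sc Gr (crt \<sigma>) \<and> (\<forall>U. killed l (cm \<sigma> U) (s U))"
  by (auto simp: Ker_chart_def common_kernel_def fun_eq_iff word_op_chart killed_def r_eq)

lemma comb_fraction:
  assumes W: "openin (opens Mats) W" and h: "h \<in> matrix_polys" "\<And>B. B \<in> W \<Longrightarrow> h B \<noteq> 0"
    and G: "G \<in> S" "\<And>B. B \<in> W \<Longrightarrow> sc (h B) (s B) = G B"
  shows "s \<in> Y.comb W S"
proof -
  have "restrict_section (\<lambda>A. 1 / h A) W \<in> reg_funs Mats W"
    using regular_fraction[OF _ matrix_polys.const[of 1] h(1), of W] W h(2)
    by (simp add: openin_Mo_iff) (simp add: Mo_def)
  from Y.comb_scale[OF W this Y.comb_base[OF W G(1)]] show ?thesis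
    by (rule Y.comb_cong) (use G(2)[symmetric] h(2) in simp)
qed

text \<open>The chart kernel is a pointwise condition at \<open>cm \<sigma> (\<pi> A)\<close>, which
  differs from \<open>A\<close> by an invertible factor, so the pull-back is killed at every
  \<open>A\<close> over the chart. It remains to write it locally as a fraction whose numerator is a
  polynomial element of the kernel.\<close>

lemma Ker_pullback:
  assumes t: "t \<in> Ker_chart x act l \<sigma>"
  shows "restrict_section (\<lambda>A. t (\<pi> A)) (reps (crt \<sigma>)) \<in> restriction_to_Mo act (KerM l) (reps (crt \<sigma>))"
proof -
  let ?s = "restrict_section (\<lambda>A. t (\<pi> A)) (reps (crt \<sigma>))"
  have free: "?s \<in> free_sheaf sc Mats (reps (crt \<sigma>))"
    using t by (intro free_pullback) (simp add: Ker_chart_iff)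
  have "\<exists>W. openin (opens Mats) W \<and> A \<in> W \<and> W \<subseteq> reps (crt \<sigma>) \<and> ?s \<in> Y.comb W (KerM l)"
    if A: "A \<in> reps (crt \<sigma>)" for A
  proof -
    have op: "openin zariski (reps (crt \<sigma>))"
      using openin_chart[of \<sigma>] by (simp add: openin_Gr_iff)
    have "?s \<in> tensor_functions sc (regular_functions (reps (crt \<sigma>)))"
      using Y.free_sheafD(2)[OF free] by (simp add: Mo_def)
    from Mk.tensor_regular_local[OF op this A]
    obtain G h where G: "G \<in> tensor_functions sc matrix_polys" and h: "h \<in> matrix_polys" "h A \<noteq> 0"
      and hG: "\<forall>B. h B \<noteq> 0 \<longrightarrow> B \<in> reps (crt \<sigma>) \<and> sc (h B) (?s B) = G B" by blast
    define W where "W = {B. h B \<noteq> 0}"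
    have W: "openin (opens Mats) W"
      unfolding openin_Mo_iff W_def using openin_zariski_nonzero[OF h(1)] hG by (auto simp: representatives_iff)
    \<comment> \<open>\<open>G\<close> is known to be killed only where \<open>h\<close> is nonzero.
      The extra factor \<open>h\<close> makes the product zero elsewhere, so it lies in the kernel
      at every matrix; the denominator becomes the square of \<open>h\<close>.\<close>
    have G': "(\<lambda>B. sc (h B) (G B)) \<in> KerM l"
      unfolding Ker_module_iff
    proof (intro conjI allI)
      show "(\<lambda>B. sc (h B) (G B)) \<in> tensor_functions sc matrix_polys"
        by (rule Mk.tensor_polys_scale[OF h(1) G])
      fix B
      show "killed l B (sc (h B) (G B))"
      proof (cases "h B = 0")
        case True
        then show ?thesis by (simp add: killed_zero)
      next
        case False
        then have B: "B \<in> reps (crt \<sigma>)" "sc (h B) (?s B) = G B" using hG by blast+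
        have m: "minor \<sigma> B \<noteq> 0" using B(1) by (simp add: reps_chart)
        have "killed l (cm \<sigma> (\<pi> B)) (t (\<pi> B))" using t by (simp add: Ker_chart_iff)
        then have "killed l B (t (\<pi> B))"
          unfolding chart_matrix_column_span[OF m] by (rule killed_col_reduce[OF m])
        then show ?thesis using B by (auto simp flip: B(2) intro!: killed_scale)
      qed
    qed
    have "?s \<in> Y.comb W (KerM l)"
      by (rule comb_fraction[OF W matrix_polys.mult[OF h(1) h(1)] _ G'])
        (use hG in \<open>auto simp: W_def simp flip: Mk.scale_scale\<close>)
    moreover have "W \<subseteq> reps (crt \<sigma>)" using hG by (auto simp: W_def)
    moreover have "A \<in> W" using h(2) by (simp add: W_def)
    ultimately show ?thesis using W by blast
  qed
  with free show ?thesis unfolding restriction_to_Mo_def Y.generated_iff by blast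
qed

theorem descent_Ker:
  assumes "\<exists>B. finite B \<and> Mk.span B = UNIV"
  shows "descent x act r (KerM l) (Ker_chart x act l)"
proof
  show "\<exists>B. finite B \<and> Mk.span B = UNIV" by fact
  show "KerM l \<subseteq> tensor_functions sc matrix_polys" by (auto simp: Ker_module_iff)
  show "(\<lambda>A. 0) \<in> KerM l" by (simp add: Ker_module_iff Mk.tensor_functions_zero killed_zero)
  show "(\<lambda>A. s A + t A) \<in> KerM l" if "s \<in> KerM l" "t \<in> KerM l" for s t
    using that by (simp add: Ker_module_iff Mk.tensor_functions_add killed_add)
  show "(\<lambda>A. sc (f A) (t A)) \<in> KerM l" if "f \<in> matrix_polys" "t \<in> KerM l" for f t
    using that by (simp add: Ker_module_iff Mk.tensor_polys_scale killed_scale)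
  show "(\<lambda>A. t (A ** g)) \<in> KerM l" if t: "t \<in> KerM l" and g: "invertible g" for t g
    unfolding Ker_module_iff
  proof (intro conjI allI)
    show "(\<lambda>A. t (A ** g)) \<in> tensor_functions sc matrix_polys"
      by (rule Mk.tensor_polys_compose[OF _ matrix_polys_mult_right]) (use t in \<open>simp add: Ker_module_iff\<close>)
    fix A
    have "killed l (A ** g) (t (A ** g))" using t by (simp add: Ker_module_iff)
    \<comment> \<open>\<open>killed\<close> passes to right multiples, and \<open>A\<close> is a
      right multiple of \<open>A ** g\<close> because \<open>g\<close> is invertible.\<close>
    from killed_mult[OF this, of "matrix_inv g"] show "killed l A (t (A ** g))"
      by (simp add: matrix_inv_right[OF g] flip: matrix_mul_assoc)
  qed
  show "restrict_section (\<lambda>U. t (cm \<sigma> U)) (crt \<sigma>) \<in> Ker_chart x act l \<sigma>" if "t \<in> KerM l" for t \<sigma>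
    using that free_chart[of t \<sigma>] by (simp add: Ker_module_iff Ker_chart_iff restrict_section_def killed_zero)
  show "t \<in> free_sheaf sc Gr (crt \<sigma>)" if "t \<in> Ker_chart x act l \<sigma>" for t \<sigma>
    using that by (simp add: Ker_chart_iff)
qed (rule Ker_pullback)

end

section \<open>Images\<close>

context grassmannian_module
begin

abbreviation ImM :: "nat \<Rightarrow> (('k, 'n, 'r) mat \<Rightarrow> 'm) set" where
  "ImM l \<equiv> Im_module x act l"

abbreviation tensor_polys :: "(('k, 'n, 'r) mat \<Rightarrow> 'm) set" where
  "tensor_polys \<equiv> tensor_functions sc matrix_polys"

lemma Im_module_iff:
  "s \<in> ImM l \<longleftrightarrow> (\<exists>t. (\<forall>js. length js = l \<longrightarrow> t js \<in> tensor_polys) \<and>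
     s = (\<lambda>A. \<Sum>js | length js = l. act (word_elt A js) (t js A)))"
proof -
  have "word_op (theta_global x act) js (t js) A = act (word_elt A js) (t js A)" for js A and t :: "'r list \<Rightarrow> ('k, 'n, 'r) mat \<Rightarrow> 'm"
    by (rule word_op_global)
  then show ?thesis unfolding Im_module_def sum_of_images_def by auto
qed

lemma Im_chart_iff:
  "s \<in> Im_chart x act l \<sigma> \<longleftrightarrow> (\<exists>t. (\<forall>js. length js = l \<longrightarrow> t js \<in> free_sheaf sc Gr (crt \<sigma>)) \<and>
     s = (\<lambda>U. \<Sum>js | length js = l. act (word_elt (cm \<sigma> U) js) (t js U)))"
proof -
  have "word_op (theta_chart x act \<sigma>) js (t js) U = act (word_elt (cm \<sigma> U) js) (t js U)"
    for js U and t :: "'r list \<Rightarrow> ('e \<Rightarrow>\<^sub>0 'k) set \<Rightarrow> 'm"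
    by (rule word_op_chart)
  then show ?thesis unfolding Im_chart_def sum_of_images_def r_eq by auto
qed

lemma Im_moduleI:
  "(\<And>js. length js = l \<Longrightarrow> t js \<in> tensor_polys) \<Longrightarrow> s = (\<lambda>A. \<Sum>js | length js = l. act (word_elt A js) (t js A)) \<Longrightarrow> s \<in> ImM l"
  unfolding Im_module_iff by blast

text \<open>The map \<open>M\<close> to matrices is arbitrary, so that the identity on matrices and
  \<open>cm \<sigma>\<close> on a chart are both covered. The action of the group algebra is moved
  onto the constant vectors, leaving entries of \<open>M\<close> as coefficients.\<close>

lemma tensor_act_column_elt:
  assumes s: "s \<in> tensor_functions sc \<A>" and mult: "\<And>f i. f \<in> \<A> \<Longrightarrow> (\<lambda>p. M p $ i $ j * f p) \<in> \<A>"
  shows "(\<lambda>p. act (column_elt (M p) j) (s p)) \<in> tensor_functions sc \<A>"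
proof -
  obtain N f m where f: "\<forall>k<(N::nat). f k \<in> \<A>" and s: "s = (\<lambda>p. \<Sum>k<N. sc (f k p) (m k))"
    using s unfolding Mk.tensor_functions_iff by blast
  have "(\<lambda>p. \<Sum>i\<in>UNIV. \<Sum>k<N. sc (M p $ i $ j * f k p) (act (x i) (m k))) \<in> tensor_functions sc \<A>"
  proof (rule Mk.tensor_functions_sum)
    fix i :: 'n
    show "(\<lambda>p. \<Sum>k<N. sc (M p $ i $ j * f k p) (act (x i) (m k))) \<in> tensor_functions sc \<A>"
      by (rule Mk.tensor_functionsI[where f = "\<lambda>k p. M p $ i $ j * f k p" and m = "\<lambda>k. act (x i) (m k)"])
        (use mult f in simp)
  qed simp
  also have "(\<lambda>p. \<Sum>i\<in>UNIV. \<Sum>k<N. sc (M p $ i $ j * f k p) (act (x i) (m k))) = (\<lambda>p. act (column_elt (M p) j) (s p))"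
    by (rule ext, subst sum.swap)
      (simp add: act_column_elt s M.scale_sum_right act_scale Mk.scale_sum_right mult.commute)
  finally show ?thesis .
qed

lemma tensor_act_word_elt:
  assumes s: "s \<in> tensor_functions sc \<A>" and mult: "\<And>f i j. f \<in> \<A> \<Longrightarrow> (\<lambda>p. M p $ i $ j * f p) \<in> \<A>"
  shows "(\<lambda>p. act (word_elt (M p) js) (s p)) \<in> tensor_functions sc \<A>"
proof (induction js)
  case Nil
  then show ?case using s by (simp add: word_elt_simps)
next
  case (Cons j js)
  from tensor_act_column_elt[OF Cons mult, of j] show ?case by (simp add: word_elt_simps)
qed

lemma tensor_polys_act_word_elt: "s \<in> tensor_polys \<Longrightarrow> (\<lambda>A. act (word_elt A js) (s A)) \<in> tensor_polys"
  by (rule tensor_act_word_elt[where M = "\<lambda>A. A"]) (auto intro: matrix_polys.mult matrix_polys.coord)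

lemma free_act_word_elt:
  assumes s: "s \<in> free_sheaf sc Gr (crt \<sigma>)"
  shows "(\<lambda>U. act (word_elt (cm \<sigma> U) js) (s U)) \<in> free_sheaf sc Gr (crt \<sigma>)"
proof (rule G.free_sheafI[OF openin_chart])
  have mult: "(\<lambda>U. cm \<sigma> U $ i $ j * f U) \<in> reg_funs Gr (crt \<sigma>)" if f: "f \<in> reg_funs Gr (crt \<sigma>)" for f i j
  proof -
    have "restrict_section (\<lambda>U. cm \<sigma> U $ i $ j) (crt \<sigma>) \<in> reg_funs Gr (crt \<sigma>)"
      using reg_cpull[OF regular_UNIV[OF matrix_polys.coord[of i j]], of \<sigma>] by (simp add: cpull_UNIV)
    from G.reg_mult[OF openin_chart this f]
    have "(\<lambda>U. restrict_section (\<lambda>U. cm \<sigma> U $ i $ j) (crt \<sigma>) U * f U) \<in> reg_funs Gr (crt \<sigma>)" .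
    also have "(\<lambda>U. restrict_section (\<lambda>U. cm \<sigma> U $ i $ j) (crt \<sigma>) U * f U) = (\<lambda>U. cm \<sigma> U $ i $ j * f U)"
      using G.reg_outside[OF f] by (auto simp: fun_eq_iff restrict_section_def)
    finally show ?thesis .
  qed
  show "(\<lambda>U. act (word_elt (cm \<sigma> U) js) (s U)) \<in> tensor_functions sc (reg_funs Gr (crt \<sigma>))"
    by (rule tensor_act_word_elt[OF G.free_sheafD(2)[OF s] mult])
qed

lemma Im_chart_free:
  assumes "s \<in> Im_chart x act l \<sigma>"
  shows "s \<in> free_sheaf sc Gr (crt \<sigma>)"
proof -
  obtain t where t: "\<forall>js. length js = l \<longrightarrow> t js \<in> free_sheaf sc Gr (crt \<sigma>)"
    and s: "s = (\<lambda>U. \<Sum>js | length js = l. act (word_elt (cm \<sigma> U) js) (t js U))"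
    using assms unfolding Im_chart_iff by blast
  have "(\<lambda>U. \<Sum>js | length js = l. act (word_elt (cm \<sigma> U) js) (t js U)) \<in> tensor_functions sc (reg_funs Gr (crt \<sigma>))"
  proof (rule Mk.tensor_functions_sum[OF finite_words])
    fix js :: "'r list" assume "js \<in> {js. length js = l}"
    then have "t js \<in> free_sheaf sc Gr (crt \<sigma>)" using t by simp
    then show "(\<lambda>U. act (word_elt (cm \<sigma> U) js) (t js U)) \<in> tensor_functions sc (reg_funs Gr (crt \<sigma>))"
      by (rule G.free_sheafD(2)[OF free_act_word_elt])
  qed
  then show ?thesis unfolding s by (rule G.free_sheafI[OF openin_chart])
qed

text \<open>By linearity it is enough to treat constant vectors: the word \<open>ls\<close> applied
  to a constant \<open>m\<close> is a global element of \<open>ImM l\<close>, and the regular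
  coefficients of \<open>v\<close> come outside.\<close>

lemma comb_act_word_elt:
  assumes W: "openin (opens Mats) W" and v: "v \<in> free_sheaf sc Mats W" and ls: "length ls = l"
  shows "(\<lambda>A. act (word_elt A ls) (v A)) \<in> Y.comb W (ImM l)"
proof -
  obtain N f m where f: "\<forall>k<(N::nat). f k \<in> reg_funs Mats W" and v: "v = (\<lambda>p. \<Sum>k<N. sc (f k p) (m k))"
    using Y.free_sheafD(2)[OF v] unfolding Mk.tensor_functions_iff by blast
  have gen: "(\<lambda>A. act (word_elt A ls) m) \<in> ImM l" for m
  proof (rule Im_moduleI[of _ "\<lambda>js A. if js = ls then m else 0"])
    fix js :: "'r list"
    show "(\<lambda>A. if js = ls then m else 0) \<in> tensor_polys"
      using Mk.tensor_functions_pure[OF matrix_polys.const[of 1], of m] Mk.tensor_functions_zero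
      by (cases "js = ls") simp_all
  next
    have "(\<Sum>js | length js = l. act (word_elt A js) (if js = ls then m else 0)) =
        (\<Sum>js | length js = l. if js = ls then act (word_elt A js) m else 0)" for A
      by (rule sum.cong) auto
    then show "(\<lambda>A. act (word_elt A ls) m) = (\<lambda>A. \<Sum>js | length js = l. act (word_elt A js) (if js = ls then m else 0))"
      using ls by (simp add: finite_words)
  qed
  have "(\<lambda>A. \<Sum>k<N. sc (f k A) (act (word_elt A ls) (m k))) \<in> Y.comb W (ImM l)"
  proof (rule Y.comb_sum)
    fix k assume "k \<in> {..<N}"
    then have "f k \<in> reg_funs Mats W" using f by simp
    then show "(\<lambda>A. sc (f k A) (act (word_elt A ls) (m k))) \<in> Y.comb W (ImM l)"
      by (rule Y.comb_scale[OF W _ Y.comb_base[OF W gen]])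
  qed simp
  then show ?thesis by (simp add: v M.scale_sum_right act_scale)
qed

lemma reg_matrix_inv:
  "restrict_section (\<lambda>A. matrix_inv (submat \<sigma> A) $ i $ j) (reps (crt \<sigma>)) \<in> reg_funs Mats (reps (crt \<sigma>))"
proof -
  have "(\<lambda>A. adjugate (submat \<sigma> A) $ i $ j) \<in> matrix_polys"
    by (rule matrix_polys_adjugate) (simp add: matrix_polys.coord)
  then have "restrict_section (\<lambda>A. adjugate (submat \<sigma> A) $ i $ j / minor \<sigma> A) (reps (crt \<sigma>)) \<in> regular_functions (reps (crt \<sigma>))"
  proof (rule regular_fraction[rotated])
    show "openin zariski (reps (crt \<sigma>))" using openin_chart[of \<sigma>] unfolding openin_Gr_iff by (rule conjunct2)
    show "minor \<sigma> \<in> matrix_polys" by (rule matrix_polys_minor)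
    show "minor \<sigma> A \<noteq> 0" if "A \<in> reps (crt \<sigma>)" for A using that unfolding reps_chart by simp
  qed
  also have "restrict_section (\<lambda>A. adjugate (submat \<sigma> A) $ i $ j / minor \<sigma> A) (reps (crt \<sigma>)) =
      restrict_section (\<lambda>A. matrix_inv (submat \<sigma> A) $ i $ j) (reps (crt \<sigma>))"
    by (rule restrict_section_cong) (simp_all add: reps_chart minor_neq_0_iff matrix_inv_adjugate, simp add: minor_def)
  finally show ?thesis by (simp add: Mo_def)
qed

lemma reg_word_coef:
  "restrict_section (\<lambda>A. word_coef (matrix_inv (submat \<sigma> A)) ls js) (reps (crt \<sigma>)) \<in> reg_funs Mats (reps (crt \<sigma>))"
proof -
  let ?W = "reps (crt \<sigma>)"
  have W: "openin (opens Mats) ?W" by (rule openin_reps[OF openin_chart])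
  have "restrict_section (\<lambda>A. \<Prod>q\<leftarrow>qs. matrix_inv (submat \<sigma> A) $ fst q $ snd q) ?W \<in> reg_funs Mats ?W" for qs
  proof (induction qs)
    case Nil
    show ?case using Y.reg_const[OF W, of 1] by (simp add: restrict_section_def)
  next
    case (Cons q qs)
    have "restrict_section (\<lambda>A. \<Prod>q\<leftarrow>q # qs. matrix_inv (submat \<sigma> A) $ fst q $ snd q) ?W =
      (\<lambda>A. restrict_section (\<lambda>A. matrix_inv (submat \<sigma> A) $ fst q $ snd q) ?W A *
        restrict_section (\<lambda>A. \<Prod>q\<leftarrow>qs. matrix_inv (submat \<sigma> A) $ fst q $ snd q) ?W A)"
      by (simp add: restrict_section_def fun_eq_iff)
    then show ?case using Y.reg_mult[OF W reg_matrix_inv Cons] by simp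
  qed
  then show ?thesis by (simp add: word_coef_def)
qed

text \<open>The chart matrix of \<open>\<pi> A\<close> is \<open>A\<close> times the inverse of
  \<open>submat \<sigma> A\<close>. Expanding words in this product leaves words in \<open>A\<close>
  with coefficients regular over the whole chart, so a single expression is valid there.\<close>

lemma Im_pullback:
  assumes t: "t \<in> Im_chart x act l \<sigma>"
  shows "restrict_section (\<lambda>A. t (\<pi> A)) (reps (crt \<sigma>)) \<in> restriction_to_Mo act (ImM l) (reps (crt \<sigma>))"
proof -
  let ?W = "reps (crt \<sigma>)"
  have W: "openin (opens Mats) ?W" by (rule openin_reps[OF openin_chart])
  obtain u where u: "\<forall>js. length js = l \<longrightarrow> u js \<in> free_sheaf sc Gr (crt \<sigma>)"
    and t_eq: "t = (\<lambda>U. \<Sum>js | length js = l. act (word_elt (cm \<sigma> U) js) (u js U))"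
    using t unfolding Im_chart_iff by blast
  define v where "v ls A = (\<Sum>js | length js = l.
      sc (restrict_section (\<lambda>A. word_coef (matrix_inv (submat \<sigma> A)) ls js) ?W A)
        (restrict_section (\<lambda>A. u js (\<pi> A)) ?W A))" for ls A
  have v: "v ls \<in> free_sheaf sc Mats ?W" for ls
  proof (rule Y.free_sheafI[OF W])
    show "v ls \<in> tensor_functions sc (reg_funs Mats ?W)"
      unfolding v_def[abs_def]
    proof (rule Mk.tensor_functions_sum[OF finite_words])
      fix js :: "'r list" assume "js \<in> {js. length js = l}"
      then have "u js \<in> free_sheaf sc Gr (crt \<sigma>)" using u by simp
      from Y.free_sheafD(2)[OF Y.free_scale[OF reg_word_coef free_pullback[OF this]]]
      show "(\<lambda>A. sc (restrict_section (\<lambda>A. word_coef (matrix_inv (submat \<sigma> A)) ls js) ?W A)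
        (restrict_section (\<lambda>A. u js (\<pi> A)) ?W A)) \<in> tensor_functions sc (reg_funs Mats ?W)" .
    qed
  qed
  have "(\<lambda>A. \<Sum>ls | length ls = l. act (word_elt A ls) (v ls A)) \<in> Y.comb ?W (ImM l)"
    by (rule Y.comb_sum[OF finite_words]) (simp add: comb_act_word_elt[OF W v])
  moreover have "restrict_section (\<lambda>A. t (\<pi> A)) ?W A = (\<Sum>ls | length ls = l. act (word_elt A ls) (v ls A))"
    if A: "A \<in> ?W" for A
  proof -
    have m: "minor \<sigma> A \<noteq> 0" using A by (simp add: reps_chart)
    have "t (\<pi> A) = (\<Sum>js | length js = l. act (word_elt (A ** matrix_inv (submat \<sigma> A)) js) (u js (\<pi> A)))"
      by (simp add: t_eq chart_matrix_column_span[OF m] col_reduce_def)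
    also have "\<dots> = (\<Sum>ls | length ls = l. act (word_elt A ls) (v ls A))"
      unfolding sum_act_word_elt_mult using A by (simp add: v_def)
    finally show ?thesis using A by simp
  qed
  ultimately have "restrict_section (\<lambda>A. t (\<pi> A)) ?W \<in> Y.comb ?W (ImM l)" by (rule Y.comb_cong)
  with free_pullback[OF Im_chart_free[OF t]] show ?thesis
    unfolding restriction_to_Mo_def by (rule Y.generatedI)
qed

theorem descent_Im:
  assumes "\<exists>B. finite B \<and> Mk.span B = UNIV"
  shows "descent x act r (ImM l) (Im_chart x act l)"
proof
  show "\<exists>B. finite B \<and> Mk.span B = UNIV" by fact
  show "ImM l \<subseteq> tensor_polys"
  proof
    fix s assume "s \<in> ImM l"
    then obtain t where t: "\<forall>js. length js = l \<longrightarrow> t js \<in> tensor_polys"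
      and s: "s = (\<lambda>A. \<Sum>js | length js = l. act (word_elt A js) (t js A))" unfolding Im_module_iff by blast
    show "s \<in> tensor_polys"
      unfolding s by (rule Mk.tensor_functions_sum[OF finite_words]) (use t in \<open>simp add: tensor_polys_act_word_elt\<close>)
  qed
  show "(\<lambda>A. 0) \<in> ImM l"
    by (rule Im_moduleI[of _ "\<lambda>_ _. 0"]) (simp_all add: Mk.tensor_functions_zero)
next
  fix s t assume "s \<in> ImM l" and "t \<in> ImM l"
  obtain u where u: "\<forall>js. length js = l \<longrightarrow> u js \<in> tensor_polys"
    and s: "s = (\<lambda>A. \<Sum>js | length js = l. act (word_elt A js) (u js A))"
    using \<open>s \<in> ImM l\<close> unfolding Im_module_iff by blast
  obtain v where v: "\<forall>js. length js = l \<longrightarrow> v js \<in> tensor_polys"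
    and t: "t = (\<lambda>A. \<Sum>js | length js = l. act (word_elt A js) (v js A))"
    using \<open>t \<in> ImM l\<close> unfolding Im_module_iff by blast
  show "(\<lambda>A. s A + t A) \<in> ImM l"
    by (rule Im_moduleI[of _ "\<lambda>js A. u js A + v js A"])
      (use u v in \<open>simp_all add: Mk.tensor_functions_add s t M.scale_right_distrib sum.distrib\<close>)
next
  fix f :: "('k, 'n, 'r) mat \<Rightarrow> 'k" and t assume f: "f \<in> matrix_polys" and "t \<in> ImM l"
  obtain u where u: "\<forall>js. length js = l \<longrightarrow> u js \<in> tensor_polys"
    and t: "t = (\<lambda>A. \<Sum>js | length js = l. act (word_elt A js) (u js A))"
    using \<open>t \<in> ImM l\<close> unfolding Im_module_iff by blast
  show "(\<lambda>A. sc (f A) (t A)) \<in> ImM l"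
    by (rule Im_moduleI[of _ "\<lambda>js A. sc (f A) (u js A)"])
      (use u f in \<open>simp_all add: Mk.tensor_polys_scale t Mk.scale_sum_right act_scale\<close>)
next
  fix t and g :: "('k, 'r, 'r) mat" assume "t \<in> ImM l"
  obtain u where u: "\<forall>js. length js = l \<longrightarrow> u js \<in> tensor_polys"
    and t: "t = (\<lambda>A. \<Sum>js | length js = l. act (word_elt A js) (u js A))"
    using \<open>t \<in> ImM l\<close> unfolding Im_module_iff by blast
  show "(\<lambda>A. t (A ** g)) \<in> ImM l"
  \<comment> \<open>The arguments are read off from \<open>sum_act_word_elt_mult\<close>; the
    constants \<open>word_coef g ls js\<close> and the substitution of \<open>A ** g\<close> both
    preserve polynomial tensors.\<close>
  proof (rule Im_moduleI[of _ "\<lambda>ls A. \<Sum>js | length js = l. sc (word_coef g ls js) (u js (A ** g))"])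
    fix ls :: "'r list"
    show "(\<lambda>A. \<Sum>js | length js = l. sc (word_coef g ls js) (u js (A ** g))) \<in> tensor_polys"
    proof (rule Mk.tensor_functions_sum[OF finite_words])
      fix js :: "'r list" assume "js \<in> {js. length js = l}"
      then have "u js \<in> tensor_polys" using u by simp
      from Mk.tensor_polys_scale[OF matrix_polys.const Mk.tensor_polys_compose[OF this matrix_polys_mult_right]]
      show "(\<lambda>A. sc (word_coef g ls js) (u js (A ** g))) \<in> tensor_polys" .
    qed
  qed (simp add: t sum_act_word_elt_mult)
next
  fix t and \<sigma> :: "'r \<Rightarrow> 'n" assume "t \<in> ImM l"
  obtain u where u: "\<forall>js. length js = l \<longrightarrow> u js \<in> tensor_polys"
    and t: "t = (\<lambda>A. \<Sum>js | length js = l. act (word_elt A js) (u js A))"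
    using \<open>t \<in> ImM l\<close> unfolding Im_module_iff by blast
  have "restrict_section (\<lambda>U. t (cm \<sigma> U)) (crt \<sigma>) =
      (\<lambda>U. \<Sum>js | length js = l. act (word_elt (cm \<sigma> U) js) (restrict_section (\<lambda>U. u js (cm \<sigma> U)) (crt \<sigma>) U))"
    by (simp add: t restrict_section_def fun_eq_iff)
  moreover have "\<forall>js. length js = l \<longrightarrow> restrict_section (\<lambda>U. u js (cm \<sigma> U)) (crt \<sigma>) \<in> free_sheaf sc Gr (crt \<sigma>)"
    using u free_chart by blast
  ultimately show "restrict_section (\<lambda>U. t (cm \<sigma> U)) (crt \<sigma>) \<in> Im_chart x act l \<sigma>"
    unfolding Im_chart_iff
    by (intro exI[of _ "\<lambda>js. restrict_section (\<lambda>U. u js (cm \<sigma> U)) (crt \<sigma>)"]) simp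
qed (rule Im_chart_free Im_pullback; assumption)+

end

text \<open>\<open>Ker_sheaf\<close>, \<open>Im_sheaf\<close> and \<open>\<R>\<close> are defined by
  \<open>THE\<close>, so four statements of unique existence accompany the two equalities and give
  them content. Kernels and images are two instances of \<open>descent\<close>.\<close>

theorem theorem6p8:
  fixes x :: "'n::{finite,linorder} \<Rightarrow> ('e::{ab_group_add,finite} \<Rightarrow>\<^sub>0 'k::alg_closed_field)"
    and V :: "('e \<Rightarrow>\<^sub>0 'k) set"
    and act :: "('e \<Rightarrow>\<^sub>0 'k) \<Rightarrow> 'm::ab_group_add \<Rightarrow> 'm"
    and r :: "'r::{finite,linorder} itself"
    and p l :: nat
  assumes char_p: "p = CHAR('k)" "p > 0"
    and elementary_abelian: "\<And>g::'e. (\<Sum>i<p. g) = 0" "CARD('e) = p ^ CARD('n)"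
    and V: "radical_complement V x"
    and r_le_n: "CARD('r) \<le> CARD('n)"
    and M: "module act" "\<exists>B. finite B \<and> module.span (kscale act) B = UNIV"
    and l: "1 \<le> l" "l \<le> (p - 1) * CARD('r)"
  shows
    "(\<exists>!F. has_chart_modules x act (Ker_chart x act l :: ('r \<Rightarrow> 'n) \<Rightarrow> _) F) \<and>
     (\<exists>!F. has_chart_modules x act (Im_chart x act l :: ('r \<Rightarrow> 'n) \<Rightarrow> _) F) \<and>
     (\<exists>!F. descends_to x act (Ker_module x act l :: ((('k, 'r) vec, 'n) vec \<Rightarrow> 'm) set) F) \<and>
     (\<exists>!F. descends_to x act (Im_module x act l :: ((('k, 'r) vec, 'n) vec \<Rightarrow> 'm) set) F) \<and>
     Ker_sheaf r x act l = \<R> x act (Ker_module x act l :: ((('k, 'r) vec, 'n) vec \<Rightarrow> 'm) set) \<and>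
     Im_sheaf r x act l = \<R> x act (Im_module x act l :: ((('k, 'r) vec, 'n) vec \<Rightarrow> 'm) set)"
proof -
  interpret M: module act by (rule M(1))
  interpret grassmannian_module x act "TYPE('r)"
    by unfold_locales (use V in \<open>auto simp: radical_complement_def\<close>)
  interpret Ker: descent x act "TYPE('r)" "Ker_module x act l" "Ker_chart x act l"
    by (rule descent_Ker[OF M(2)])
  interpret Im: descent x act "TYPE('r)" "Im_module x act l" "Im_chart x act l"
    by (rule descent_Im[OF M(2)])
  show ?thesis
    unfolding Ker_sheaf_def Im_sheaf_def
    using Ker.chart_modules_descend Im.chart_modules_descend by blast
qed

end
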